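(* Let $K$ be a field of characteristic zero and $R=K[x_1,\dots,x_n]$ the polynomial ring with the standard grading. For $p=(p_0,p_1,p_2,p_3)$ with coordinates in $K$, and $i=1,\dots,n$, put $$f_i=p_0x_i^2+p_1\Big(\sum_{j\neq i}x_j\Big)x_i+p_2\sum_{j\ne i}x_j^2+p_3\sum_{\substack{1\le k<l\le n\\ k,l\neq i}}x_kx_l .$$ Let $I=(f_1,\dots,f_n)$ and $A=R/I$, and let $e_1=x_1+\cdots+x_n$. Let $X=\{x_1,\dots,x_n\}=\bigsqcup_{i=1}^rX_i$ be a partition of the set of variables into $r$ nonempty subsets, let $n_i=|X_i|$, and let $G=S_{n_1}\times S_{n_2}\times\cdots\times S_{n_r}\subset S_n$ be the Young subgroup acting on $R$ so that $S_{n_k}$ permutes the variables in the block $X_k$ and fixes the variables in the other blocks. Let $S=K[y_1,\dots,y_r]$ be the polynomial ring in $r$ variables and let $\phi:S\to A$ be the $K$-algebra homomorphism defined by letting $\phi(y_i)$ be the image in $A$ of $\sum_{x\in X_i}x$. (a) If $f_1,\dots,f_n$ is a regular sequence and $e_1^2\notin I$, then $R^G/(I\cap R^G)$ is a complete intersection with the strong Lefschetz property. (b) There is a nonempty (Zariski) open subset $U$ of the projective space $\mathbb{P}^3=\{(p_0,p_1,p_2,p_3)\}$ such that, for every $p\in U$ for which $f_1,\dots,f_n$ is a regular sequence and $e_1^2\notin I$, the image $\phi(S)$ coincides with the ring of invariants $A^G$. In particular, $A^G$ has the standard grading if the parameters are general enough.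
   Context: The group $S_n$ acts on $R$ by $f^\sigma(x_1,\dots,x_n)=f(x_{\sigma(1)},\dots,x_{\sigma(n)})$; one has $f_i^\sigma=f_{\sigma(i)}$, so $I$ is stable under $S_n$ and $S_n$ (hence $G$) acts on $A$. $R^G$ and $A^G$ denote rings of invariants, graded by the grading inherited from $R$ and $A$ (where each variable has degree one); $A^G=R^G/(I\cap R^G)$. A graded algebra $\bigoplus_{i\ge0}A_i$ has the standard grading if it is generated over $A_0$ by elements of degree one. Strong Lefschetz property: let $V=\bigoplus_{i\ge 0}V_i$ be a finite-dimensional graded vector space and $L:V\to V$ a graded endomorphism of degree one ($L(V_i)\subset V_{i+1}$). $L$ is a strong Lefschetz element if there is an integer $c$ such that $V_i=0$ for $i\ge c+1$ and $L^{c-2i}:V_i\to V_{c-i}$ is bijective for all $i=0,1,\dots,\lfloor c/2\rfloor$. A graded (not necessarily standard graded) Artinian $K$-algebra $B=\bigoplus_i B_i$ with $B_0=K$ has the strong Lefschetz property if there is $l\in B_1$ such that multiplication by $l$ is a strong Lefschetz element of the graded endomorphisms of $B$. *)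

theory Defs
  imports
    "HOL-Algebra.Algebra"
    "HOL-Algebra.Algebraic_Closure_Type"
    "HOL-Library.Poly_Mapping"
    "HOL-Library.Numeral_Type"
    "HOL-Combinatorics.Permutations"
begin

section \<open>Graded algebras over a field\<close>

text \<open>
  A graded algebra over the field \<open>'k\<close> is a ring with a structure map \<open>emb\<close> from \<open>'k\<close> and
  homogeneous components \<open>hcomp\<close>. Restricting to a subring and passing to a quotient keep track
  of all the data; \<open>quot_alg\<close> only adds the two extra fields to the library quotient
  \<open>Quot\<close>.
\<close>

record ('b, 'k) galgebra = "'b ring" +
  emb :: "'k \<Rightarrow> 'b"
  hcomp :: "nat \<Rightarrow> 'b set"

definition sub_alg :: "('b, 'k) galgebra \<Rightarrow> 'b set \<Rightarrow> ('b, 'k) galgebra" where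
  "sub_alg B H = B\<lparr>carrier := H, hcomp := (\<lambda>d. hcomp B d \<inter> H)\<rparr>"

definition quot_alg :: "('b, 'k) galgebra \<Rightarrow> 'b set \<Rightarrow> ('b set, 'k) galgebra" where
  "quot_alg B J = ring.extend (B Quot J)
     (galgebra.fields (\<lambda>c. J +>\<^bsub>B\<^esub> emb B c) (\<lambda>d. (\<lambda>b. J +>\<^bsub>B\<^esub> b) ` hcomp B d))"

definition graded_algebra :: "('b, 'k::field) galgebra \<Rightarrow> bool" where
  "graded_algebra B \<longleftrightarrow>
     cring B \<and>
     emb B \<in> ring_hom ring_of_type_algebra B \<and>
     (\<forall>i. additive_subgroup (hcomp B i) B) \<and>
     (\<forall>c. emb B c \<in> hcomp B 0) \<and>
     (\<forall>i j. \<forall>a\<in>hcomp B i. \<forall>b\<in>hcomp B j. a \<otimes>\<^bsub>B\<^esub> b \<in> hcomp B (i + j)) \<and>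
     (\<forall>b\<in>carrier B. \<exists>!g. (\<forall>i. g i \<in> hcomp B i) \<and> finite {i. g i \<noteq> \<zero>\<^bsub>B\<^esub>} \<and>
        b = (\<Oplus>\<^bsub>B\<^esub>i\<in>{i. g i \<noteq> \<zero>\<^bsub>B\<^esub>}. g i))"

definition standard_graded :: "('b, 'k::field) galgebra \<Rightarrow> bool" where
  "standard_graded B \<longleftrightarrow>
     graded_algebra B \<and> generate_ring B (hcomp B 0 \<union> hcomp B 1) = carrier B"

text \<open>
  For \<open>V \<noteq> 0\<close> the integer \<open>c\<close> is necessarily nonnegative, and for \<open>V = 0\<close> one can take
  \<open>c = 0\<close>, so \<open>c\<close> may be taken to be a natural number.
\<close>

definition strong_lefschetz_element :: "(nat \<Rightarrow> 'b set) \<Rightarrow> 'b \<Rightarrow> ('b \<Rightarrow> 'b) \<Rightarrow> bool" where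
  "strong_lefschetz_element V z L \<longleftrightarrow>
     (\<exists>c. (\<forall>i\<ge>c + 1. V i = {z}) \<and>
          (\<forall>i\<le>c div 2. bij_betw (L ^^ (c - 2 * i)) (V i) (V (c - i))))"

definition strong_lefschetz_property :: "('b, 'k::field) galgebra \<Rightarrow> bool" where
  "strong_lefschetz_property B \<longleftrightarrow>
     graded_algebra B \<and>
     subfield (range (emb B)) B \<and>
     ring.finite_dimension B (range (emb B)) (carrier B) \<and>
     hcomp B 0 = range (emb B) \<and>
     (\<exists>l\<in>hcomp B 1. strong_lefschetz_element (hcomp B) \<zero>\<^bsub>B\<^esub> (\<lambda>b. l \<otimes>\<^bsub>B\<^esub> b))"

section \<open>Polynomial rings\<close>

type_synonym ('v, 'k) mpoly = "('v \<Rightarrow>\<^sub>0 nat) \<Rightarrow>\<^sub>0 'k"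

definition mconst :: "'k::comm_ring_1 \<Rightarrow> ('v, 'k) mpoly" where
  "mconst c = Poly_Mapping.single 0 c"

definition mvar :: "'v \<Rightarrow> ('v, 'k::comm_ring_1) mpoly" where
  "mvar v = Poly_Mapping.single (Poly_Mapping.single v 1) 1"

definition wdeg :: "('v \<Rightarrow> nat) \<Rightarrow> ('v \<Rightarrow>\<^sub>0 nat) \<Rightarrow> nat" where
  "wdeg w m = (\<Sum>v\<in>Poly_Mapping.keys m. w v * Poly_Mapping.lookup m v)"

definition whomogeneous :: "('v \<Rightarrow> nat) \<Rightarrow> nat \<Rightarrow> ('v, 'k::comm_ring_1) mpoly \<Rightarrow> bool" where
  "whomogeneous w d f \<longleftrightarrow> (\<forall>m\<in>Poly_Mapping.keys f. wdeg w m = d)"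

text \<open>The polynomial ring in the variables \<open>v \<in> V\<close>, graded by giving \<open>v\<close> the degree \<open>w v\<close>.\<close>

definition mpoly_alg :: "('v \<Rightarrow> nat) \<Rightarrow> 'v set \<Rightarrow> (('v, 'k::comm_ring_1) mpoly, 'k) galgebra" where
  "mpoly_alg w V =
     \<lparr>carrier = {f. \<forall>m\<in>Poly_Mapping.keys f. Poly_Mapping.keys m \<subseteq> V},
      monoid.mult = (*), one = 1, ring.zero = 0, ring.add = (+),
      emb = mconst,
      hcomp = (\<lambda>d. {f. (\<forall>m\<in>Poly_Mapping.keys f. Poly_Mapping.keys m \<subseteq> V) \<and> whomogeneous w d f})\<rparr>"

definition meval :: "('k::comm_ring_1 \<Rightarrow> 'b::comm_ring_1) \<Rightarrow> ('v \<Rightarrow> 'b) \<Rightarrow> ('v, 'k) mpoly \<Rightarrow> 'b" where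
  "meval h a f = (\<Sum>m\<in>Poly_Mapping.keys f. h (Poly_Mapping.lookup f m) * (\<Prod>v\<in>Poly_Mapping.keys m. a v ^ Poly_Mapping.lookup m v))"

abbreviation meval_at :: "('v \<Rightarrow> 'k::comm_ring_1) \<Rightarrow> ('v, 'k) mpoly \<Rightarrow> 'k" where
  "meval_at \<equiv> meval (\<lambda>c. c)"

abbreviation msubst :: "('v \<Rightarrow> ('w, 'k::comm_ring_1) mpoly) \<Rightarrow> ('v, 'k) mpoly \<Rightarrow> ('w, 'k) mpoly" where
  "msubst \<equiv> meval mconst"

section \<open>Regular sequences and complete intersections\<close>

text \<open>
  \<open>fs ! i\<close> is a nonzerodivisor modulo the preceding elements, and the quotient by all of them
  is nonzero.
\<close>

definition regular_sequence :: "('b, 'm) ring_scheme \<Rightarrow> 'b list \<Rightarrow> bool" where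
  "regular_sequence R fs \<longleftrightarrow>
     set fs \<subseteq> carrier R \<and>
     (\<forall>i<length fs. \<forall>g\<in>carrier R.
        fs ! i \<otimes>\<^bsub>R\<^esub> g \<in> Idl\<^bsub>R\<^esub> (set (take i fs)) \<longrightarrow> g \<in> Idl\<^bsub>R\<^esub> (set (take i fs))) \<and>
     Idl\<^bsub>R\<^esub> (set fs) \<noteq> carrier R"

text \<open>
  Graded complete intersection: isomorphic, as a graded algebra, to a polynomial ring with
  variables of positive (not necessarily equal) degrees modulo a homogeneous regular sequence.
\<close>

definition complete_intersection :: "('b, 'k::field) galgebra \<Rightarrow> bool" where
  "complete_intersection B \<longleftrightarrow>
     (\<exists>(m::nat) w (gs :: (nat, 'k) mpoly list) h.
        (\<forall>i<m. 0 < w i) \<and>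
        regular_sequence (mpoly_alg w {..<m}) gs \<and>
        (\<forall>g\<in>set gs. \<exists>d. whomogeneous w d g) \<and>
        (let Q = quot_alg (mpoly_alg w {..<m}) (Idl\<^bsub>mpoly_alg w {..<m}\<^esub> (set gs)) in
           h \<in> ring_iso Q B \<and>
           (\<forall>c. h (emb Q c) = emb B c) \<and>
           (\<forall>d. h ` hcomp Q d = hcomp B d)))"

section \<open>Zariski open subsets of projective space\<close>

definition proj_point :: "('i \<Rightarrow> 'k::field) \<Rightarrow> ('i \<Rightarrow> 'k) set" where
  "proj_point p = {q. \<exists>c. c \<noteq> 0 \<and> q = (\<lambda>i. c * p i)}"

definition proj_space :: "('i \<Rightarrow> 'k::field) set set" where
  "proj_space = proj_point ` {p. p \<noteq> (\<lambda>_. 0)}"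

definition proj_zero_locus :: "('i, 'k::field) mpoly set \<Rightarrow> ('i \<Rightarrow> 'k) set set" where
  "proj_zero_locus F = {proj_point p | p. p \<noteq> (\<lambda>_. 0) \<and> (\<forall>g\<in>F. meval_at p g = 0)}"

definition zariski_open :: "('i \<Rightarrow> 'k::field) set set \<Rightarrow> bool" where
  "zariski_open U \<longleftrightarrow>
     (\<exists>F. (\<forall>g\<in>F. \<exists>d. whomogeneous (\<lambda>_. 1) d g) \<and> U = proj_space - proj_zero_locus F)"

section \<open>The algebra \<open>A\<close> and its invariants\<close>

abbreviation R_alg :: "nat \<Rightarrow> ((nat, 'k::field) mpoly, 'k) galgebra" where
  "R_alg n \<equiv> mpoly_alg (\<lambda>_. 1) {1..n}"

definition quadric :: "nat \<Rightarrow> (4 \<Rightarrow> 'k::field) \<Rightarrow> nat \<Rightarrow> (nat, 'k) mpoly" where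
  "quadric n p i =
     mconst (p 0) * mvar i ^ 2
     + mconst (p 1) * (\<Sum>j\<in>{1..n} - {i}. mvar j) * mvar i
     + mconst (p 2) * (\<Sum>j\<in>{1..n} - {i}. mvar j ^ 2)
     + mconst (p 3) *
         (\<Sum>(k, l)\<in>{(k, l). 1 \<le> k \<and> k < l \<and> l \<le> n \<and> k \<noteq> i \<and> l \<noteq> i}. mvar k * mvar l)"

definition quadrics :: "nat \<Rightarrow> (4 \<Rightarrow> 'k::field) \<Rightarrow> (nat, 'k) mpoly list" where
  "quadrics n p = map (quadric n p) [1..<n + 1]"

definition I_ideal :: "nat \<Rightarrow> (4 \<Rightarrow> 'k::field) \<Rightarrow> (nat, 'k) mpoly set" where
  "I_ideal n p = Idl\<^bsub>R_alg n\<^esub> (set (quadrics n p))"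

definition A_alg :: "nat \<Rightarrow> (4 \<Rightarrow> 'k::field) \<Rightarrow> ((nat, 'k) mpoly set, 'k) galgebra" where
  "A_alg n p = quot_alg (R_alg n) (I_ideal n p)"

definition e1 :: "nat \<Rightarrow> (nat, 'k::field) mpoly" where
  "e1 n = (\<Sum>j\<in>{1..n}. mvar j)"

definition var_partition :: "nat \<Rightarrow> nat \<Rightarrow> (nat \<Rightarrow> nat set) \<Rightarrow> bool" where
  "var_partition n r Blk \<longleftrightarrow>
     (\<Union>i\<in>{1..r}. Blk i) = {1..n} \<and> disjoint_family_on Blk {1..r} \<and> (\<forall>i\<in>{1..r}. Blk i \<noteq> {})"

definition young_subgroup :: "nat \<Rightarrow> nat \<Rightarrow> (nat \<Rightarrow> nat set) \<Rightarrow> (nat \<Rightarrow> nat) set" where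
  "young_subgroup n r Blk = {\<sigma>. \<sigma> permutes {1..n} \<and> (\<forall>k\<in>{1..r}. \<sigma> ` Blk k = Blk k)}"

definition perm_act :: "(nat \<Rightarrow> nat) \<Rightarrow> (nat, 'k::field) mpoly \<Rightarrow> (nat, 'k) mpoly" where
  "perm_act \<sigma> = msubst (\<lambda>i. mvar (\<sigma> i))"

definition R_inv :: "nat \<Rightarrow> (nat \<Rightarrow> nat) set \<Rightarrow> (nat, 'k::field) mpoly set" where
  "R_inv n G = {f \<in> carrier (R_alg n). \<forall>\<sigma>\<in>G. perm_act \<sigma> f = f}"

text \<open>
  The ideal is stable under permutations of the variables, so the image of the coset of \<open>f\<close>
  under \<open>perm_act \<sigma>\<close> is the coset of \<open>perm_act \<sigma> f\<close>; this is the induced action on the quotient.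
\<close>

definition A_inv :: "nat \<Rightarrow> (4 \<Rightarrow> 'k::field) \<Rightarrow> (nat \<Rightarrow> nat) set \<Rightarrow> (nat, 'k) mpoly set set" where
  "A_inv n p G = {a \<in> carrier (A_alg n p). \<forall>\<sigma>\<in>G. perm_act \<sigma> ` a = a}"

text \<open>The algebras \<open>R\<^sup>G / (I \<inter> R\<^sup>G)\<close> and \<open>A\<^sup>G\<close>, with the gradings inherited from \<open>R\<close> and \<open>A\<close>.\<close>

definition RG_quot :: "nat \<Rightarrow> (4 \<Rightarrow> 'k::field) \<Rightarrow> (nat \<Rightarrow> nat) set \<Rightarrow> ((nat, 'k) mpoly set, 'k) galgebra" where
  "RG_quot n p G = quot_alg (sub_alg (R_alg n) (R_inv n G)) (I_ideal n p \<inter> R_inv n G)"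

definition AG_alg :: "nat \<Rightarrow> (4 \<Rightarrow> 'k::field) \<Rightarrow> (nat \<Rightarrow> nat) set \<Rightarrow> ((nat, 'k) mpoly set, 'k) galgebra" where
  "AG_alg n p G = sub_alg (A_alg n p) (A_inv n p G)"

definition phi :: "nat \<Rightarrow> (4 \<Rightarrow> 'k::field) \<Rightarrow> (nat \<Rightarrow> nat set) \<Rightarrow> (nat, 'k) mpoly \<Rightarrow> (nat, 'k) mpoly set" where
  "phi n p Blk g = I_ideal n p +>\<^bsub>R_alg n\<^esub> msubst (\<lambda>i. \<Sum>x\<in>Blk i. mvar x) g"

end

theory Submission
  imports Defs "HOL-Computational_Algebra.Formal_Power_Series"
begin

text \<open>
  The hypotheses force \<open>I\<close> to be generated by quadrics \<open>x\<^sub>i\<^sup>2 - s e\<^sub>1 x\<^sub>i - t e\<^sub>1\<^sup>2\<close>. With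
  \<open>z = e\<^sub>1\<close> and \<open>y\<^sub>i = x\<^sub>i - (s/2) e\<^sub>1\<close> these relations become \<open>y\<^sub>i\<^sup>2 = \<tau> z\<^sup>2\<close> and
  \<open>\<Sum> y\<^sub>i = \<kappa> z\<close>, so \<open>A\<close> is the cokernel of \<open>\<Sum> y\<^sub>i - \<kappa> z\<close> on the free \<open>K[z]\<close>-module
  \<open>K[z, y]/(y\<^sub>i\<^sup>2 - \<tau> z\<^sup>2)\<close> whose basis is formed by the squarefree monomials.

  A sum \<open>u\<close> of \<open>m\<close> of the \<open>y\<^sub>i\<close> satisfies a monic equation \<open>h\<^sub>m(u, z) = 0\<close> of degree \<open>m + 1\<close>
  (\<open>Hs\<close> below), and the elementary symmetric functions of these \<open>y\<^sub>i\<close> are polynomials in \<open>u\<close>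
  and \<open>z\<close>. Averaging over \<open>G\<close> therefore shows that the invariants are generated by \<open>z\<close> and the
  block sums \<open>u\<^sub>k\<close>, and in fact
  \<open>A\<^sup>G = K[z, u\<^sub>1, \<dots>, u\<^sub>r]/(h\<^bsub>n\<^sub>1\<^esub>(u\<^sub>1, z), \<dots>, h\<^bsub>n\<^sub>r\<^esub>(u\<^sub>r, z), \<Sum> u\<^sub>k - \<kappa> z)\<close>; the relations are a
  regular sequence because each \<open>h\<close> is monic in its own variable and \<open>h\<^sub>n(\<kappa>, 1) \<noteq> 0\<close>.

  For the strong Lefschetz property, \<open>A\<close> is spanned by strings \<open>z\<^sup>k D\<close> where \<open>D\<close> is a product of
  \<open>i\<close> differences \<open>y\<^sub>a - y\<^sub>b\<close> on disjoint pairs. On such a \<open>D\<close> the form \<open>\<kappa> z\<close> acts as the sum of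
  the remaining \<open>n - 2i\<close> variables, so \<open>h\<^bsub>n-2i\<^esub>(\<kappa>, 1) z\<^bsup>n-2i+1\<^esup> D = 0\<close>. This makes
  \<open>z\<^bsup>n-2i\<^esup>\<close> surjective from degree \<open>i\<close> to degree \<open>n - i\<close>, and it is bijective because the Hilbert
  series of a complete intersection of \<open>n\<close> quadrics is \<open>(1 + t)\<^sup>n\<close>. Taking invariants preserves
  bijectivity.
\<close>

locale ring_hom1 =
  fixes h :: "'a::comm_ring_1 \<Rightarrow> 'b::comm_ring_1"
  assumes hom_one [simp]: "h 1 = 1"
    and hom_add [simp]: "h (x + y) = h x + h y"
    and hom_mult [simp]: "h (x * y) = h x * h y"
begin

lemma hom_zero [simp]: "h 0 = 0"
  by (metis add_cancel_right_left hom_add)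

lemma hom_uminus [simp]: "h (- x) = - h x"
  by (metis hom_add hom_zero add.right_inverse add_eq_0_iff)

lemma hom_diff [simp]: "h (x - y) = h x - h y"
  by (metis diff_conv_add_uminus hom_add hom_uminus)

lemma hom_power [simp]: "h (x ^ n) = h x ^ n"
  by (induction n) auto

lemma hom_of_nat [simp]: "h (of_nat n) = of_nat n"
  by (induction n) auto

lemma hom_sum: "h (sum f A) = (\<Sum>x\<in>A. h (f x))"
  by (induction A rule: infinite_finite_induct) auto

lemma hom_prod: "h (prod f A) = (\<Prod>x\<in>A. h (f x))"
  by (induction A rule: infinite_finite_induct) auto

end

section \<open>Multivariate polynomials\<close>

lemma mconst_0 [simp]: "mconst 0 = 0"
  by (simp add: mconst_def)

lemma mconst_1 [simp]: "mconst 1 = 1"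
  by (simp add: mconst_def)

lemma mconst_add: "mconst (a + b) = mconst a + mconst b"
  by (simp add: mconst_def single_add)

lemma mconst_mult: "mconst (a * b) = mconst a * mconst b"
  by (simp add: mconst_def mult_single)

interpretation mconst: ring_hom1 mconst
  by unfold_locales (simp_all add: mconst_add mconst_mult)

lemma lookup_mconst_mult:
  "Poly_Mapping.lookup (mconst c * f) m = c * Poly_Mapping.lookup f m"
  unfolding mconst_def
  by (cases "c = 0") (simp_all flip: mult_map_scale_conv_mult add: Poly_Mapping.map.rep_eq when_def)

lemma mpoly_sum_single:
  "f = (\<Sum>m\<in>Poly_Mapping.keys f. Poly_Mapping.single m (Poly_Mapping.lookup f m))"
  by (rule poly_mapping_eqI)
    (auto simp: lookup_sum lookup_single when_def in_keys_iff sum.delta)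

lemma mvar_power: "mvar v ^ e = Poly_Mapping.single (Poly_Mapping.single v e) 1"
proof (induction e)
  case (Suc e)
  then show ?case
    by (simp only: power_Suc mvar_def mult_single flip: single_add) simp
qed simp

definition polys :: "'v set \<Rightarrow> ('v, 'k::comm_ring_1) mpoly set" where
  "polys V = {f. \<forall>m\<in>Poly_Mapping.keys f. Poly_Mapping.keys m \<subseteq> V}"

lemma keys_add_nat: "Poly_Mapping.keys (m + m' :: 'v \<Rightarrow>\<^sub>0 nat) = Poly_Mapping.keys m \<union> Poly_Mapping.keys m'"
  by (auto simp: in_keys_iff lookup_add)

lemma polys_add: "f \<in> polys V \<Longrightarrow> g \<in> polys V \<Longrightarrow> f + g \<in> polys V"
  unfolding polys_def using keys_add[of f g] by blast

lemma polys_uminus: "f \<in> polys V \<Longrightarrow> - f \<in> polys V"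
  unfolding polys_def by (auto simp: in_keys_iff)

lemma polys_diff: "f \<in> polys V \<Longrightarrow> g \<in> polys V \<Longrightarrow> f - g \<in> polys V"
  using polys_add[of f V "- g"] polys_uminus[of g V] by simp

lemma polys_mult: "f \<in> polys V \<Longrightarrow> g \<in> polys V \<Longrightarrow> f * g \<in> polys V"
  unfolding polys_def using keys_mult[of f g] by (fastforce simp: keys_add_nat)

lemma polys_mconst [simp]: "mconst c \<in> polys V"
  by (auto simp: polys_def mconst_def)

lemma polys_0 [simp]: "0 \<in> polys V" and polys_1 [simp]: "1 \<in> polys V"
  using polys_mconst[of 0 V] polys_mconst[of 1 V] by auto

lemma polys_of_nat [simp]: "of_nat k \<in> polys V"
  using polys_mconst[of "of_nat k" V] by simp

lemma polys_mvar: "v \<in> V \<Longrightarrow> mvar v \<in> polys V"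
  by (auto simp: polys_def mvar_def)

lemma polys_sum: "(\<And>x. x \<in> A \<Longrightarrow> f x \<in> polys V) \<Longrightarrow> sum f A \<in> polys V"
  by (induction A rule: infinite_finite_induct) (auto intro: polys_add)

lemma polys_prod: "(\<And>x. x \<in> A \<Longrightarrow> f x \<in> polys V) \<Longrightarrow> prod f A \<in> polys V"
  by (induction A rule: infinite_finite_induct) (auto intro: polys_mult)

lemma polys_power: "f \<in> polys V \<Longrightarrow> f ^ k \<in> polys V"
  by (induction k) (auto intro: polys_mult)

lemmas polys_intros = polys_add polys_uminus polys_diff polys_mult polys_mvar polys_sum polys_prod polys_power

lemma polys_mono: "V \<subseteq> W \<Longrightarrow> polys V \<subseteq> polys W"
  by (auto simp: polys_def)

lemma polys_UNIV [simp]: "polys UNIV = UNIV"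
  by (auto simp: polys_def)

lemma mpoly_induct [consumes 1, case_names const add mvar]:
  assumes f: "f \<in> polys V"
    and const: "\<And>c. P (mconst c)"
    and add: "\<And>f g. f \<in> polys V \<Longrightarrow> g \<in> polys V \<Longrightarrow> P f \<Longrightarrow> P g \<Longrightarrow> P (f + g)"
    and mvar: "\<And>v f. v \<in> V \<Longrightarrow> f \<in> polys V \<Longrightarrow> P f \<Longrightarrow> P (mvar v * f)"
  shows "P f"
proof -
  have pow: "P (mvar v ^ e * g) \<and> mvar v ^ e * g \<in> polys V" if "v \<in> V" "g \<in> polys V" "P g" for v e g
    using that by (induction e) (auto simp: mult.assoc intro!: mvar polys_intros)
  have mon: "P (Poly_Mapping.single (\<Sum>v\<in>A. Poly_Mapping.single v (e v)) c)
      \<and> Poly_Mapping.single (\<Sum>v\<in>A. Poly_Mapping.single v (e v)) c \<in> polys V"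
    if "finite A" "A \<subseteq> V" for A c and e :: "_ \<Rightarrow> nat"
    using that
  proof (induction A rule: finite_induct)
    case empty
    then show ?case using const[of c] polys_mconst[of c V] by (simp add: mconst_def)
  next
    case (insert v A)
    have "Poly_Mapping.single (\<Sum>v\<in>insert v A. Poly_Mapping.single v (e v)) c
      = mvar v ^ e v * Poly_Mapping.single (\<Sum>v\<in>A. Poly_Mapping.single v (e v)) c"
      using insert by (simp add: mvar_power mult_single)
    then show ?case using insert pow by auto
  qed
  have mon': "P (Poly_Mapping.single m c) \<and> Poly_Mapping.single m c \<in> polys V"
    if "Poly_Mapping.keys m \<subseteq> V" for m c
  proof -
    have "m = (\<Sum>v\<in>Poly_Mapping.keys m. Poly_Mapping.single v (Poly_Mapping.lookup m v))"
      by (rule poly_mapping_eqI) (auto simp: lookup_sum lookup_single when_def in_keys_iff sum.delta)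
    then show ?thesis
      using mon[OF finite_keys that, of "Poly_Mapping.lookup m" c] by simp
  qed
  have "P (\<Sum>m\<in>M. Poly_Mapping.single m (Poly_Mapping.lookup f m))
      \<and> (\<Sum>m\<in>M. Poly_Mapping.single m (Poly_Mapping.lookup f m)) \<in> polys V"
    if "finite M" "M \<subseteq> Poly_Mapping.keys f" for M
    using that
  proof (induction M rule: finite_induct)
    case empty
    show ?case using const[of 0] by simp
  next
    case (insert m M)
    have "Poly_Mapping.keys m \<subseteq> V" using insert.prems f by (auto simp: polys_def)
    from mon'[OF this] insert show ?case by (auto intro: add polys_add)
  qed
  from this[of "Poly_Mapping.keys f"] show ?thesis
    using mpoly_sum_single[of f] by simp
qed

subsection \<open>Substitution\<close>

definition mon_eval :: "('v \<Rightarrow> 'b::comm_ring_1) \<Rightarrow> ('v \<Rightarrow>\<^sub>0 nat) \<Rightarrow> 'b" where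
  "mon_eval a m = (\<Prod>v\<in>Poly_Mapping.keys m. a v ^ Poly_Mapping.lookup m v)"

lemma mon_eval_superset:
  assumes "finite A" "Poly_Mapping.keys m \<subseteq> A"
  shows "mon_eval a m = (\<Prod>v\<in>A. a v ^ Poly_Mapping.lookup m v)"
  unfolding mon_eval_def
  by (rule prod.mono_neutral_left) (use assms in \<open>auto simp: in_keys_iff\<close>)

lemma mon_eval_add: "mon_eval a (m + m') = mon_eval a m * mon_eval a m'"
  using mon_eval_superset[of "Poly_Mapping.keys (m + m')" m a]
    mon_eval_superset[of "Poly_Mapping.keys (m + m')" m' a]
  by (simp add: keys_add_nat mon_eval_def lookup_add power_add prod.distrib)

context
  fixes h :: "'k::comm_ring_1 \<Rightarrow> 'b::comm_ring_1"
  assumes h: "ring_hom1 h"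
begin

interpretation h: ring_hom1 h by (rule h)

lemma meval_superset:
  assumes "finite M" "Poly_Mapping.keys f \<subseteq> M"
  shows "meval h a f = (\<Sum>m\<in>M. h (Poly_Mapping.lookup f m) * mon_eval a m)"
  unfolding meval_def mon_eval_def
  by (rule sum.mono_neutral_left) (use assms in \<open>auto simp: in_keys_iff\<close>)

lemma meval_add: "meval h a (f + g) = meval h a f + meval h a g"
proof -
  let ?M = "Poly_Mapping.keys f \<union> Poly_Mapping.keys g"
  have "finite ?M" "Poly_Mapping.keys (f + g) \<subseteq> ?M" by (auto simp: keys_add)
  then show ?thesis
    using meval_superset[of ?M f a] meval_superset[of ?M g a] meval_superset[of ?M "f + g" a]
    by (simp add: lookup_add algebra_simps sum.distrib)
qed

lemma meval_single: "meval h a (Poly_Mapping.single m c) = h c * mon_eval a m"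
  by (cases "c = 0") (auto simp: meval_def mon_eval_def)

lemma meval_0: "meval h a 0 = 0"
  by (simp add: meval_def)

lemma meval_sum: "meval h a (sum f A) = (\<Sum>x\<in>A. meval h a (f x))"
  by (induction A rule: infinite_finite_induct) (auto simp: meval_add meval_0)

lemma meval_mult: "meval h a (f * g) = meval h a f * meval h a g"
proof -
  have "f * g = (\<Sum>m\<in>Poly_Mapping.keys f. \<Sum>m'\<in>Poly_Mapping.keys g.
      Poly_Mapping.single (m + m') (Poly_Mapping.lookup f m * Poly_Mapping.lookup g m'))"
    by (subst (1) mpoly_sum_single[of f], subst (1) mpoly_sum_single[of g])
      (simp add: sum_product mult_single)
  moreover have "meval h a f * meval h a g = (\<Sum>m\<in>Poly_Mapping.keys f. \<Sum>m'\<in>Poly_Mapping.keys g.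
      h (Poly_Mapping.lookup f m * Poly_Mapping.lookup g m') * mon_eval a (m + m'))"
    by (simp add: meval_def sum_product mon_eval_add flip: mon_eval_def) (simp add: mult_ac)
  ultimately show ?thesis by (simp add: meval_sum meval_single)
qed

lemma meval_ring_hom1: "ring_hom1 (meval h a)"
proof
  show "meval h a 1 = 1"
    using meval_single[of a 0 1] by (simp add: mon_eval_def)
qed (auto simp: meval_add meval_mult)

lemma meval_mconst [simp]: "meval h a (mconst c) = h c"
  using meval_single[of a 0 c] by (simp add: mon_eval_def mconst_def)

lemma meval_mvar [simp]: "meval h a (mvar v) = a v"
  using meval_single[of a "Poly_Mapping.single v 1" 1] by (simp add: mon_eval_def mvar_def)

end

lemmas msubst_mconst [simp] = meval_mconst[OF mconst.ring_hom1_axioms]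
lemmas msubst_mvar [simp] = meval_mvar[OF mconst.ring_hom1_axioms]

interpretation msubst: ring_hom1 "msubst a" for a
  by (rule meval_ring_hom1) unfold_locales

interpretation meval_at: ring_hom1 "meval_at a" for a
  by (rule meval_ring_hom1) (unfold_locales, auto)

lemma meval_at_mconst [simp]: "meval_at a (mconst c) = c"
  by (rule meval_mconst) (unfold_locales, auto)

lemma meval_at_mvar [simp]: "meval_at a (mvar v) = a v"
  by (rule meval_mvar) (unfold_locales, auto)

lemma ring_hom1_comp: "ring_hom1 f \<Longrightarrow> ring_hom1 g \<Longrightarrow> ring_hom1 (\<lambda>x. f (g x))"
  by (auto simp: ring_hom1_def)

lemma ring_hom1_mpoly_eqI:
  assumes "ring_hom1 f" "ring_hom1 g" "\<And>c. f (mconst c) = g (mconst c)"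
    and "\<And>v. v \<in> V \<Longrightarrow> f (mvar v) = g (mvar v)" and "p \<in> polys V"
  shows "f p = g p"
proof -
  interpret f: ring_hom1 f by fact
  interpret g: ring_hom1 g by fact
  show ?thesis using assms(5) by (induction rule: mpoly_induct) (auto simp: assms)
qed

lemma msubst_polys:
  assumes "p \<in> polys V" "\<And>v. v \<in> V \<Longrightarrow> a v \<in> polys W"
  shows "msubst a p \<in> polys W"
  using assms(1) by (induction rule: mpoly_induct) (auto intro: polys_intros assms)

lemma msubst_msubst:
  "msubst a (msubst b p) = msubst (\<lambda>v. msubst a (b v)) p"
  by (rule ring_hom1_mpoly_eqI[where V = UNIV])
    (auto intro: ring_hom1_comp msubst.ring_hom1_axioms)

lemma msubst_id_on: "p \<in> polys V \<Longrightarrow> (\<And>v. v \<in> V \<Longrightarrow> a v = mvar v) \<Longrightarrow> msubst a p = p"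
  by (induction rule: mpoly_induct) auto

lemma msubst_cong:
  "p \<in> polys V \<Longrightarrow> (\<And>v. v \<in> V \<Longrightarrow> a v = b v) \<Longrightarrow> msubst a p = msubst b p"
  by (induction rule: mpoly_induct) auto

definition restr :: "'v set \<Rightarrow> ('v, 'k::comm_ring_1) mpoly \<Rightarrow> ('v, 'k) mpoly" where
  "restr V = msubst (\<lambda>v. if v \<in> V then mvar v else 0)"

interpretation restr: ring_hom1 "restr V"
  unfolding restr_def by (rule msubst.ring_hom1_axioms)

lemma restr_polys: "restr V f \<in> polys V"
  unfolding restr_def by (rule msubst_polys[of _ UNIV]) (auto intro: polys_mvar)

lemma restr_id: "f \<in> polys V \<Longrightarrow> restr V f = f"
  unfolding restr_def by (rule msubst_id_on) auto

subsection \<open>Homogeneous components\<close>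

lemma wdeg_superset:
  assumes "finite A" "Poly_Mapping.keys m \<subseteq> A"
  shows "wdeg w m = (\<Sum>v\<in>A. w v * Poly_Mapping.lookup m v)"
  unfolding wdeg_def
  by (rule sum.mono_neutral_left) (use assms in \<open>auto simp: in_keys_iff\<close>)

lemma wdeg_add: "wdeg w (m + m') = wdeg w m + wdeg w m'"
  using wdeg_superset[of "Poly_Mapping.keys (m + m')" m w]
    wdeg_superset[of "Poly_Mapping.keys (m + m')" m' w]
  by (simp add: keys_add_nat wdeg_def lookup_add algebra_simps sum.distrib)

lemma wdeg_0 [simp]: "wdeg w 0 = 0"
  by (simp add: wdeg_def)

lemma wdeg_single [simp]: "wdeg w (Poly_Mapping.single v e) = w v * e"
  by (cases "e = 0") (auto simp: wdeg_def)

lemma whomogeneous_0 [simp]: "whomogeneous w d 0"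
  by (simp add: whomogeneous_def)

lemma whomogeneous_add: "whomogeneous w d f \<Longrightarrow> whomogeneous w d g \<Longrightarrow> whomogeneous w d (f + g)"
  unfolding whomogeneous_def using keys_add[of f g] by blast

lemma whomogeneous_uminus: "whomogeneous w d f \<Longrightarrow> whomogeneous w d (- f)"
  unfolding whomogeneous_def by (auto simp: in_keys_iff)

lemma whomogeneous_diff: "whomogeneous w d f \<Longrightarrow> whomogeneous w d g \<Longrightarrow> whomogeneous w d (f - g)"
  using whomogeneous_add[of w d f "- g"] whomogeneous_uminus[of w d g] by simp

lemma whomogeneous_mult:
  "whomogeneous w d f \<Longrightarrow> whomogeneous w e g \<Longrightarrow> whomogeneous w (d + e) (f * g)"
  unfolding whomogeneous_def using keys_mult[of f g] by (fastforce simp: wdeg_add)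

lemma whomogeneous_mconst [simp]: "whomogeneous w 0 (mconst c)"
  by (simp add: whomogeneous_def mconst_def)

lemma whomogeneous_mconst_mult: "whomogeneous w d f \<Longrightarrow> whomogeneous w d (mconst c * f)"
  using whomogeneous_mult[of w 0 "mconst c" d f] by simp

lemma whomogeneous_1 [simp]: "whomogeneous w 0 1"
  using whomogeneous_mconst[of w 1] by simp

lemma whomogeneous_mvar: "w v = d \<Longrightarrow> whomogeneous w d (mvar v)"
  by (simp add: whomogeneous_def mvar_def)

lemma whomogeneous_sum: "(\<And>x. x \<in> A \<Longrightarrow> whomogeneous w d (f x)) \<Longrightarrow> whomogeneous w d (sum f A)"
  by (induction A rule: infinite_finite_induct) (auto intro: whomogeneous_add)

lemma whomogeneous_power: "whomogeneous w d f \<Longrightarrow> whomogeneous w (d * k) (f ^ k)"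
  by (induction k) (auto intro: whomogeneous_mult)

lemma whomogeneous_prod:
  "(\<And>x. x \<in> A \<Longrightarrow> whomogeneous w (d x) (f x)) \<Longrightarrow> whomogeneous w (sum d A) (prod f A)"
  by (induction A rule: infinite_finite_induct) (auto intro: whomogeneous_mult)

definition hpart :: "('v \<Rightarrow> nat) \<Rightarrow> nat \<Rightarrow> ('v, 'k::comm_ring_1) mpoly \<Rightarrow> ('v, 'k) mpoly" where
  "hpart w d f = (\<Sum>m\<in>{m\<in>Poly_Mapping.keys f. wdeg w m = d}. Poly_Mapping.single m (Poly_Mapping.lookup f m))"

lemma lookup_hpart:
  "Poly_Mapping.lookup (hpart w d f) m = (if wdeg w m = d then Poly_Mapping.lookup f m else 0)"
  unfolding hpart_def
  by (auto simp: lookup_sum lookup_single when_def in_keys_iff sum.delta)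

lemma hpart_add: "hpart w d (f + g) = hpart w d f + hpart w d g"
  by (rule poly_mapping_eqI) (simp add: lookup_hpart lookup_add)

lemma hpart_0 [simp]: "hpart w d 0 = 0"
  by (rule poly_mapping_eqI) (simp add: lookup_hpart)

lemma hpart_diff: "hpart w d (f - g) = hpart w d f - hpart w d g"
  by (rule poly_mapping_eqI) (simp add: lookup_hpart lookup_minus)

lemma hpart_sum: "hpart w d (sum f A) = (\<Sum>x\<in>A. hpart w d (f x))"
  by (induction A rule: infinite_finite_induct) (auto simp: hpart_add)

lemma hpart_mconst_mult: "hpart w d (mconst c * f) = mconst c * hpart w d f"
  by (rule poly_mapping_eqI) (simp add: lookup_hpart lookup_mconst_mult)

lemma keys_hpart: "Poly_Mapping.keys (hpart w d f) = {m\<in>Poly_Mapping.keys f. wdeg w m = d}"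
  by (auto simp: in_keys_iff lookup_hpart split: if_splits)

lemma whomogeneous_hpart [simp]: "whomogeneous w d (hpart w d f)"
  by (auto simp: whomogeneous_def keys_hpart)

lemma hpart_homogeneous: "whomogeneous w e f \<Longrightarrow> hpart w d f = (if d = e then f else 0)"
  by (rule poly_mapping_eqI) (auto simp: lookup_hpart whomogeneous_def in_keys_iff)

lemma hpart_polys: "f \<in> polys V \<Longrightarrow> hpart w d f \<in> polys V"
  by (auto simp: polys_def keys_hpart)

lemma sum_hpart:
  assumes "finite D" "wdeg w ` Poly_Mapping.keys f \<subseteq> D"
  shows "(\<Sum>d\<in>D. hpart w d f) = f"
proof (rule poly_mapping_eqI)
  fix m
  have "Poly_Mapping.lookup f m = 0" if "wdeg w m \<notin> D"
  proof -
    have "m \<notin> Poly_Mapping.keys f" using assms(2) that by blast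
    then show ?thesis by (simp add: in_keys_iff)
  qed
  then show "Poly_Mapping.lookup (\<Sum>d\<in>D. hpart w d f) m = Poly_Mapping.lookup f m"
    using assms(1) by (auto simp: lookup_sum lookup_hpart)
qed

lemma hpart_mult_homogeneous:
  assumes "whomogeneous w e f"
  shows "hpart w d (f * g) = (if e \<le> d then f * hpart w (d - e) g else 0)"
proof -
  let ?D = "wdeg w ` Poly_Mapping.keys g"
  have g: "hpart w j g = 0" if "j \<notin> ?D" for j
    using that by (intro poly_mapping_eqI) (auto simp: lookup_hpart in_keys_iff)
  have "f * g = (\<Sum>j\<in>?D. f * hpart w j g)"
    by (simp add: sum_hpart flip: sum_distrib_left)
  then have "hpart w d (f * g) = (\<Sum>j\<in>?D. if d = e + j then f * hpart w j g else 0)"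
    by (simp add: hpart_sum hpart_homogeneous[OF whomogeneous_mult[OF assms whomogeneous_hpart]])
  also have "\<dots> = (\<Sum>j\<in>?D. if j = d - e \<and> e \<le> d then f * hpart w j g else 0)"
    by (intro sum.cong) auto
  also have "\<dots> = (if e \<le> d then f * hpart w (d - e) g else 0)"
    using g[of "d - e"] by (auto simp: sum.delta)
  finally show ?thesis .
qed

lemma hpart_msubst:
  assumes "\<And>v. whomogeneous u (w v) (a v)"
  shows "hpart u d (msubst a f) = msubst a (hpart w d f)"
proof -
  have mon: "whomogeneous u (wdeg w m) (mon_eval a m)" for m
    unfolding mon_eval_def wdeg_def by (intro whomogeneous_prod whomogeneous_power assms)
  have "hpart u d (msubst a f) = (\<Sum>m\<in>Poly_Mapping.keys f. if d = wdeg w m then mconst (Poly_Mapping.lookup f m) * mon_eval a m else 0)"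
    by (simp add: meval_def hpart_sum flip: mon_eval_def)
      (simp add: hpart_homogeneous[OF whomogeneous_mconst_mult[OF mon]])
  also have "\<dots> = (\<Sum>m\<in>Poly_Mapping.keys (hpart w d f). mconst (Poly_Mapping.lookup (hpart w d f) m) * mon_eval a m)"
    unfolding keys_hpart by (rule sum.mono_neutral_cong_right) (auto simp: lookup_hpart)
  finally show ?thesis by (simp add: meval_def mon_eval_def)
qed

section \<open>Ideals\<close>

interpretation idl: Modules.module "(*) :: 'a::comm_ring_1 \<Rightarrow> 'a \<Rightarrow> 'a"
  by unfold_locales (auto simp: algebra_simps)

declare idl.scale_scale [simp del]

abbreviation ideal_gen :: "'a::comm_ring_1 set \<Rightarrow> 'a set" where
  "ideal_gen \<equiv> idl.span"

lemma ideal_gen_mult_right: "f \<in> ideal_gen F \<Longrightarrow> f * g \<in> ideal_gen F"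
  using idl.span_scale[of f F g] by (simp add: mult.commute)

lemma ideal_gen_hom:
  assumes "ring_hom1 h" "\<And>f. f \<in> F \<Longrightarrow> h f \<in> ideal_gen F'" "f \<in> ideal_gen F"
  shows "h f \<in> ideal_gen F'"
proof -
  interpret h: ring_hom1 h by fact
  show ?thesis using assms(3)
    by (induction rule: idl.span_induct_alt)
      (auto intro: idl.span_add idl.span_scale idl.span_zero assms(2))
qed

lemma ideal_gen_hpart:
  assumes "\<And>f. f \<in> F \<Longrightarrow> \<exists>d. whomogeneous w d f" "f \<in> ideal_gen F"
  shows "hpart w d f \<in> ideal_gen F"
  using assms(2)
proof (induction rule: idl.span_induct_alt)
  case (step c x y)
  obtain e where e: "whomogeneous w e x" using assms(1) step by blast
  have "hpart w d (c * x) \<in> ideal_gen F"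
    using hpart_mult_homogeneous[OF e, of d c] idl.span_base[OF step(1)]
    by (auto simp: mult.commute[of c] intro: ideal_gen_mult_right idl.span_zero)
  then show ?case using step by (auto simp: hpart_add intro: idl.span_add)
qed (auto intro: idl.span_zero)

lemma ideal_gen_eqI:
  "F \<subseteq> ideal_gen F' \<Longrightarrow> F' \<subseteq> ideal_gen F \<Longrightarrow> ideal_gen F = ideal_gen F'"
  by (simp add: idl.span_eq)

subsection \<open>The polynomial algebra\<close>

lemma mpoly_alg_simps [simp]:
  "carrier (mpoly_alg w V) = polys V" "monoid.mult (mpoly_alg w V) = (*)" "one (mpoly_alg w V) = 1"
  "ring.zero (mpoly_alg w V) = 0" "ring.add (mpoly_alg w V) = (+)" "emb (mpoly_alg w V) = mconst"
  "hcomp (mpoly_alg w V) d = {f \<in> polys V. whomogeneous w d f}"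
  by (auto simp: mpoly_alg_def polys_def)

lemma mpoly_alg_cring: "cring (mpoly_alg w V)"
proof (rule cringI)
  show "abelian_group (mpoly_alg w V)"
  proof (rule abelian_groupI)
    fix x assume "x \<in> carrier (mpoly_alg w V)"
    then show "\<exists>y\<in>carrier (mpoly_alg w V). y \<oplus>\<^bsub>mpoly_alg w V\<^esub> x = \<zero>\<^bsub>mpoly_alg w V\<^esub>"
      by (intro bexI[of _ "- x"]) (auto intro: polys_uminus)
  qed (simp_all add: polys_add add.assoc add.commute)
  show "comm_monoid (mpoly_alg w V)"
    by (rule comm_monoidI) (auto simp: algebra_simps polys_mult)
qed (auto simp: algebra_simps)

lemma genideal_mpoly_alg:
  assumes "F \<subseteq> polys V"
  shows "genideal (mpoly_alg w V) F = ideal_gen F \<inter> polys V"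
proof -
  interpret cring "mpoly_alg w V" by (rule mpoly_alg_cring)
  let ?I = "genideal (mpoly_alg w V) F"
  have I: "ideal ?I (mpoly_alg w V)" by (rule genideal_ideal) (use assms in auto)
  interpret I: ideal ?I "mpoly_alg w V" by (rule I)
  have "ideal (ideal_gen F \<inter> polys V) (mpoly_alg w V)"
  proof (rule idealI)
    show "ring (mpoly_alg w V)" by (rule ring_axioms)
    have inv: "inv\<^bsub>add_monoid (mpoly_alg w V)\<^esub> x = - x" if "x \<in> polys V" for x
      unfolding a_inv_def[symmetric]
      by (rule minus_equality) (use that in \<open>auto intro: polys_uminus\<close>)
    show "subgroup (ideal_gen F \<inter> polys V) (add_monoid (mpoly_alg w V))"
    proof (rule subgroup.intro)
      fix x assume x: "x \<in> ideal_gen F \<inter> polys V"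
      then show "inv\<^bsub>add_monoid (mpoly_alg w V)\<^esub> x \<in> ideal_gen F \<inter> polys V"
        by (subst inv) (auto intro: idl.span_neg polys_uminus)
    qed (auto intro: idl.span_add idl.span_zero polys_add)
  qed (auto intro: idl.span_scale ideal_gen_mult_right polys_mult)
  then have 1: "?I \<subseteq> ideal_gen F \<inter> polys V"
    by (rule genideal_minimal) (use assms in \<open>auto intro: idl.span_base\<close>)
  have "restr V f \<in> ?I" if "f \<in> ideal_gen F" for f
    using that
  proof (induction rule: idl.span_induct_alt)
    case base
    then show ?case using I.zero_closed by simp
  next
    case (step c x y)
    have "restr V (c * x + y) = restr V c * x + restr V y"
      using restr_id[of x] step assms by auto
    moreover have "x \<in> ?I" using genideal_self[of F] assms step by auto
    then have "restr V c * x \<in> ?I" using I.I_l_closed[of x "restr V c"] by (simp add: restr_polys)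
    ultimately show ?case using step I.a_closed[of "restr V c * x" "restr V y"] by simp
  qed
  then have "ideal_gen F \<inter> polys V \<subseteq> ?I" using restr_id by force
  with 1 show ?thesis by blast
qed

section \<open>Square-zero deformations and elementary symmetric functions\<close>

fun Hs :: "'a::comm_ring_1 \<Rightarrow> 'a \<Rightarrow> nat \<Rightarrow> nat \<Rightarrow> 'a" where
  "Hs q u m 0 = 1"
| "Hs q u m (Suc 0) = u"
| "Hs q u m (Suc (Suc j)) =
     u * Hs q u m (Suc j) - of_nat (Suc j) * (of_nat m - of_nat j) * q * Hs q u m j"

lemma (in ring_hom1) hom_Hs: "h (Hs q u m j) = Hs (h q) (h u) m j"
  by (induction q u m j rule: Hs.induct) auto

lemma Hs_scale: "Hs (c * z ^ 2) (k * z) m j = Hs c k m j * z ^ j"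
  by (induction c k m j rule: Hs.induct) (auto simp: algebra_simps power2_eq_square)

lemma Hs_diff_dvd: "(u - v) dvd (Hs q u m j - Hs q v m j)"
proof (induction q u m j rule: Hs.induct)
  case (3 q u m j)
  have "Hs q u m (Suc (Suc j)) - Hs q v m (Suc (Suc j)) =
    u * (Hs q u m (Suc j) - Hs q v m (Suc j)) + (u - v) * Hs q v m (Suc j)
    - of_nat (Suc j) * (of_nat m - of_nat j) * q * (Hs q u m j - Hs q v m j)"
    by (simp add: algebra_simps)
  then show ?case using 3 by (simp add: dvd_add dvd_diff)
qed auto

definition esym :: "('i \<Rightarrow> 'a::comm_ring_1) \<Rightarrow> 'i set \<Rightarrow> nat \<Rightarrow> 'a" where
  "esym y T j = coeff (\<Prod>i\<in>T. [:1, y i:]) j"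

lemma esym_empty [simp]: "esym y {} j = (if j = 0 then 1 else 0)"
  by (simp add: esym_def coeff_1)

lemma esym_insert_Suc:
  "finite T \<Longrightarrow> i \<notin> T \<Longrightarrow> esym y (insert i T) (Suc j) = esym y T (Suc j) + y i * esym y T j"
  by (simp add: esym_def)

lemma esym_0 [simp]: "finite T \<Longrightarrow> esym y T 0 = 1"
  by (induction T rule: finite_induct) (simp_all add: esym_def)

lemma esym_eq_0: "finite T \<Longrightarrow> card T < j \<Longrightarrow> esym y T j = 0"
proof (induction T arbitrary: j rule: finite_induct)
  case (insert i T)
  from insert.prems obtain l where l: "j = Suc l" by (cases j) auto
  have "esym y T (Suc l) = 0" "esym y T l = 0"
    by (rule insert.IH; use insert.hyps insert.prems l in simp)+
  then show ?case unfolding l esym_insert_Suc[OF insert.hyps(1,2)] by simp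
qed auto

lemma esym_1: "finite T \<Longrightarrow> esym y T (Suc 0) = sum y T"
  by (induction T rule: finite_induct) (auto simp: esym_insert_Suc)

lemma esym_polys: "finite T \<Longrightarrow> esym mvar T j \<in> polys T"
proof (induction T arbitrary: j rule: finite_induct)
  case empty
  then show ?case by auto
next
  case (insert i T)
  then show ?case using polys_mono[of T "insert i T"]
    by (cases j) (auto simp: esym_insert_Suc intro!: polys_intros)
qed

lemma esym_rec:
  assumes "idl.subspace J" "finite T" "\<And>i. i \<in> T \<Longrightarrow> y i ^ 2 - q \<in> J"
  shows "sum y T * esym y T (Suc j) - (of_nat (Suc (Suc j)) * esym y T (Suc (Suc j))
           + (of_nat (card T) - of_nat j) * q * esym y T j) \<in> J"
  using assms(2,3)
proof (induction T arbitrary: j rule: finite_induct)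
  case empty
  then show ?case using assms(1) by (auto simp: idl.subspace_0)
next
  case (insert i T)
  define u m where "u = sum y T" and "m = (of_nat (card T) :: 'a)"
  have c: "of_nat (card (insert i T)) = 1 + m" "sum y (insert i T) = y i + u"
    using insert by (auto simp: m_def u_def)
  have sq: "y i ^ 2 - q \<in> J" using insert by auto
  have IH: "u * esym y T (Suc j) - (of_nat (Suc (Suc j)) * esym y T (Suc (Suc j))
           + (m - of_nat j) * q * esym y T j) \<in> J" for j
    using insert by (simp add: u_def m_def)
  show ?case
  proof (cases j)
    case 0
    have e: "esym y T (Suc 0) = u" "esym y T 0 = 1" using insert by (simp_all add: esym_1 u_def)
    have "(y i + u) * (u + y i) - (of_nat (Suc (Suc 0)) * (esym y T (Suc (Suc 0)) + y i * u)
      + (1 + m - of_nat 0) * q * 1)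
      = (u * u - (2 * esym y T (Suc (Suc 0)) + m * q)) + (y i ^ 2 - q)"
      by (simp add: algebra_simps power2_eq_square)
    also have "\<dots> \<in> J"
      using idl.subspace_add[OF assms(1) IH[of 0] sq] by (simp add: e)
    finally show ?thesis unfolding c 0 esym_insert_Suc[OF insert(1,2)] e
      using insert(1) by (simp only: esym_0 finite_insert mult_1_right)
  next
    case (Suc l)
    let ?e = "esym y T"
    have "(y i + u) * (?e (Suc j) + y i * ?e j) - (of_nat (Suc (Suc j)) * (?e (Suc (Suc j)) + y i * ?e (Suc j))
        + (1 + m - of_nat j) * q * (?e j + y i * ?e l)) =
        (u * ?e (Suc j) - (of_nat (Suc (Suc j)) * ?e (Suc (Suc j)) + (m - of_nat j) * q * ?e j))
      + y i * (u * ?e (Suc l) - (of_nat (Suc (Suc l)) * ?e (Suc (Suc l)) + (m - of_nat l) * q * ?e l))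
      + ?e j * (y i ^ 2 - q)"
      unfolding Suc by (simp add: algebra_simps power2_eq_square)
    also have "\<dots> \<in> J"
      by (intro idl.subspace_add[OF assms(1)] idl.subspace_scale[OF assms(1)] IH sq)
    finally show ?thesis unfolding c esym_insert_Suc[OF insert(1,2)]
      unfolding Suc esym_insert_Suc[OF insert(1,2)] .
  qed
qed

text \<open>
  Up to the factor \<open>j!\<close>, \<open>Hs\<close> computes the elementary symmetric functions of elements with
  the common square \<open>q\<close> from their sum \<open>u\<close> alone.
\<close>
lemma Hs_esym:
  fixes y :: "'i \<Rightarrow> 'a::comm_ring_1"
  assumes "idl.subspace J" "finite T" "\<And>i. i \<in> T \<Longrightarrow> y i ^ 2 - q \<in> J"
  shows "Hs q (sum y T) (card T) j - of_nat (fact j) * esym y T j \<in> J"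
proof (induction j rule: less_induct)
  case (less j)
  consider "j = 0" | "j = 1" | l where "j = Suc (Suc l)"
    by (metis One_nat_def not0_implies_Suc)
  then show ?case
  proof cases
    case (3 l)
    define F where "F = (of_nat (fact l) :: 'a)"
    define L where "L = (of_nat (Suc l) :: 'a)"
    define m u where "m = (of_nat (card T) - of_nat l :: 'a)" and "u = sum y T"
    have f: "of_nat (fact (Suc l)) = L * F"
      "of_nat (fact j) = L * F * of_nat (Suc (Suc l))"
      unfolding 3 F_def L_def by (simp_all add: mult.commute algebra_simps)
    have 1: "Hs q u (card T) (Suc l) - L * F * esym y T (Suc l) \<in> J"
      using less[of "Suc l"] 3 unfolding f u_def by simp
    have 2: "Hs q u (card T) l - F * esym y T l \<in> J"
      using less[of l] 3 unfolding F_def u_def by simp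
    have R: "u * esym y T (Suc l) - (of_nat (Suc (Suc l)) * esym y T (Suc (Suc l))
           + m * q * esym y T l) \<in> J"
      using esym_rec[OF assms, where j = l] unfolding u_def m_def .
    have "Hs q u (card T) j - of_nat (fact j) * esym y T j =
      u * (Hs q u (card T) (Suc l) - L * F * esym y T (Suc l))
      - (L * m * q) * (Hs q u (card T) l - F * esym y T l)
      + (L * F) * (u * esym y T (Suc l) - (of_nat (Suc (Suc l)) * esym y T (Suc (Suc l))
           + m * q * esym y T l))"
      unfolding f unfolding 3 Hs.simps(3) unfolding L_def[symmetric] m_def[symmetric]
      by (simp only: algebra_simps)
    also have "\<dots> \<in> J"
      by (intro idl.subspace_add[OF assms(1)] idl.subspace_diff[OF assms(1)]
          idl.subspace_scale[OF assms(1)] 1 2 R)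
    finally show ?thesis unfolding u_def .
  qed (use assms in \<open>auto simp: esym_1 idl.subspace_0\<close>)
qed

lemma Hs_sum_mem:
  assumes "idl.subspace J" "finite T" "\<And>i. i \<in> T \<Longrightarrow> y i ^ 2 - q \<in> J"
  shows "Hs q (sum y T) (card T) (Suc (card T)) \<in> J"
  using Hs_esym[OF assms, where j = "Suc (card T)"] assms(2) by (simp add: esym_eq_0)

lemma Hs_monic:
  fixes q :: "'a::comm_ring_1"
  shows "degree (Hs [:q:] [:0, 1:] m j) = j \<and> lead_coeff (Hs [:q:] [:0, 1:] m j) = 1"
proof -
  have "coeff (Hs [:q:] [:0, 1:] m j) j = 1 \<and> (\<forall>i>j. coeff (Hs [:q:] [:0, 1:] m j) i = 0)"
  proof (induction j rule: less_induct)
    case (less j)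
    consider "j = 0" | "j = 1" | l where "j = Suc (Suc l)"
      by (metis One_nat_def not0_implies_Suc)
    then show ?case
    proof cases
      case (3 l)
      define c where "c = of_nat (Suc l) * (of_nat m - of_nat l) * q"
      have "of_nat (Suc l) * (of_nat m - of_nat l) * [:q:] = [:c:]"
        by (simp add: c_def of_nat_poly)
      then have H: "Hs [:q:] [:0, 1:] m j = [:0, 1:] * Hs [:q:] [:0, 1:] m (Suc l) - smult c (Hs [:q:] [:0, 1:] m l)"
        unfolding 3 Hs.simps(3) by simp
      show ?thesis unfolding H using less[of "Suc l"] less[of l] 3
        by (auto simp: coeff_pCons split: nat.splits)
    qed (auto simp: coeff_pCons split: nat.splits)
  qed
  moreover from this have "degree (Hs [:q:] [:0, 1:] m j) = j"
    by (metis degree_le le_antisym le_degree zero_neq_one)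
  ultimately show ?thesis by simp
qed

section \<open>Monic polynomials in one variable\<close>

lemma monic_coeff_mem:
  fixes A p :: "'a::comm_ring_1 poly"
  assumes J: "idl.subspace J" and p: "lead_coeff p = 1"
    and mem: "\<And>i. degree p \<le> i \<Longrightarrow> coeff (A * p) i \<in> J"
  shows "coeff A i \<in> J"
proof -
  have "\<forall>i. degree A < i + k \<longrightarrow> coeff A i \<in> J" for k
  proof (induction k)
    case 0
    then show ?case by (auto simp: coeff_eq_0 idl.subspace_0[OF J])
  next
    case (Suc k)
    show ?case
    proof (intro allI impI)
      fix i assume i: "degree A < i + Suc k"
      let ?d = "degree p"
      have "coeff (A * p) (i + ?d) = (\<Sum>a\<le>i + ?d. coeff A a * coeff p (i + ?d - a))"
        by (rule coeff_mult)
      also have "\<dots> = coeff A i * coeff p ?d + (\<Sum>a\<in>{..i + ?d} - {i}. coeff A a * coeff p (i + ?d - a))"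
        by (subst sum.remove[of _ i]) auto
      finally have "coeff A i = coeff (A * p) (i + ?d) - (\<Sum>a\<in>{..i + ?d} - {i}. coeff A a * coeff p (i + ?d - a))"
        using p by simp
      also have "\<dots> \<in> J"
      proof (intro idl.subspace_diff[OF J] idl.subspace_sum[OF J] mem)
        fix a assume a: "a \<in> {..i + ?d} - {i}"
        show "coeff A a * coeff p (i + ?d - a) \<in> J"
        proof (cases "a < i")
          case True
          then show ?thesis by (simp add: coeff_eq_0 idl.subspace_0[OF J])
        next
          case False
          then have "coeff A a \<in> J" using Suc a i by auto
          then show ?thesis using idl.subspace_scale[OF J] by (simp add: mult.commute)
        qed
      qed simp
      finally show "coeff A i \<in> J" .
    qed
  qed
  from this[of "Suc (degree A)"] show ?thesis by auto
qed

definition to_poly :: "'v \<Rightarrow> ('v, 'k::comm_ring_1) mpoly \<Rightarrow> ('v, 'k) mpoly poly" where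
  "to_poly v = meval (\<lambda>c. [:mconst c:]) (\<lambda>w. if w = v then [:0, 1:] else [:mvar w:])"

lemma ring_hom1_poly_const: "ring_hom1 (\<lambda>c. [:mconst c:])"
  by unfold_locales (auto simp: mconst_add mconst_mult)

interpretation to_poly: ring_hom1 "to_poly v"
  unfolding to_poly_def by (rule meval_ring_hom1[OF ring_hom1_poly_const])

lemma to_poly_mconst [simp]: "to_poly v (mconst c) = [:mconst c:]"
  and to_poly_mvar [simp]: "to_poly v (mvar w) = (if w = v then [:0, 1:] else [:mvar w:])"
  unfolding to_poly_def
  by (simp_all add: meval_mconst[OF ring_hom1_poly_const] meval_mvar[OF ring_hom1_poly_const])

lemma to_poly_polys: "f \<in> polys V \<Longrightarrow> v \<notin> V \<Longrightarrow> to_poly v f = [:f:]"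
  by (induction rule: mpoly_induct) auto

lemma poly_to_poly: "poly (to_poly v f) (mvar v) = f"
proof -
  have "f \<in> polys UNIV" by simp
  then show ?thesis by (induction rule: mpoly_induct) auto
qed

lemma coeff_to_poly_ideal:
  assumes "F \<subseteq> polys V" "v \<notin> V" "f \<in> ideal_gen F"
  shows "coeff (to_poly v f) i \<in> ideal_gen F"
  using assms(3)
proof (induction rule: idl.span_induct_alt)
  case (step c x y)
  have "to_poly v x = [:x:]" using assms step by (auto intro: to_poly_polys)
  then show ?case using step
    by (auto simp: mult.commute[of x] intro!: idl.span_add idl.span_scale[OF idl.span_base])
qed (auto intro: idl.span_zero)

lemma ideal_coeff_to_poly:
  assumes "idl.subspace J" "\<And>i. coeff (to_poly v f) i \<in> J"
  shows "f \<in> J"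
proof -
  have "f = (\<Sum>i\<le>degree (to_poly v f). mvar v ^ i * coeff (to_poly v f) i)"
    using poly_to_poly[of v f] by (simp add: poly_altdef mult.commute)
  also have "\<dots> \<in> J"
    by (intro idl.subspace_sum[OF assms(1)] idl.subspace_scale[OF assms(1)] assms(2))
  finally show ?thesis .
qed

lemma monic_regular:
  assumes "F \<subseteq> polys V" "v \<notin> V" "lead_coeff (to_poly v h) = 1" "h * g \<in> ideal_gen F"
  shows "g \<in> ideal_gen F"
proof (rule ideal_coeff_to_poly[where v = v])
  fix i
  have "coeff (to_poly v g * to_poly v h) i \<in> ideal_gen F" for i
    using coeff_to_poly_ideal[OF assms(1,2,4)] by (simp add: mult.commute)
  then show "coeff (to_poly v g) i \<in> ideal_gen F"
    using monic_coeff_mem[of "ideal_gen F", OF _ assms(3)] by auto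
qed auto

lemma lead_coeff_to_poly_Hs:
  assumes "q \<in> polys V" "v \<notin> V"
  shows "lead_coeff (to_poly v (Hs q (mvar v) m j)) = 1"
  using Hs_monic[of q m j] by (auto simp: to_poly.hom_Hs to_poly_polys[OF assms])

lemma Hs_division:
  assumes f: "f \<in> polys (insert v V)" and q: "q \<in> polys V"
  shows "\<exists>a b. (\<forall>j. a j \<in> polys V) \<and>
    f = (\<Sum>j\<le>m. a j * Hs q (mvar v) m j) + b * Hs q (mvar v) m (Suc m)"
proof -
  define H where "H = Hs q (mvar v) m"
  define W where "W = {f. \<exists>a b. (\<forall>j. a j \<in> polys V) \<and> f = (\<Sum>j\<le>m. a j * H j) + b * H (Suc m)}"
  have W_add: "f + g \<in> W" if "f \<in> W" "g \<in> W" for f g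
  proof -
    from that obtain a b a' b' where "\<forall>j. a j \<in> polys V" "\<forall>j. a' j \<in> polys V"
      "f = (\<Sum>j\<le>m. a j * H j) + b * H (Suc m)" "g = (\<Sum>j\<le>m. a' j * H j) + b' * H (Suc m)"
      unfolding W_def by blast
    then show ?thesis unfolding W_def
      by (intro CollectI exI[of _ "\<lambda>j. a j + a' j"] exI[of _ "b + b'"])
        (auto simp: algebra_simps sum.distrib intro: polys_add)
  qed
  have W_H: "a * H j \<in> W" if "a \<in> polys V" "j \<le> m" for a j
    unfolding W_def using that
    by (intro CollectI exI[of _ "\<lambda>i. if i = j then a else 0"] exI[of _ 0])
      (auto simp: if_distrib[of "\<lambda>x. x * _"] sum.delta cong: if_cong)
  have W_ideal: "b * H (Suc m) \<in> W" for b
    unfolding W_def by (intro CollectI exI[of _ "\<lambda>i. 0"] exI[of _ b]) auto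
  have W_0: "0 \<in> W" using W_ideal[of 0] by simp
  have W_sum: "(\<Sum>j\<in>A. g j) \<in> W" if "\<And>j. j \<in> A \<Longrightarrow> g j \<in> W" for g and A :: "nat set"
    using that by (induction A rule: infinite_finite_induct) (auto intro: W_add W_0)
  have W_scale: "c * f \<in> W" if "c \<in> polys V" "f \<in> W" for c f
  proof -
    from that(2) obtain a b where *: "\<forall>j. a j \<in> polys V" "f = (\<Sum>j\<le>m. a j * H j) + b * H (Suc m)"
      unfolding W_def by blast
    then show ?thesis using that(1) unfolding W_def
      by (intro CollectI exI[of _ "\<lambda>j. c * a j"] exI[of _ "c * b"])
        (auto simp: algebra_simps sum_distrib_left intro: polys_mult)
  qed
  have W_v: "mvar v * f \<in> W" if "f \<in> W" for f
  proof -
    from that obtain a b where *: "\<forall>j. a j \<in> polys V" "f = (\<Sum>j\<le>m. a j * H j) + b * H (Suc m)"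
      unfolding W_def by blast
    have step: "a j * (mvar v * H j) \<in> W" if "j \<le> m" for j
    proof -
      have "a j * H (Suc j) \<in> W"
        using that W_H[of "a j" "Suc j"] W_ideal[of "a j"] * by (cases "j = m") auto
      moreover have "\<exists>c l. c \<in> polys V \<and> l \<le> m \<and> mvar v * H j = H (Suc j) + c * H l"
      proof (cases j)
        case (Suc l)
        then show ?thesis using that q
          by (intro exI[of _ "of_nat (Suc l) * (of_nat m - of_nat l) * q"] exI[of _ l])
            (auto simp: H_def intro!: polys_intros simp del: of_nat_Suc)
      qed (auto simp: H_def intro!: exI[of _ 0])
      then obtain c l where c: "c \<in> polys V" "l \<le> m" "mvar v * H j = H (Suc j) + c * H l" by blast
      have "a j * (c * H l) \<in> W" using W_H[of "a j * c" l] c * by (auto simp: mult.assoc polys_mult)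
      ultimately show ?thesis using c W_add by (simp add: distrib_left)
    qed
    have "mvar v * f = (\<Sum>j\<le>m. a j * (mvar v * H j)) + (mvar v * b) * H (Suc m)"
      unfolding *(2) by (simp add: algebra_simps sum_distrib_left)
    then show ?thesis using step W_ideal by (auto intro!: W_add W_sum)
  qed
  from f have "f \<in> W"
  proof (induction rule: mpoly_induct)
    case (const c)
    show ?case using W_H[of "mconst c" 0] by (simp add: H_def)
  next
    case (mvar w f)
    then show ?case using W_v W_scale[OF polys_mvar] by auto
  qed (auto intro: W_add)
  then show ?thesis unfolding W_def H_def by blast
qed

subsection \<open>Adjoining square roots\<close>

abbreviation squares :: "('v, 'k::comm_ring_1) mpoly \<Rightarrow> 'v set \<Rightarrow> ('v, 'k) mpoly set" where
  "squares q T \<equiv> (\<lambda>v. mvar v ^ 2 - q) ` T"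

lemma squares_polys: "q \<in> polys V \<Longrightarrow> squares q T \<subseteq> polys (V \<union> T)"
  using polys_mono[of V "V \<union> T"] by (auto intro!: polys_intros)

lemma adjoin_square_root:
  assumes F: "F \<subseteq> polys V" and v: "v \<notin> V" and q: "q \<in> polys V"
    and f: "f0 \<in> polys V" "f1 \<in> polys V"
    and mem: "f0 + f1 * mvar v \<in> ideal_gen (insert (mvar v ^ 2 - q) F)"
  shows "f0 \<in> ideal_gen F" "f1 \<in> ideal_gen F"
proof -
  let ?p = "[:- q, 0, 1:]"
  from mem obtain k where "f0 + f1 * mvar v - k * (mvar v ^ 2 - q) \<in> ideal_gen F"
    by (auto simp: idl.span_breakdown_eq)
  from coeff_to_poly_ideal[OF F v this]
  have *: "coeff ([:f0, f1:] - to_poly v k * ?p) i \<in> ideal_gen F" for i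
    by (simp add: to_poly_polys[OF _ v] f q power2_eq_square)
  have **: "coeff (to_poly v k) i \<in> ideal_gen F" for i
  proof (rule monic_coeff_mem)
    fix i assume "degree ?p \<le> i"
    then have "coeff [:f0, f1:] i = 0" by (intro coeff_eq_0) (auto split: if_splits)
    then show "coeff (to_poly v k * ?p) i \<in> ideal_gen F"
      using *[of i] by (simp add: idl.span_neg[of "- _", simplified])
  qed auto
  have "coeff (to_poly v k * ?p) i \<in> ideal_gen F" for i
    unfolding coeff_mult by (intro idl.span_sum ideal_gen_mult_right **)
  then have "coeff [:f0, f1:] i \<in> ideal_gen F" for i
    using idl.span_add[OF *[of i], of "coeff (to_poly v k * ?p) i"] by simp
  from this[of 0] this[of 1] show "f0 \<in> ideal_gen F" "f1 \<in> ideal_gen F" by simp_all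
qed

lemma esym_independent:
  assumes "finite T" "V \<inter> T = {}" "F \<subseteq> polys V" "q \<in> polys V" "\<And>j. b j \<in> polys V"
    and "(\<Sum>j\<le>card T. b j * esym mvar T j) \<in> ideal_gen (F \<union> squares q T)" and "j \<le> card T"
  shows "b j \<in> ideal_gen F"
  using assms
proof (induction T arbitrary: b j rule: finite_induct)
  case (insert v T)
  let ?e = "esym mvar T" and ?W = "V \<union> T"
  let ?f0 = "\<Sum>j\<le>card T. b j * ?e j" and ?f1 = "\<Sum>j\<le>card T. b (Suc j) * ?e j"
  have VW: "polys V \<subseteq> polys ?W" "polys T \<subseteq> polys ?W" by (rule polys_mono; simp)+
  have e: "?e j \<in> polys ?W" for j using esym_polys[OF insert(1), of j] VW by blast
  have b: "b j \<in> polys ?W" for j using insert.prems VW by blast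
  have "(\<Sum>j\<le>card (insert v T). b j * esym mvar (insert v T) j) =
    b 0 + (\<Sum>j\<le>card T. b (Suc j) * (?e (Suc j) + mvar v * ?e j))"
    using insert by (subst card_insert_disjoint) (auto simp: sum.atMost_Suc_shift esym_insert_Suc simp del: sum.atMost_Suc)
  also have "\<dots> = (b 0 + (\<Sum>j\<le>card T. b (Suc j) * ?e (Suc j))) + ?f1 * mvar v"
    by (simp add: algebra_simps sum.distrib sum_distrib_left)
  also have "b 0 + (\<Sum>j\<le>card T. b (Suc j) * ?e (Suc j)) = (\<Sum>j\<le>Suc (card T). b j * ?e j)"
    using insert by (simp add: sum.atMost_Suc_shift del: sum.atMost_Suc)
  also have "\<dots> = ?f0" using insert by (simp add: esym_eq_0)
  finally have mem: "?f0 + ?f1 * mvar v \<in> ideal_gen (insert (mvar v ^ 2 - q) (F \<union> squares q T))"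
    using insert.prems by simp
  have F: "F \<union> squares q T \<subseteq> polys ?W"
    using insert.prems VW squares_polys[of q V T] by blast
  have "v \<notin> ?W" "q \<in> polys ?W" "?f0 \<in> polys ?W" "?f1 \<in> polys ?W"
    using insert VW b e by (auto intro!: polys_intros)
  note D = adjoin_square_root[OF F this(1,2,3,4) mem]
  have b0: "b j \<in> ideal_gen F" if "j \<le> card T" for j
    using insert.IH[of b j] insert.prems D that by auto
  have "b (Suc j) \<in> ideal_gen F" if "j \<le> card T" for j
    using insert.IH[of "\<lambda>j. b (Suc j)" j] insert.prems D that by auto
  with b0 show ?case using insert.prems(6) insert.hyps by (cases j) auto
qed auto

lemma squares_nonzerodivisor:
  fixes c g :: "('v::linorder, 'k::idom) mpoly"
  assumes "finite T" "V \<inter> T = {}" "q \<in> polys V" "c \<in> polys V" "c \<noteq> 0"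
    and "g \<in> polys (V \<union> T)" "c * g \<in> ideal_gen (squares q T)"
  shows "g \<in> ideal_gen (squares q T)"
  using assms(1,2,6,7)
proof (induction T arbitrary: g rule: finite_induct)
  case empty
  then show ?case using assms(5) by auto
next
  case (insert v T)
  let ?W = "V \<union> T"
  have VW: "polys V \<subseteq> polys ?W" by (rule polys_mono) simp
  have H2: "Hs q (mvar v) 1 (Suc 1) = mvar v ^ 2 - q" by (simp add: power2_eq_square)
  obtain a b where ab: "\<forall>j. a j \<in> polys ?W"
    "g = (\<Sum>j\<le>1. a j * Hs q (mvar v) 1 j) + b * Hs q (mvar v) 1 (Suc 1)"
    using Hs_division[of g v ?W q 1] insert.prems assms VW by auto
  have g: "g = a 0 + a 1 * mvar v + b * (mvar v ^ 2 - q)"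
    using ab(2) unfolding H2 by simp
  let ?I = "ideal_gen (insert (mvar v ^ 2 - q) (squares q T))"
  have sq: "b * (mvar v ^ 2 - q) \<in> ?I" for b
    by (intro idl.span_scale idl.span_base) auto
  have "c * a 0 + c * a 1 * mvar v = c * g - (c * b) * (mvar v ^ 2 - q)"
    unfolding g by (simp add: algebra_simps)
  also have "\<dots> \<in> ?I" using insert.prems sq by (intro idl.span_diff) auto
  finally have "c * a 0 + c * a 1 * mvar v \<in> ?I" .
  moreover have "v \<notin> ?W" "q \<in> polys ?W" "c * a 0 \<in> polys ?W" "c * a 1 \<in> polys ?W"
    "squares q T \<subseteq> polys ?W"
    using insert assms VW ab squares_polys[of q V T] by (auto intro!: polys_mult)
  ultimately have "c * a 0 \<in> ideal_gen (squares q T)" "c * a 1 \<in> ideal_gen (squares q T)"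
    using adjoin_square_root[of "squares q T" ?W v q "c * a 0" "c * a 1"] by auto
  then have "a 0 \<in> ideal_gen (squares q T)" "a 1 \<in> ideal_gen (squares q T)"
    using insert ab by auto
  then have "a 0 \<in> ?I" "a 1 \<in> ?I"
    using idl.span_mono[of "squares q T" "insert (mvar v ^ 2 - q) (squares q T)"] by auto
  then have "g \<in> ?I" unfolding g using sq[of b] by (intro idl.span_add) (auto intro: ideal_gen_mult_right)
  then show ?case by simp
qed

declare One_nat_def [simp del]

section \<open>Young subgroups\<close>

interpretation perm_act: ring_hom1 "perm_act \<sigma>"
  unfolding perm_act_def by (rule msubst.ring_hom1_axioms)

lemma perm_act_mconst [simp]: "perm_act \<sigma> (mconst c) = mconst c"
  and perm_act_mvar [simp]: "perm_act \<sigma> (mvar i) = mvar (\<sigma> i)"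
  by (simp_all add: perm_act_def)

lemma perm_act_comp: "perm_act \<sigma> (perm_act \<pi> f) = perm_act (\<sigma> \<circ> \<pi>) f"
  by (simp add: perm_act_def msubst_msubst comp_def)

lemma perm_act_id [simp]: "perm_act id f = f"
  unfolding perm_act_def by (rule msubst_id_on[of _ UNIV]) auto

lemma perm_act_polys:
  "f \<in> polys V \<Longrightarrow> \<sigma> ` V \<subseteq> W \<Longrightarrow> perm_act \<sigma> f \<in> polys W"
  unfolding perm_act_def by (rule msubst_polys) (auto intro: polys_mvar)

lemma hpart_perm_act: "hpart (\<lambda>_. 1) d (perm_act \<sigma> f) = perm_act \<sigma> (hpart (\<lambda>_. 1) d f)"
  unfolding perm_act_def by (rule hpart_msubst) (simp add: whomogeneous_mvar)

locale young =
  fixes n r :: nat and Blk :: "nat \<Rightarrow> nat set"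
  assumes part: "var_partition n r Blk"
begin

abbreviation G where "G \<equiv> young_subgroup n r Blk"

lemma Blk_subset: "k \<in> {1..r} \<Longrightarrow> Blk k \<subseteq> {1..n}"
  using part by (auto simp: var_partition_def)

lemma finite_Blk: "k \<in> {1..r} \<Longrightarrow> finite (Blk k)"
  using Blk_subset finite_subset by blast

lemma sum_Blk: "(\<Sum>k\<in>{1..r}. \<Sum>i\<in>Blk k. f i) = (\<Sum>i\<in>{1..n}. f i)"
  using part finite_Blk unfolding var_partition_def disjoint_family_on_def
  by (subst sum.UNION_disjoint[symmetric]) auto

lemma ex_Blk: "i \<in> {1..n} \<Longrightarrow> \<exists>k\<in>{1..r}. i \<in> Blk k"
  using part by (auto simp: var_partition_def)

lemma G_permutes: "\<sigma> \<in> G \<Longrightarrow> \<sigma> permutes {1..n}"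
  by (simp add: young_subgroup_def)

lemma G_Blk: "\<sigma> \<in> G \<Longrightarrow> k \<in> {1..r} \<Longrightarrow> \<sigma> ` Blk k = Blk k"
  by (simp add: young_subgroup_def)

lemma G_0: "\<sigma> \<in> G \<Longrightarrow> \<sigma> 0 = 0"
  by (meson G_permutes atLeastAtMost_iff not_one_le_zero permutes_not_in)

lemma finite_G: "finite G"
  by (rule finite_subset[OF _ finite_permutations[of "{1..n}"]]) (auto simp: young_subgroup_def)

lemma id_G: "id \<in> G"
  by (auto simp: young_subgroup_def permutes_id)

lemma comp_G: "\<sigma> \<in> G \<Longrightarrow> \<pi> \<in> G \<Longrightarrow> \<sigma> \<circ> \<pi> \<in> G"
  by (auto simp: young_subgroup_def permutes_compose simp flip: image_image intro!: permutes_compose)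

lemma inv_G:
  assumes "\<sigma> \<in> G" shows "(inv_into UNIV \<sigma>) \<in> G"
proof -
  have p: "\<sigma> permutes {1..n}" using assms by (rule G_permutes)
  have "(inv_into UNIV \<sigma>) ` Blk k = Blk k" if "k \<in> {1..r}" for k
    using G_Blk[OF assms that] image_inv_f_f[OF permutes_inj[OF p], of "Blk k"] by simp
  then show ?thesis using permutes_inv[OF p] by (simp add: young_subgroup_def)
qed

lemma transpose_G:
  assumes "k \<in> {1..r}" "a \<in> Blk k" "b \<in> Blk k"
  shows "Transposition.transpose a b \<in> G"
proof -
  have ab: "a \<in> Blk j \<longleftrightarrow> b \<in> Blk j" if "j \<in> {1..r}" for j
  proof (cases "j = k")
    case False
    then have "Blk k \<inter> Blk j = {}"
      using part assms(1) that unfolding var_partition_def disjoint_family_on_def by metis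
    then show ?thesis using assms by blast
  qed (use assms in simp)
  have sub: "Transposition.transpose a b ` Blk j \<subseteq> Blk j" if "j \<in> {1..r}" for j
  proof (rule image_subsetI)
    fix x assume "x \<in> Blk j"
    then show "Transposition.transpose a b x \<in> Blk j"
      using ab[OF that] unfolding Transposition.transpose_def by metis
  qed
  have "Transposition.transpose a b ` Blk j = Blk j" if "j \<in> {1..r}" for j
  proof
    show "Blk j \<subseteq> Transposition.transpose a b ` Blk j"
      using image_mono[OF sub[OF that], of "Transposition.transpose a b"]
      by (simp add: image_comp)
  qed (rule sub[OF that])
  moreover have "Transposition.transpose a b permutes {1..n}"
    using assms Blk_subset[OF assms(1)] by (intro permutes_swap_id) auto
  ultimately show ?thesis by (simp add: young_subgroup_def)
qed

lemma bij_betw_comp_left: "\<sigma> \<in> G \<Longrightarrow> bij_betw (\<lambda>\<pi>. \<sigma> \<circ> \<pi>) G G"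
  by (rule bij_betwI[where g = "\<lambda>\<pi>. (inv_into UNIV \<sigma>) \<circ> \<pi>"])
    (auto intro: comp_G inv_G simp: permutes_inv_o[OF G_permutes] simp flip: o_assoc,
      auto simp: o_assoc permutes_inv_o[OF G_permutes])

lemma bij_betw_comp_right: "\<sigma> \<in> G \<Longrightarrow> bij_betw (\<lambda>\<pi>. \<pi> \<circ> \<sigma>) G G"
  by (rule bij_betwI[where g = "\<lambda>\<pi>. \<pi> \<circ> (inv_into UNIV \<sigma>)"])
    (auto intro: comp_G inv_G simp: o_assoc,
      auto simp: permutes_inv_o[OF G_permutes] simp flip: o_assoc)

definition avg :: "(nat, 'k::field_char_0) mpoly \<Rightarrow> (nat, 'k) mpoly" where
  "avg f = mconst (1 / of_nat (card G)) * (\<Sum>\<sigma>\<in>G. perm_act \<sigma> f)"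

lemma card_G: "of_nat (card G) \<noteq> (0 :: 'k::field_char_0)"
  using finite_G id_G by auto

lemma avg_invariant: "(\<And>\<sigma>. \<sigma> \<in> G \<Longrightarrow> perm_act \<sigma> f = f) \<Longrightarrow> avg f = f"
proof -
  assume "\<And>\<sigma>. \<sigma> \<in> G \<Longrightarrow> perm_act \<sigma> f = f"
  then have "avg f = mconst (1 / of_nat (card G)) * mconst (of_nat (card G)) * f"
    by (simp add: avg_def)
  then show ?thesis using card_G by (simp del: mconst.hom_of_nat flip: mconst_mult)
qed

lemma perm_act_avg: "\<sigma> \<in> G \<Longrightarrow> perm_act \<sigma> (avg f) = avg f"
  using sum.reindex_bij_betw[OF bij_betw_comp_left[of \<sigma>], of "\<lambda>\<pi>. perm_act \<pi> f"]
  by (simp add: avg_def perm_act.hom_sum perm_act_comp)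

lemma avg_perm_act: "\<sigma> \<in> G \<Longrightarrow> avg (perm_act \<sigma> f) = avg f"
  using sum.reindex_bij_betw[OF bij_betw_comp_right[of \<sigma>], of "\<lambda>\<pi>. perm_act \<pi> f"]
  by (simp add: avg_def perm_act.hom_sum perm_act_comp)

lemma avg_add: "avg (f + g) = avg f + avg g"
  by (simp add: avg_def sum.distrib algebra_simps)

lemma avg_0 [simp]: "avg 0 = 0"
  by (simp add: avg_def)

lemma avg_uminus: "avg (- f) = - avg f"
  by (simp add: avg_def sum_negf)

lemma avg_diff: "avg (f - g) = avg f - avg g"
  using avg_add[of f "- g"] by (simp add: avg_uminus)

lemma avg_sum: "avg (sum f A) = (\<Sum>x\<in>A. avg (f x))"
  by (induction A rule: infinite_finite_induct) (auto simp: avg_add)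

lemma avg_mult: "(\<And>\<sigma>. \<sigma> \<in> G \<Longrightarrow> perm_act \<sigma> f = f) \<Longrightarrow> avg (f * g) = f * avg g"
  by (simp add: avg_def sum_distrib_left mult.left_commute)

lemma avg_polys:
  assumes "{1..n} \<subseteq> V" "f \<in> polys V" shows "avg f \<in> polys V"
proof -
  have "\<sigma> ` V \<subseteq> V" if "\<sigma> \<in> G" for \<sigma>
  proof (rule image_subsetI)
    fix x assume "x \<in> V"
    then show "\<sigma> x \<in> V"
      using permutes_in_image[OF G_permutes[OF that], of x] permutes_not_in[OF G_permutes[OF that], of x] assms(1)
      by (cases "x \<in> {1..n}") auto
  qed
  then show ?thesis unfolding avg_def using assms
    by (auto intro!: polys_intros perm_act_polys)
qed

lemma hpart_avg: "hpart (\<lambda>_. 1) d (avg f) = avg (hpart (\<lambda>_. 1) d f)"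
  by (simp add: avg_def hpart_mconst_mult hpart_sum hpart_perm_act)

lemma avg_ideal:
  assumes "\<And>\<sigma> x. \<sigma> \<in> G \<Longrightarrow> x \<in> F \<Longrightarrow> perm_act \<sigma> x \<in> ideal_gen F" "f \<in> ideal_gen F"
  shows "avg f \<in> ideal_gen F"
proof -
  have "perm_act \<sigma> f \<in> ideal_gen F" if "\<sigma> \<in> G" for \<sigma>
    by (rule ideal_gen_hom[OF perm_act.ring_hom1_axioms _ assms(2)]) (rule assms(1)[OF that])
  then show ?thesis unfolding avg_def by (intro idl.span_scale idl.span_sum)
qed

end

section \<open>The deformed algebra over the polynomial ring in one variable\<close>

locale deformed = young n r Blk
  for n r :: nat and Blk :: "nat \<Rightarrow> nat set" +
  fixes \<tau> \<kappa> :: "'k::field_char_0"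
begin

definition z :: "(nat, 'k) mpoly" where "z = mvar 0"
definition q :: "(nat, 'k) mpoly" where "q = mconst \<tau> * z ^ 2"
definition Y :: "nat set \<Rightarrow> (nat, 'k) mpoly" where "Y S = (\<Sum>i\<in>S. mvar i)"
definition ysq :: "nat set \<Rightarrow> (nat, 'k) mpoly" where "ysq S = (\<Prod>i\<in>S. mvar i)"
definition J :: "(nat, 'k) mpoly set" where "J = ideal_gen (squares q {1..n})"

lemma z_polys: "0 \<in> V \<Longrightarrow> z \<in> polys V" and q_polys: "0 \<in> V \<Longrightarrow> q \<in> polys V"
  by (auto simp: z_def q_def intro!: polys_intros)

lemma Y_polys: "S \<subseteq> V \<Longrightarrow> Y S \<in> polys V" and ysq_polys: "S \<subseteq> V \<Longrightarrow> ysq S \<in> polys V"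
  by (auto simp: Y_def ysq_def intro!: polys_intros)

lemma perm_act_z: "\<sigma> \<in> G \<Longrightarrow> perm_act \<sigma> z = z" and perm_act_q: "\<sigma> \<in> G \<Longrightarrow> perm_act \<sigma> q = q"
  by (auto simp: z_def q_def G_0)

lemma perm_act_Y: "inj_on \<sigma> S \<Longrightarrow> perm_act \<sigma> (Y S) = Y (\<sigma> ` S)"
  and perm_act_ysq: "inj_on \<sigma> S \<Longrightarrow> perm_act \<sigma> (ysq S) = ysq (\<sigma> ` S)"
  by (auto simp: Y_def ysq_def perm_act.hom_sum perm_act.hom_prod sum.reindex prod.reindex)

lemma G_inj: "\<sigma> \<in> G \<Longrightarrow> inj_on \<sigma> S"
  using G_permutes permutes_inj inj_on_subset by blast

lemma square_mem_J: "i \<in> {1..n} \<Longrightarrow> mvar i ^ 2 - q \<in> J"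
  unfolding J_def by (intro idl.span_base) auto

lemma subspace_J: "idl.subspace J"
  unfolding J_def by (rule idl.subspace_span)

lemmas J_simps = idl.subspace_add[OF subspace_J] idl.subspace_diff[OF subspace_J]
  idl.subspace_scale[OF subspace_J] idl.subspace_0[OF subspace_J] idl.subspace_sum[OF subspace_J]

lemma J_mult_right: "f \<in> J \<Longrightarrow> f * g \<in> J"
  unfolding J_def by (rule ideal_gen_mult_right)

lemma perm_act_square:
  "\<sigma> \<in> G \<Longrightarrow> x \<in> squares q {1..n} \<Longrightarrow> perm_act \<sigma> x \<in> ideal_gen (squares q {1..n})"
  using permutes_in_image[OF G_permutes]
  by (auto simp: perm_act_q intro!: idl.span_base)

lemma avg_J: "f \<in> J \<Longrightarrow> avg f \<in> J"
  unfolding J_def by (rule avg_ideal) (rule perm_act_square)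

lemma y_mult_ysq:
  assumes "S \<subseteq> {1..n}" "i \<in> {1..n}"
  shows "i \<notin> S \<Longrightarrow> mvar i * ysq S = ysq (insert i S)"
    and "i \<in> S \<Longrightarrow> mvar i * ysq S - q * ysq (S - {i}) \<in> J"
proof -
  have fin: "finite S" using assms finite_subset by blast
  show "i \<notin> S \<Longrightarrow> mvar i * ysq S = ysq (insert i S)"
    using fin by (simp add: ysq_def)
  assume i: "i \<in> S"
  have "mvar i * ysq S - q * ysq (S - {i}) = (mvar i ^ 2 - q) * ysq (S - {i})"
    using fin i by (simp add: ysq_def prod.remove[of S i] power2_eq_square algebra_simps)
  then show "mvar i * ysq S - q * ysq (S - {i}) \<in> J"
    using J_mult_right square_mem_J assms by simp
qed

lemma squarefree_induct [consumes 1, case_names ideal add const basis]: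
  assumes f: "f \<in> polys {0..n}"
    and ideal: "\<And>f. f \<in> J \<Longrightarrow> P f"
    and add: "\<And>f g. P f \<Longrightarrow> P g \<Longrightarrow> P (f + g)"
    and const: "\<And>c f. P f \<Longrightarrow> P (mconst c * f)"
    and basis: "\<And>k S. S \<subseteq> {1..n} \<Longrightarrow> P (z ^ k * ysq S)"
  shows "P f"
proof -
  define W where "W = {f. \<forall>k S. S \<subseteq> {1..n} \<longrightarrow> P (z ^ k * ysq S * f)}"
  have W_add: "f + g \<in> W" if "f \<in> W" "g \<in> W" for f g
    using that add unfolding W_def by (auto simp: distrib_left)
  have W: "f \<in> W"
    using f
  proof (induction rule: mpoly_induct)
    case (const c)
    then show ?case unfolding W_def using assms(4)[OF basis, of _ c] by (auto simp: mult_ac)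
  next
    case (mvar v f)
    show ?case unfolding W_def
    proof (intro CollectI allI impI)
      fix k S assume S: "S \<subseteq> {1..n}"
      consider "v = 0" | "v \<in> {1..n}" "v \<notin> S" | "v \<in> {1..n}" "v \<in> S" using mvar S by fastforce
      then show "P (z ^ k * ysq S * (mvar v * f))"
      proof cases
        case 1
        then have "z ^ k * ysq S * (mvar v * f) = z ^ Suc k * ysq S * f"
          by (simp add: z_def mult_ac)
        moreover have "P (z ^ Suc k * ysq S * f)" using mvar(3) S unfolding W_def by blast
        ultimately show ?thesis by (simp only:)
      next
        case 2
        then have "z ^ k * ysq S * (mvar v * f) = z ^ k * ysq (insert v S) * f"
          using y_mult_ysq(1)[OF S, of v] by (simp add: mult_ac flip: y_mult_ysq(1)[OF S])
        moreover have "P (z ^ k * ysq (insert v S) * f)"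
          using mvar(3) S 2 unfolding W_def by blast
        ultimately show ?thesis by (simp only:)
      next
        case 3
        have "z ^ k * ysq S * (mvar v * f) = mconst \<tau> * (z ^ (k + 2) * ysq (S - {v}) * f)
          + z ^ k * f * (mvar v * ysq S - q * ysq (S - {v}))"
          by (simp add: q_def algebra_simps power_add power2_eq_square)
        moreover have "P (z ^ k * f * (mvar v * ysq S - q * ysq (S - {v})))"
          by (intro ideal J_simps y_mult_ysq S 3)
        moreover have "P (z ^ (k + 2) * ysq (S - {v}) * f)"
          using mvar(3) order_trans[OF Diff_subset S] unfolding W_def by blast
        ultimately show ?thesis using add const by auto
      qed
    qed
  qed (rule W_add)
  then have "P (z ^ 0 * ysq {} * f)" unfolding W_def by blast
  then show ?thesis by (simp add: ysq_def)
qed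

definition \<Theta> :: "(nat, 'k) mpoly \<Rightarrow> (nat, 'k) mpoly" where
  "\<Theta> = msubst (\<lambda>k. if k = 0 then z else Y (Blk k))"

sublocale \<Theta>: ring_hom1 \<Theta>
  unfolding \<Theta>_def by (rule msubst.ring_hom1_axioms)

lemma \<Theta>_mconst [simp]: "\<Theta> (mconst c) = mconst c"
  and \<Theta>_mvar: "\<Theta> (mvar k) = (if k = 0 then z else Y (Blk k))"
  by (simp_all add: \<Theta>_def)

lemma \<Theta>_z [simp]: "\<Theta> z = z" and \<Theta>_q [simp]: "\<Theta> q = q"
  by (simp_all add: z_def q_def \<Theta>_mvar)

lemma \<Theta>_invariant:
  assumes "g \<in> polys {0..r}" "\<sigma> \<in> G" shows "perm_act \<sigma> (\<Theta> g) = \<Theta> g"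
  using assms(1)
proof (induction rule: mpoly_induct)
  case (mvar k f)
  have "perm_act \<sigma> (\<Theta> (mvar k)) = \<Theta> (mvar k)"
    using mvar(1) assms(2) by (auto simp: \<Theta>_mvar perm_act_z perm_act_Y[OF G_inj] G_Blk)
  then show ?case using mvar by simp
qed auto

text \<open>
  Induction on \<open>card S\<close>: all monomials \<open>ysq (insert j S)\<close> with \<open>j\<close> in a fixed block have the same
  average, so \<open>Y (Blk k) * ysq S\<close> averages to a positive multiple of the one wanted, up to
  shorter monomials.
\<close>
lemma avg_ysq_in_range:
  "S \<subseteq> {1..n} \<Longrightarrow> \<exists>g\<in>polys {0..r}. avg (ysq S) - \<Theta> g \<in> J"
proof (induction "card S" arbitrary: S rule: less_induct)
  case less
  show ?case
  proof (cases "S = {}")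
    case True
    then have "avg (ysq S) - \<Theta> 1 = 0" by (simp add: ysq_def avg_invariant)
    then show ?thesis by (intro bexI[of _ 1]) (auto simp: J_simps)
  next
    case False
    then obtain i where i: "i \<in> S" by blast
    define T where "T = S - {i}"
    have iT: "i \<notin> T" and S: "S = insert i T" and fin: "finite T" and Tn: "T \<subseteq> {1..n}"
      using less.prems i finite_subset[OF less.prems] by (auto simp: T_def)
    obtain k where k: "k \<in> {1..r}" "i \<in> Blk k" using ex_Blk less.prems i by blast
    define B where "B = Blk k"
    have B: "finite B" "B \<subseteq> {1..n}" using k finite_Blk Blk_subset by (auto simp: B_def)
    have inv_q: "avg (q * f) = q * avg f" for f by (rule avg_mult) (rule perm_act_q)
    have inv_Y: "avg (Y B * f) = Y B * avg f" for f
      by (rule avg_mult) (simp add: perm_act_Y[OF G_inj] B_def G_Blk[OF _ k(1)])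
    obtain g0 where g0: "g0 \<in> polys {0..r}" "avg (ysq T) - \<Theta> g0 \<in> J"
      using less.hyps[of T] fin iT S Tn by auto
    have "\<exists>g. g \<in> polys {0..r} \<and> avg (ysq (T - {j})) - \<Theta> g \<in> J" if "j \<in> T" for j
    proof -
      have "card (T - {j}) < card S" using fin iT S that by (simp add: card_Diff_singleton less_Suc_eq_le card_gt_0_iff)
      then show ?thesis using less.hyps[of "T - {j}"] Tn by blast
    qed
    then obtain g where g: "\<And>j. j \<in> T \<Longrightarrow> g j \<in> polys {0..r}"
      "\<And>j. j \<in> T \<Longrightarrow> avg (ysq (T - {j})) - \<Theta> (g j) \<in> J" by metis
    have avg_eq: "avg (ysq (insert j T)) = avg (ysq S)" if "j \<in> B - T" for j
    proof -
      have "Transposition.transpose i j \<in> G" using transpose_G k that by (auto simp: B_def)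
      moreover have "Transposition.transpose i j ` insert i T = insert j T"
        using iT that by (auto simp: Transposition.transpose_def image_iff)
      ultimately show ?thesis unfolding S
        by (metis G_inj avg_perm_act perm_act_ysq)
    qed
    let ?N = "card (B - T)"
    have iB: "i \<in> B - T" using k iT by (simp add: B_def)
    have N: "of_nat ?N \<noteq> (0 :: 'k)" using iB B by auto
    define R where "R = (\<Sum>j\<in>B \<inter> T. mvar j * ysq T - q * ysq (T - {j}))"
    have "R \<in> J" unfolding R_def using Tn B by (intro J_simps y_mult_ysq) auto
    have "Y B * ysq T = (\<Sum>j\<in>B. mvar j * ysq T)" by (simp add: Y_def sum_distrib_right)
    also have "\<dots> = (\<Sum>j\<in>B - T. mvar j * ysq T) + (\<Sum>j\<in>B \<inter> T. mvar j * ysq T)"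
      using B by (metis Diff_Diff_Int Diff_subset add.commute sum.subset_diff)
    also have "(\<Sum>j\<in>B - T. mvar j * ysq T) = (\<Sum>j\<in>B - T. ysq (insert j T))"
      using y_mult_ysq(1)[OF Tn] B by (intro sum.cong) auto
    also have "(\<Sum>j\<in>B \<inter> T. mvar j * ysq T) = R + q * (\<Sum>j\<in>B \<inter> T. ysq (T - {j}))"
      by (simp add: R_def sum_distrib_left flip: sum.distrib)
    finally have "avg (Y B * ysq T) = (\<Sum>j\<in>B - T. avg (ysq (insert j T)))
        + (avg R + q * (\<Sum>j\<in>B \<inter> T. avg (ysq (T - {j}))))"
      by (simp add: avg_add avg_sum inv_q)
    then have "of_nat ?N * avg (ysq S) = Y B * avg (ysq T) - avg R - q * (\<Sum>j\<in>B \<inter> T. avg (ysq (T - {j})))"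
      using avg_eq inv_Y by simp
    then have "of_nat ?N * avg (ysq S) - \<Theta> (mvar k * g0 - q * (\<Sum>j\<in>B \<inter> T. g j)) =
      Y B * (avg (ysq T) - \<Theta> g0) - avg R - q * (\<Sum>j\<in>B \<inter> T. avg (ysq (T - {j})) - \<Theta> (g j))"
      using k by (simp add: \<Theta>_mvar B_def \<Theta>.hom_sum sum_subtractf algebra_simps)
    also have "\<dots> \<in> J"
      by (rule J_simps(2)[OF J_simps(2)[OF J_simps(3)[OF g0(2)] avg_J[OF \<open>R \<in> J\<close>]]
          J_simps(3)[OF J_simps(5)]]) (use g in auto)
    finally have mem: "of_nat ?N * avg (ysq S) - \<Theta> (mvar k * g0 - q * (\<Sum>j\<in>B \<inter> T. g j)) \<in> J" .
    let ?c = "mconst (1 / of_nat ?N) :: (nat, 'k) mpoly"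
    have "?c * of_nat ?N = mconst (1 / of_nat ?N * of_nat ?N)"
      by (simp only: mconst_mult mconst.hom_of_nat)
    moreover have "1 / of_nat ?N * of_nat ?N = (1 :: 'k)" using N by simp
    ultimately have c: "?c * of_nat ?N = 1" by (simp only: mconst_1)
    have "?c * (of_nat ?N * avg (ysq S) - \<Theta> (mvar k * g0 - q * (\<Sum>j\<in>B \<inter> T. g j))) \<in> J"
      by (intro J_simps mem)
    moreover have "?c * (of_nat ?N * avg (ysq S) - t) = avg (ysq S) - ?c * t" for t
      by (simp only: right_diff_distrib mult.assoc[symmetric] c mult_1_left)
    ultimately have "avg (ysq S) - \<Theta> (?c * (mvar k * g0 - q * (\<Sum>j\<in>B \<inter> T. g j))) \<in> J"
      by (simp only: \<Theta>.hom_mult[of ?c] \<Theta>_mconst)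
    moreover have "?c * (mvar k * g0 - q * (\<Sum>j\<in>B \<inter> T. g j)) \<in> polys {0..r}"
      using k g0 g by (auto intro!: polys_mult[OF polys_mconst] polys_diff polys_mult q_polys polys_sum polys_mvar)
    ultimately show ?thesis by blast
  qed
qed

lemma avg_in_range:
  assumes "f \<in> polys {0..n}" shows "\<exists>g\<in>polys {0..r}. avg f - \<Theta> g \<in> J"
  using assms
proof (induction rule: squarefree_induct)
  case (ideal f)
  then show ?case using avg_J by (intro bexI[of _ 0]) auto
next
  case (add f g)
  then obtain f' g' where "f' \<in> polys {0..r}" "avg f - \<Theta> f' \<in> J" "g' \<in> polys {0..r}" "avg g - \<Theta> g' \<in> J"
    by blast
  then show ?case
    using J_simps(1)[of "avg f - \<Theta> f'" "avg g - \<Theta> g'"]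
    by (intro bexI[of _ "f' + g'"]) (auto simp: avg_add algebra_simps intro: polys_add)
next
  case (const c f)
  then obtain f' where "f' \<in> polys {0..r}" "avg f - \<Theta> f' \<in> J" by blast
  moreover have "avg (mconst c * f) = mconst c * avg f" by (rule avg_mult) simp
  ultimately show ?case
    using J_simps(3)[of "avg f - \<Theta> f'" "mconst c"]
    by (intro bexI[of _ "mconst c * f'"]) (auto simp: right_diff_distrib intro!: polys_mult)
next
  case (basis k S)
  obtain g where "g \<in> polys {0..r}" "avg (ysq S) - \<Theta> g \<in> J" using avg_ysq_in_range[OF basis] by blast
  moreover have "avg (z ^ k * ysq S) = z ^ k * avg (ysq S)"
    by (rule avg_mult) (simp add: perm_act_z)
  ultimately show ?case
    using J_simps(3)[of "avg (ysq S) - \<Theta> g" "z ^ k"]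
    by (intro bexI[of _ "z ^ k * g"])
      (auto simp: algebra_simps intro!: polys_mult polys_power z_polys)
qed

end

lemma ideal_gen_insert_polys:
  assumes "insert a F \<subseteq> polys V" "f \<in> polys V" "f \<in> ideal_gen (insert a F)"
  shows "\<exists>k\<in>polys V. f - k * a \<in> ideal_gen F"
proof -
  from assms(3) obtain k where "f - k * a \<in> ideal_gen F"
    by (auto simp: idl.span_breakdown_eq)
  then have "restr V (f - k * a) \<in> ideal_gen F"
    by (rule ideal_gen_hom[OF restr.ring_hom1_axioms, rotated])
      (use assms in \<open>auto simp: restr_id subset_iff intro: idl.span_base\<close>)
  then show ?thesis using assms by (intro bexI[of _ "restr V k"]) (auto simp: restr_id restr_polys)
qed

lemma Hs_0: "Hs 0 0 m (Suc j) = 0"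
  by (cases j) auto

lemma whomogeneous_Hs:
  assumes "whomogeneous w 2 q" "whomogeneous w 1 u"
  shows "whomogeneous w j (Hs q u m j)"
proof (induction j rule: less_induct)
  case (less j)
  consider "j = 0" | "j = 1" | l where "j = Suc (Suc l)"
    by (metis One_nat_def not0_implies_Suc)
  then show ?case
  proof cases
    case (3 l)
    have "of_nat (Suc l) * (of_nat m - of_nat l) = (mconst (of_nat (Suc l) * (of_nat m - of_nat l)) :: ('a, 'b) mpoly)"
      by (simp only: mconst.hom_mult mconst.hom_diff mconst.hom_of_nat)
    moreover have "whomogeneous w j (u * Hs q u m (Suc l))" "whomogeneous w j (q * Hs q u m l)"
      using whomogeneous_mult[OF assms(2) less[of "Suc l"]] whomogeneous_mult[OF assms(1) less[of l]] 3
      by (simp_all add: One_nat_def)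
    ultimately show ?thesis
      unfolding 3 Hs.simps mult.assoc[of _ q]
      by (simp only:) (intro whomogeneous_diff whomogeneous_mconst_mult)
  qed (use assms in \<open>auto simp: One_nat_def\<close>)
qed

context deformed
begin

definition hk :: "nat \<Rightarrow> (nat, 'k) mpoly" where
  "hk k = Hs q (mvar k) (card (Blk k)) (Suc (card (Blk k)))"

definition lin :: "(nat, 'k) mpoly" where
  "lin = (\<Sum>k\<in>{1..r}. mvar k) - mconst \<kappa> * z"

definition ylin :: "(nat, 'k) mpoly" where
  "ylin = Y {1..n} - mconst \<kappa> * z"

definition Jl :: "(nat, 'k) mpoly set" where
  "Jl = ideal_gen (insert ylin (squares q {1..n}))"

lemma Hs_polys: "u \<in> polys V \<Longrightarrow> q \<in> polys V \<Longrightarrow> Hs q u m j \<in> polys V"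
proof (induction j rule: less_induct)
  case (less j)
  consider "j = 0" | "j = 1" | l where "j = Suc (Suc l)"
    by (metis One_nat_def not0_implies_Suc)
  then show ?case
  proof cases
    case (3 l)
    then show ?thesis using less by (auto intro!: polys_intros simp del: of_nat_Suc)
  qed (use less in \<open>auto simp: One_nat_def\<close>)
qed

lemma hk_polys: "0 \<in> V \<Longrightarrow> k \<in> V \<Longrightarrow> hk k \<in> polys V"
  unfolding hk_def by (intro Hs_polys polys_mvar q_polys)

lemma lin_polys: "lin \<in> polys {0..r}" and ylin_polys: "ylin \<in> polys {0..n}"
  unfolding lin_def ylin_def by (auto intro!: polys_intros z_polys Y_polys)

lemma \<Theta>_polys:
  assumes "g \<in> polys {0..r}" shows "\<Theta> g \<in> polys {0..n}"
  unfolding \<Theta>_def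
proof (rule msubst_polys[OF assms])
  fix k assume "k \<in> {0..r}"
  then show "(if k = 0 then z else Y (Blk k)) \<in> polys {0..n}"
    using Blk_subset[of k] by (cases "k = 0") (fastforce intro!: Y_polys z_polys)+
qed

lemma \<Theta>_lin: "\<Theta> lin = ylin"
  using sum_Blk[of "mvar :: nat \<Rightarrow> (nat, 'k) mpoly"]
  by (simp add: lin_def ylin_def \<Theta>.hom_sum \<Theta>_mvar Y_def)

lemma Hs_Y_mem:
  assumes "S \<subseteq> {1..n}" shows "Hs q (Y S) (card S) (Suc (card S)) \<in> J"
  unfolding Y_def using assms finite_subset[OF assms]
  by (intro Hs_sum_mem subspace_J square_mem_J) auto

lemma \<Theta>_hk: "k \<in> {1..r} \<Longrightarrow> \<Theta> (hk k) \<in> J"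
  using Hs_Y_mem[OF Blk_subset] by (simp add: hk_def \<Theta>.hom_Hs \<Theta>_mvar)

lemma kernel_\<Theta>_aux:
  assumes "k \<le> r" "g \<in> polys {0..k}" "\<Theta> g \<in> ideal_gen (squares q (\<Union>j\<in>{1..k}. Blk j))"
  shows "g \<in> ideal_gen (hk ` {1..k})"
  using assms
proof (induction k arbitrary: g)
  case 0
  have "\<Theta> g = g" unfolding \<Theta>_def
    by (rule msubst_id_on[OF 0(2)]) (auto simp: z_def)
  then show ?case using 0 by simp
next
  case (Suc k)
  define B m where "B = Blk (Suc k)" and "m = card B"
  let ?W = "\<Union>j\<in>{1..k}. Blk j"
  let ?I = "ideal_gen (squares q ?W)" and ?I' = "ideal_gen (squares q (?W \<union> B))"
  have r: "Suc k \<in> {1..r}" using Suc by auto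
  have B: "finite B" "B \<subseteq> {1..n}" using finite_Blk[OF r] Blk_subset[OF r] by (auto simp: B_def)
  have "B \<inter> Blk j = {}" if "j \<in> {1..k}" for j
  proof -
    have "j \<in> {1..r}" "Suc k \<noteq> j" using that Suc.prems(1) by auto
    then show ?thesis
      using part r unfolding var_partition_def disjoint_family_on_def B_def by blast
  qed
  then have disj: "B \<inter> ?W = {}" by blast
  have WB: "(\<Union>j\<in>{1..Suc k}. Blk j) = ?W \<union> B"
    by (auto simp: B_def atLeastAtMostSuc_conv)
  let ?H = "Hs q (mvar (Suc k)) m"
  have "g \<in> polys (insert (Suc k) {0..k})" using Suc.prems(2) by (simp add: atLeast0_atMost_Suc)
  then obtain a b where a: "\<And>j. a j \<in> polys {0..k}" and g: "g = (\<Sum>j\<le>m. a j * ?H j) + b * hk (Suc k)"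
    using Hs_division[of g "Suc k" "{0..k}" q m] q_polys unfolding hk_def m_def B_def by auto
  let ?c = "\<lambda>j. \<Theta> (a j) * of_nat (fact j)"
  have sub: "idl.subspace ?I'" by simp
  have sq: "mvar i ^ 2 - q \<in> ?I'" if "i \<in> B" for i using that by (auto intro: idl.span_base)
  have "\<Theta> (hk (Suc k)) \<in> ?I'"
    using Hs_sum_mem[OF sub B(1), of mvar q] sq
    by (simp add: hk_def \<Theta>.hom_Hs \<Theta>_mvar B_def Y_def)
  then have "\<Theta> b * \<Theta> (hk (Suc k)) \<in> ?I'" by (rule idl.span_scale)
  then have "\<Theta> g - \<Theta> b * \<Theta> (hk (Suc k)) \<in> ?I'"
    using Suc.prems(3) unfolding WB by (rule idl.span_diff[rotated])
  then have 1: "(\<Sum>j\<le>m. \<Theta> (a j) * Hs q (Y B) m j) \<in> ?I'"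
    unfolding g by (simp add: \<Theta>.hom_sum \<Theta>.hom_Hs \<Theta>_mvar B_def)
  have "(\<Sum>j\<le>m. \<Theta> (a j) * (Hs q (Y B) m j - of_nat (fact j) * esym mvar B j)) \<in> ?I'"
    unfolding Y_def m_def using sq by (intro idl.span_sum idl.span_scale Hs_esym[OF sub B(1)]) auto
  from idl.span_diff[OF 1 this] have "(\<Sum>j\<le>card B. ?c j * esym mvar B j) \<in> ideal_gen (squares q ?W \<union> squares q B)"
    by (simp add: m_def algebra_simps image_Un flip: sum_subtractf)
  moreover have "({0} \<union> ?W) \<inter> B = {}" using disj B by auto
  moreover have "squares q ?W \<subseteq> polys ({0} \<union> ?W)" by (rule squares_polys[OF q_polys]) simp
  moreover have "q \<in> polys ({0} \<union> ?W)" by (rule q_polys) simp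
  moreover have \<Theta>a: "\<Theta> (a j) \<in> polys ({0} \<union> ?W)" for j
    unfolding \<Theta>_def using a[of j]
    by (rule msubst_polys) (auto intro!: Y_polys z_polys)
  have "?c j \<in> polys ({0} \<union> ?W)" for j by (rule polys_mult[OF \<Theta>a polys_of_nat])
  ultimately have c: "?c j \<in> ?I" if "j \<le> m" for j
    using esym_independent[OF B(1), of "{0} \<union> ?W" "squares q ?W" q ?c j] that by (auto simp: m_def)
  have "a j \<in> ideal_gen (hk ` {1..k})" if "j \<le> m" for j
  proof -
    have "(of_nat (fact j) :: (nat, 'k) mpoly) * mconst (1 / of_nat (fact j)) = mconst (of_nat (fact j) * (1 / of_nat (fact j)))"
      by (simp only: mconst_mult mconst.hom_of_nat)
    also have "of_nat (fact j) * (1 / of_nat (fact j)) = (1 :: 'k)" by simp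
    finally have "?c j * mconst (1 / of_nat (fact j)) = \<Theta> (a j)"
      by (simp only: mult.assoc mconst_1 mult_1_right)
    with ideal_gen_mult_right[OF c[OF that], of "mconst (1 / of_nat (fact j))"]
    have "\<Theta> (a j) \<in> ?I" by (simp only:)
    then show ?thesis using Suc.IH[of "a j"] a Suc.prems(1) by simp
  qed
  moreover have "ideal_gen (hk ` {1..k}) \<subseteq> ideal_gen (hk ` {1..Suc k})"
    by (rule idl.span_mono) auto
  ultimately have "(\<Sum>j\<le>m. a j * ?H j) \<in> ideal_gen (hk ` {1..Suc k})"
    by (intro idl.span_sum ideal_gen_mult_right) auto
  then show ?case unfolding g
    by (intro idl.span_add idl.span_scale idl.span_base[of "hk (Suc k)"]) auto
qed

lemma kernel_\<Theta>: "g \<in> polys {0..r} \<Longrightarrow> \<Theta> g \<in> J \<Longrightarrow> g \<in> ideal_gen (hk ` {1..r})"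
  using kernel_\<Theta>_aux[of r g] part by (simp add: var_partition_def J_def)

lemma \<Theta>_ideal_hk: "g \<in> ideal_gen (hk ` {1..r}) \<Longrightarrow> \<Theta> g \<in> J"
  unfolding J_def by (rule ideal_gen_hom[OF \<Theta>.ring_hom1_axioms]) (use \<Theta>_hk in \<open>auto simp: J_def\<close>)

lemma z_power_neq_0: "z ^ k \<noteq> 0"
  by (simp add: z_def mvar_power) (metis lookup_single_eq lookup_zero zero_neq_one)

text \<open>
  \<open>Hs q u n (Suc n)\<close> vanishes modulo \<open>J\<close> at \<open>u = Y {1..n}\<close>, while at \<open>u = \<kappa> z\<close> it is a nonzero
  multiple of a power of \<open>z\<close>; a multiple of \<open>Y {1..n} - \<kappa> z\<close> identifies the two values.
\<close>
lemma ylin_nonzerodivisor: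
  assumes c: "Hs \<tau> \<kappa> n (Suc n) \<noteq> 0" and f: "f \<in> polys {0..n}" "ylin * f \<in> J"
  shows "f \<in> J"
proof -
  let ?H = "\<lambda>u. Hs q u n (Suc n)"
  obtain a where a: "?H (Y {1..n}) - ?H (mconst \<kappa> * z) = ylin * a"
    using Hs_diff_dvd[of "Y {1..n}" "mconst \<kappa> * z" q n "Suc n"] unfolding ylin_def by (auto elim: dvdE)
  have "?H (mconst \<kappa> * z) = mconst (Hs \<tau> \<kappa> n (Suc n)) * z ^ Suc n"
    unfolding q_def by (simp only: Hs_scale mconst.hom_Hs)
  then have "(mconst (Hs \<tau> \<kappa> n (Suc n)) * z ^ Suc n) * f = f * ?H (Y {1..n}) - a * (ylin * f)"
    using a by (simp add: algebra_simps)
  also have "\<dots> \<in> J"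
    by (rule J_simps(2)[OF J_simps(3) J_simps(3)[OF f(2)]]) (use Hs_Y_mem[of "{1..n}"] in simp)
  finally have mem: "(mconst (Hs \<tau> \<kappa> n (Suc n)) * z ^ Suc n) * f \<in> J" .
  have "mconst (Hs \<tau> \<kappa> n (Suc n)) \<noteq> 0"
    using c by (metis lookup_single_eq lookup_zero mconst_def)
  then have "mconst (Hs \<tau> \<kappa> n (Suc n)) * z ^ Suc n \<noteq> 0" using z_power_neq_0 by (metis mult_eq_0_iff)
  moreover have "{0} \<union> {1..n} = {0..n}" by auto
  moreover have "mconst (Hs \<tau> \<kappa> n (Suc n)) * z ^ Suc n \<in> polys {0}" "q \<in> polys {0}"
    by (intro polys_mult polys_power z_polys q_polys polys_mconst; simp)+
  ultimately show ?thesis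
    using squares_nonzerodivisor[of "{1..n}" "{0}" q "mconst (Hs \<tau> \<kappa> n (Suc n)) * z ^ Suc n" f] f mem
    unfolding J_def by simp
qed

definition relations :: "(nat, 'k) mpoly list" where
  "relations = map hk [1..<r + 1] @ [lin]"

lemma set_relations: "set relations = insert lin (hk ` {1..r})"
  by (auto simp: relations_def)

lemma set_relations_polys: "set relations \<subseteq> polys {0..r}"
  unfolding set_relations using lin_polys by (auto intro!: hk_polys)

lemma regular_relations:
  assumes c: "Hs \<tau> \<kappa> n (Suc n) \<noteq> 0"
  shows "regular_sequence (mpoly_alg (\<lambda>_. 1) {..<r + 1}) relations"
proof -
  let ?R = "mpoly_alg (\<lambda>_. 1) {..<r + 1} :: ((nat, 'k) mpoly, 'k) galgebra"
  have V: "{..<r + 1} = {0..r}" by auto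
  have idl: "Idl\<^bsub>?R\<^esub> F = ideal_gen F \<inter> polys {0..r}" if "F \<subseteq> polys {0..r}" for F
    using genideal_mpoly_alg[of F "{..<r + 1}"] that unfolding V by blast
  have take: "set (take i relations) = hk ` {1..i}" if "i \<le> r" for i
    using that by (auto simp: relations_def take_map simp flip: image_set)
  show ?thesis unfolding regular_sequence_def
  proof (intro conjI allI impI ballI)
    show "set relations \<subseteq> carrier ?R" using set_relations_polys by (simp add: V)
    fix i g assume i: "i < length relations" and g: "g \<in> carrier ?R"
      and mem: "relations ! i \<otimes>\<^bsub>?R\<^esub> g \<in> Idl\<^bsub>?R\<^esub> (set (take i relations))"
    have ir: "i \<le> r" using i by (simp add: relations_def)
    have T: "set (take i relations) \<subseteq> polys {0..r}"
      by (rule order_trans[OF set_take_subset set_relations_polys])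
    have g: "g \<in> polys {0..r}" using g by (simp add: V)
    have mem: "relations ! i * g \<in> ideal_gen (hk ` {1..i})"
      using mem idl[OF T] take[OF ir] by simp
    have "g \<in> ideal_gen (hk ` {1..i})"
    proof (cases "i < r")
      case True
      then have "relations ! i = hk (Suc i)" by (simp add: relations_def nth_append nth_upt One_nat_def del: upt_Suc)
      then have mem: "hk (Suc i) * g \<in> ideal_gen (hk ` {1..i})" using mem by simp
      show ?thesis
        by (rule monic_regular[OF _ _ _ mem, where V = "{0..i}" and v = "Suc i"])
          (auto simp: hk_def lead_coeff_to_poly_Hs[OF q_polys[of "{0..i}"]] intro!: hk_polys[unfolded hk_def])
    next
      case False
      then have ir: "i = r" and "relations ! i = lin" using ir by (simp_all add: relations_def nth_append)
      then have "\<Theta> (lin * g) \<in> J" using mem \<Theta>_ideal_hk[of "lin * g"] by simp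
      then have "\<Theta> g \<in> J"
        using ylin_nonzerodivisor[OF c \<Theta>_polys[OF g]] by (simp add: \<Theta>_lin)
      then show ?thesis using kernel_\<Theta> g ir by simp
    qed
    then show "g \<in> Idl\<^bsub>?R\<^esub> (set (take i relations))" using idl[OF T] take[OF ir] g by simp
  next
    have "meval_at (\<lambda>_. 0) f = 0" if "f \<in> ideal_gen (set relations)" for f
    proof -
      have "meval_at (\<lambda>_. 0) f \<in> ideal_gen {0 :: 'k}"
        by (rule ideal_gen_hom[OF meval_at.ring_hom1_axioms _ that])
          (auto simp: set_relations lin_def hk_def meval_at.hom_Hs meval_at.hom_sum q_def z_def Hs_0
            power2_eq_square idl.span_zero simp del: Hs.simps)
      then show ?thesis by (auto simp: idl.span_singleton)
    qed
    from this[of 1] have "1 \<notin> Idl\<^bsub>?R\<^esub> (set relations)"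
      unfolding idl[OF set_relations_polys] by auto
    moreover have "1 \<in> carrier ?R" by simp
    ultimately show "Idl\<^bsub>?R\<^esub> (set relations) \<noteq> carrier ?R" by metis
  qed
qed

lemma homogeneous_z: "whomogeneous (\<lambda>_. 1) 1 z" and homogeneous_q: "whomogeneous (\<lambda>_. 1) 2 q"
  and homogeneous_Y: "whomogeneous (\<lambda>_. 1) 1 (Y S)"
proof -
  show z: "whomogeneous (\<lambda>_. 1) 1 z" by (simp add: z_def whomogeneous_mvar)
  show "whomogeneous (\<lambda>_. 1) 2 q"
    unfolding q_def using whomogeneous_power[OF z, of 2] by (intro whomogeneous_mconst_mult) simp
  show "whomogeneous (\<lambda>_. 1) 1 (Y S)"
    unfolding Y_def by (intro whomogeneous_sum whomogeneous_mvar) simp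
qed

lemma homogeneous_ylin: "whomogeneous (\<lambda>_. 1) 1 ylin"
  unfolding ylin_def by (intro whomogeneous_diff homogeneous_Y whomogeneous_mconst_mult homogeneous_z)

lemma homogeneous_lin: "whomogeneous (\<lambda>_. 1) 1 lin"
  unfolding lin_def
  by (intro whomogeneous_diff whomogeneous_sum whomogeneous_mvar whomogeneous_mconst_mult homogeneous_z) simp

lemma homogeneous_relations: "g \<in> set relations \<Longrightarrow> \<exists>d. whomogeneous (\<lambda>_. 1) d g"
  unfolding set_relations hk_def
  using homogeneous_lin whomogeneous_Hs[OF homogeneous_q whomogeneous_mvar[of "\<lambda>_. 1"]] by fastforce

lemma J_subset_Jl: "J \<subseteq> Jl"
  unfolding J_def Jl_def by (rule idl.span_mono) auto

lemma kernel_relations: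
  assumes g: "g \<in> polys {0..r}" "\<Theta> g \<in> Jl"
  shows "g \<in> ideal_gen (set relations)"
proof -
  have sq: "squares q {1..n} \<subseteq> polys {0..n}"
  proof -
    have "{0} \<union> {1..n} = {0..n}" by auto
    then show ?thesis using squares_polys[OF q_polys, of "{0}" "{1..n}"] by simp
  qed
  have sub: "insert ylin (squares q {1..n}) \<subseteq> polys {0..n}" using sq ylin_polys by auto
  obtain k where k: "k \<in> polys {0..n}" "\<Theta> g - k * ylin \<in> J"
    using ideal_gen_insert_polys[OF sub \<Theta>_polys[OF g(1)]] g(2) unfolding Jl_def J_def by blast
  obtain b where b: "b \<in> polys {0..r}" "avg k - \<Theta> b \<in> J" using avg_in_range[OF k(1)] by blast
  have "perm_act \<sigma> ylin = ylin" if "\<sigma> \<in> G" for \<sigma>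
    using \<Theta>_invariant[OF lin_polys that] by (simp add: \<Theta>_lin)
  then have "avg (\<Theta> g - k * ylin) = \<Theta> g - ylin * avg k"
    using avg_mult[of ylin k] avg_invariant[of "\<Theta> g"] \<Theta>_invariant[OF g(1)] by (simp add: avg_diff mult.commute)
  then have "\<Theta> g - ylin * avg k \<in> J" using avg_J[OF k(2)] by simp
  from J_simps(1)[OF this J_simps(3)[OF b(2), of ylin]]
  have "\<Theta> (g - b * lin) \<in> J" by (simp add: \<Theta>_lin algebra_simps)
  then have "g - b * lin \<in> ideal_gen (hk ` {1..r})"
    using g b lin_polys by (intro kernel_\<Theta>) (auto intro: polys_diff polys_mult)
  then show ?thesis unfolding set_relations by (auto simp: idl.span_breakdown_eq)
qed

lemma \<Theta>_relations: "g \<in> ideal_gen (set relations) \<Longrightarrow> \<Theta> g \<in> Jl"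
  unfolding Jl_def
proof (rule ideal_gen_hom[OF \<Theta>.ring_hom1_axioms])
  fix f assume "f \<in> set relations"
  then show "\<Theta> f \<in> ideal_gen (insert ylin (squares q {1..n}))"
    unfolding set_relations using J_subset_Jl \<Theta>_hk \<Theta>_lin
    by (auto simp: Jl_def intro: idl.span_base)
qed

end

section \<open>The strong Lefschetz property\<close>

context deformed
begin

lemma subspace_Jl: "idl.subspace Jl"
  unfolding Jl_def by (rule idl.subspace_span)

lemmas Jl_simps = idl.subspace_add[OF subspace_Jl] idl.subspace_diff[OF subspace_Jl]
  idl.subspace_scale[OF subspace_Jl] idl.subspace_0[OF subspace_Jl] idl.subspace_sum[OF subspace_Jl]

lemma ylin_Jl: "ylin \<in> Jl"
  unfolding Jl_def by (intro idl.span_base) auto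

lemma hpart_Jl: "f \<in> Jl \<Longrightarrow> hpart (\<lambda>_. 1) d f \<in> Jl"
  unfolding Jl_def
proof (rule ideal_gen_hpart)
  have "whomogeneous (\<lambda>_. 1) 2 (mvar i ^ 2 - q)" for i
    using whomogeneous_power[OF whomogeneous_mvar[of "\<lambda>_. 1" i 1], of 2] homogeneous_q
    by (intro whomogeneous_diff) auto
  then show "\<exists>d. whomogeneous (\<lambda>_. 1) d f" if "f \<in> insert ylin (squares q {1..n})" for f
    using that homogeneous_ylin by blast
qed

definition lefschetz_ok :: "(nat, 'k) mpoly \<Rightarrow> bool" where
  "lefschetz_ok f \<longleftrightarrow> (\<forall>d. n \<le> 2 * d \<longrightarrow>
     (\<exists>g\<in>polys {0..n}. (if d \<le> n then whomogeneous (\<lambda>_. 1) (n - d) g else g = 0) \<and>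
        hpart (\<lambda>_. 1) d f - z ^ (2 * d - n) * g \<in> Jl))"

lemma lefschetz_ok_Jl: "f \<in> Jl \<Longrightarrow> lefschetz_ok f"
  unfolding lefschetz_ok_def using hpart_Jl by (auto intro!: bexI[of _ 0])

lemma lefschetz_ok_add:
  assumes "lefschetz_ok f" "lefschetz_ok g" shows "lefschetz_ok (f + g)"
  unfolding lefschetz_ok_def
proof (intro allI impI)
  fix d assume d: "n \<le> 2 * d"
  obtain f' where f: "f' \<in> polys {0..n}" "if d \<le> n then whomogeneous (\<lambda>_. 1) (n - d) f' else f' = 0"
    "hpart (\<lambda>_. 1) d f - z ^ (2 * d - n) * f' \<in> Jl"
    using assms(1) d unfolding lefschetz_ok_def by blast
  obtain g' where g: "g' \<in> polys {0..n}" "if d \<le> n then whomogeneous (\<lambda>_. 1) (n - d) g' else g' = 0"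
    "hpart (\<lambda>_. 1) d g - z ^ (2 * d - n) * g' \<in> Jl"
    using assms(2) d unfolding lefschetz_ok_def by blast
  show "\<exists>h\<in>polys {0..n}. (if d \<le> n then whomogeneous (\<lambda>_. 1) (n - d) h else h = 0) \<and>
        hpart (\<lambda>_. 1) d (f + g) - z ^ (2 * d - n) * h \<in> Jl"
    using f g Jl_simps(1)[OF f(3) g(3)]
    by (intro bexI[of _ "f' + g'"])
      (auto simp: hpart_add algebra_simps intro: polys_add whomogeneous_add split: if_splits)
qed

lemma lefschetz_ok_const:
  assumes "lefschetz_ok f" shows "lefschetz_ok (mconst c * f)"
  unfolding lefschetz_ok_def
proof (intro allI impI)
  fix d assume d: "n \<le> 2 * d"
  obtain f' where f: "f' \<in> polys {0..n}" "if d \<le> n then whomogeneous (\<lambda>_. 1) (n - d) f' else f' = 0"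
    "hpart (\<lambda>_. 1) d f - z ^ (2 * d - n) * f' \<in> Jl"
    using assms(1) d unfolding lefschetz_ok_def by blast
  show "\<exists>h\<in>polys {0..n}. (if d \<le> n then whomogeneous (\<lambda>_. 1) (n - d) h else h = 0) \<and>
        hpart (\<lambda>_. 1) d (mconst c * f) - z ^ (2 * d - n) * h \<in> Jl"
    using f Jl_simps(3)[OF f(3), of "mconst c"]
    by (intro bexI[of _ "mconst c * f'"])
      (auto simp: hpart_mconst_mult right_diff_distrib mult.left_commute[of _ "mconst c"]
        intro: polys_mult whomogeneous_mconst_mult split: if_splits)
qed

lemma lefschetz_ok_diff: "lefschetz_ok f \<Longrightarrow> lefschetz_ok g \<Longrightarrow> lefschetz_ok (f - g)"
  using lefschetz_ok_add[of f "- g"] lefschetz_ok_const[of g "- 1"] by simp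

lemma lefschetz_ok_sum: "(\<And>x. x \<in> A \<Longrightarrow> lefschetz_ok (f x)) \<Longrightarrow> lefschetz_ok (sum f A)"
  by (induction A rule: infinite_finite_induct)
    (auto intro: lefschetz_ok_add lefschetz_ok_Jl Jl_simps)

lemma mconst_mult_cancel:
  assumes "c \<noteq> 0" shows "mconst (1 / c) * (mconst c * f) = (f :: (nat, 'k) mpoly)"
proof -
  have "mconst (1 / c) * mconst c = (mconst (1 / c * c) :: (nat, 'k) mpoly)" by (simp only: mconst_mult)
  then show ?thesis using assms by (simp flip: mult.assoc)
qed

text \<open>
  \<open>D\<close> plays the role of a Specht polynomial \<open>(y\<^sub>1 - y\<^sub>2)(y\<^sub>3 - y\<^sub>4)\<cdots>\<close> on \<open>i\<close> disjoint pairs of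
  variables with union \<open>U\<close>; it generates a Lefschetz string of length \<open>n - 2i + 1\<close>.
\<close>
lemma string_end_mem:
  assumes nz: "Hs \<tau> \<kappa> (n - 2 * i) (Suc (n - 2 * i)) \<noteq> 0"
    and U: "U \<subseteq> {1..n}" "card U = 2 * i" and DX: "D * Y U \<in> J"
  shows "z ^ Suc (n - 2 * i) * D \<in> Jl"
proof -
  define m u c where "m = n - 2 * i" and "u = Y ({1..n} - U)" and "c = Hs \<tau> \<kappa> m (Suc m)"
  let ?H = "\<lambda>u. Hs q u m (Suc m)"
  have fin: "finite U" using U finite_subset by blast
  have "card ({1..n} - U) = m" using U fin by (simp add: card_Diff_subset m_def)
  then have H: "?H u \<in> Jl" using Hs_Y_mem[of "{1..n} - U"] J_subset_Jl by (auto simp: u_def)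
  have "Y {1..n} = Y U + u"
    unfolding Y_def u_def using U by (metis add.commute finite_atLeastAtMost sum.subset_diff)
  then have "D * (u - mconst \<kappa> * z) = D * ylin - D * Y U"
    by (simp add: ylin_def algebra_simps)
  also have "\<dots> \<in> Jl"
    by (rule Jl_simps(2)[OF Jl_simps(3)[OF ylin_Jl]]) (use DX J_subset_Jl in blast)
  finally have *: "D * (u - mconst \<kappa> * z) \<in> Jl" .
  obtain a where "?H u - ?H (mconst \<kappa> * z) = (u - mconst \<kappa> * z) * a"
    using Hs_diff_dvd[of u "mconst \<kappa> * z" q m "Suc m"] by (auto elim: dvdE)
  then have "?H (mconst \<kappa> * z) = ?H u - (u - mconst \<kappa> * z) * a" by (simp add: algebra_simps)
  then have "D * ?H (mconst \<kappa> * z) = D * ?H u - a * (D * (u - mconst \<kappa> * z))"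
    by (simp only: right_diff_distrib mult_ac)
  also have "\<dots> \<in> Jl" by (rule Jl_simps(2)[OF Jl_simps(3)[OF H] Jl_simps(3)[OF *]])
  also have "?H (mconst \<kappa> * z) = mconst c * z ^ Suc m"
    unfolding q_def c_def by (simp only: Hs_scale mconst.hom_Hs)
  finally have "D * (mconst c * z ^ Suc m) \<in> Jl" .
  from Jl_simps(3)[OF this, of "mconst (1 / c)"]
  have "mconst (1 / c) * (mconst c * (z ^ Suc m * D)) \<in> Jl" by (simp only: mult_ac)
  then show ?thesis using nz by (simp only: mconst_mult_cancel c_def m_def not_False_eq_True)
qed

lemma lefschetz_ok_string:
  assumes nz: "Hs \<tau> \<kappa> (n - 2 * i) (Suc (n - 2 * i)) \<noteq> 0"
    and U: "U \<subseteq> {1..n}" "card U = 2 * i" and DX: "D * Y U \<in> J"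
    and D: "D \<in> polys {0..n}" "whomogeneous (\<lambda>_. 1) i D"
  shows "lefschetz_ok (z ^ k * D)"
  unfolding lefschetz_ok_def
proof (intro allI impI)
  fix d assume d: "n \<le> 2 * d"
  have hom: "whomogeneous (\<lambda>_. 1) (k + i) (z ^ k * D)" for k
    using whomogeneous_mult[OF whomogeneous_power[OF homogeneous_z, of k] D(2)] by simp
  have i2n: "2 * i \<le> n" using card_mono[OF _ U(1)] U(2) by simp
  let ?Q = "\<lambda>g. (if d \<le> n then whomogeneous (\<lambda>_. 1) (n - d) g else g = 0) \<and>
        hpart (\<lambda>_. 1) d (z ^ k * D) - z ^ (2 * d - n) * g \<in> Jl"
  consider "d \<noteq> k + i" | "d = k + i" "d + i \<le> n" | "d = k + i" "n < d + i" by linarith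
  then show "\<exists>g\<in>polys {0..n}. ?Q g"
  proof cases
    case 1
    then have "?Q 0" by (simp add: hpart_homogeneous[OF hom] Jl_simps)
    then show ?thesis by (intro bexI[of _ 0]) auto
  next
    case 2
    let ?k = "k - (2 * d - n)"
    have k: "k = (2 * d - n) + ?k" "?k + i = n - d" using 2 d i2n by auto
    have "z ^ k * D = z ^ (2 * d - n) * (z ^ ?k * D)"
      by (subst k(1)) (simp add: power_add mult.assoc)
    then have "hpart (\<lambda>_. 1) d (z ^ k * D) = z ^ (2 * d - n) * (z ^ ?k * D)"
      by (metis 2(1) hpart_homogeneous[OF hom])
    then have "hpart (\<lambda>_. 1) d (z ^ k * D) - z ^ (2 * d - n) * (z ^ ?k * D) \<in> Jl"
      by (simp only: diff_self Jl_simps)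
    moreover have "whomogeneous (\<lambda>_. 1) (n - d) (z ^ ?k * D)" using hom[of ?k] k(2) by simp
    ultimately have "?Q (z ^ ?k * D)" using 2 by auto
    moreover have "z ^ ?k * D \<in> polys {0..n}" using D by (intro polys_mult polys_power z_polys) auto
    ultimately show ?thesis by blast
  next
    case 3
    then have "k = (k - Suc (n - 2 * i)) + Suc (n - 2 * i)" using i2n by linarith
    then have "z ^ k * D = z ^ (k - Suc (n - 2 * i)) * (z ^ Suc (n - 2 * i) * D)"
      by (metis mult.assoc power_add)
    also have "\<dots> \<in> Jl" by (intro Jl_simps string_end_mem[OF nz U DX])
    finally have "?Q 0" using 3 by (simp add: hpart_homogeneous[OF hom])
    then show ?thesis by (intro bexI[of _ 0]) auto
  qed
qed

lemma lefschetz_ok_Specht: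
  assumes nz: "\<And>i. 2 * i \<le> n \<Longrightarrow> Hs \<tau> \<kappa> (n - 2 * i) (Suc (n - 2 * i)) \<noteq> 0"
    and "U \<subseteq> {1..n}" "card U = 2 * i" "D * Y U \<in> J" "D \<in> polys {0..n}"
    and "whomogeneous (\<lambda>_. 1) i D" "S \<subseteq> {1..n} - U"
  shows "lefschetz_ok (z ^ k * (D * ysq S))"
  using assms(2-)
proof (induction "card S" arbitrary: S U D i k rule: less_induct)
  case less
  note U = less.prems(1,2) and DX = less.prems(3) and D = less.prems(4,5) and S = less.prems(6)
  have finX: "finite U" and finS: "finite S" using U(1) S finite_subset by blast+
  show ?case
  proof (cases "S = {}")
    case True
    have "2 * i \<le> n" using card_mono[OF _ U(1)] U(2) by simp
    from lefschetz_ok_string[OF nz[OF this] U DX D, of k]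
    show ?thesis using True by (simp add: ysq_def)
  next
    case False
    then obtain s where s: "s \<in> S" by blast
    define W where "W = S - {s}"
    define T where "T = {1..n} - U - S"
    have sW: "s \<notin> W" and SW: "S = insert s W" and finW: "finite W" "finite T" and finsT: "s \<notin> T"
      using s finS by (auto simp: W_def T_def)
    have Wn: "W \<subseteq> {1..n}" and sn: "s \<in> {1..n}" and Tn: "T \<subseteq> {1..n}" using S s by (auto simp: W_def T_def)
    have cW: "card W < card S" using sW SW finW by simp
    have IH: "lefschetz_ok (z ^ k * (D * ysq S'))" if "card S' < card S" "S' \<subseteq> {1..n} - U" for S' k
      using less.hyps[OF that(1) U DX D that(2)] .
    have IH2: "lefschetz_ok (z ^ k * (D * (mvar s - mvar t) * ysq W))" if t: "t \<in> T" for t k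
    proof (rule less.hyps[OF cW])
      let ?U = "insert s (insert t U)"
      have st: "s \<noteq> t" "s \<notin> U" "t \<notin> U" "t \<in> {1..n}" using t s S by (auto simp: T_def)
      show "?U \<subseteq> {1..n}" "card ?U = 2 * (i + 1)" using U st sn finX by auto
      have "D * (mvar s - mvar t) * Y ?U =
          (mvar s - mvar t) * (D * Y U) + (D * (mvar s ^ 2 - q) - D * (mvar t ^ 2 - q))"
        using st finX by (simp add: Y_def algebra_simps power2_eq_square)
      also have "\<dots> \<in> J"
        by (rule J_simps(1)[OF J_simps(3)[OF DX] J_simps(2)[OF J_simps(3) J_simps(3)]])
          (use square_mem_J sn st in auto)
      finally show "D * (mvar s - mvar t) * Y ?U \<in> J" .
      show "D * (mvar s - mvar t) \<in> polys {0..n}"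
        using D sn st by (intro polys_intros) auto
      show "whomogeneous (\<lambda>_. 1) (i + 1) (D * (mvar s - mvar t))"
        using D by (intro whomogeneous_mult whomogeneous_diff whomogeneous_mvar) auto
      show "W \<subseteq> {1..n} - ?U" using S SW sW t by (auto simp: T_def)
    qed
    have un: "{1..n} = U \<union> (W \<union> insert s T)" "U \<inter> (W \<union> insert s T) = {}" "W \<inter> insert s T = {}"
      using U S s sn by (auto simp: W_def T_def)
    have Yn: "Y {1..n} = Y U + Y W + (mvar s + Y T)"
    proof -
      have "Y (U \<union> (W \<union> insert s T)) = Y U + Y (W \<union> insert s T)"
        unfolding Y_def by (rule sum.union_disjoint) (use un finX finW in auto)
      moreover have "Y (W \<union> insert s T) = Y W + Y (insert s T)"
        unfolding Y_def by (rule sum.union_disjoint) (use un finX finW in auto)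
      moreover have "Y (insert s T) = mvar s + Y T" using finW finsT by (simp add: Y_def)
      ultimately show ?thesis using un(1) by (simp add: add.assoc)
    qed
    let ?N = "of_nat (card T) + 1 :: 'k"
    define R where "R = (\<Sum>j\<in>W. mvar j * ysq W - q * ysq (W - {j}))"
    have R: "R \<in> J" unfolding R_def using Wn by (intro J_simps y_mult_ysq) auto
    have YW: "Y W * ysq W = R + q * (\<Sum>j\<in>W. ysq (W - {j}))"
      by (simp add: R_def Y_def sum_distrib_left sum_distrib_right flip: sum.distrib)
    have yS: "ysq S = mvar s * ysq W" using sW finW by (simp add: SW ysq_def)
    have ST: "(\<Sum>t\<in>T. mvar s - mvar t) = of_nat (card T) * mvar s - Y T"
      by (simp add: Y_def sum_subtractf)
    have sumT: "(\<Sum>t\<in>T. D * (mvar s - mvar t) * ysq W) = D * (of_nat (card T) * mvar s - Y T) * ysq W"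
      unfolding ST[symmetric] by (simp only: sum_distrib_left sum_distrib_right)
    have eq1: "mconst ?N * (D * ysq S) =
        mconst \<kappa> * (z * (D * ysq W)) + D * ysq W * ylin - ysq W * (D * Y U) - D * (Y W * ysq W)
        + (\<Sum>t\<in>T. D * (mvar s - mvar t) * ysq W)"
      unfolding sumT yS ylin_def Yn mconst_add mconst_1 mconst.hom_of_nat by (simp only: algebra_simps mult_1_left)
    have "z ^ k * (mconst ?N * (D * ysq S)) =
        mconst \<kappa> * (z ^ Suc k * (D * ysq W)) + (z ^ k * D * ysq W) * ylin - (z ^ k * ysq W) * (D * Y U)
        - (z ^ k * D) * R - mconst \<tau> * z ^ (k + 2) * D * (\<Sum>j\<in>W. ysq (W - {j}))
        + z ^ k * (\<Sum>t\<in>T. D * (mvar s - mvar t) * ysq W)"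
      unfolding eq1 YW q_def by (simp add: algebra_simps power_add power2_eq_square)
    also have "\<dots> =
        mconst \<kappa> * (z ^ Suc k * (D * ysq W)) + (z ^ k * D * ysq W) * ylin - (z ^ k * ysq W) * (D * Y U)
        - (z ^ k * D) * R - (\<Sum>j\<in>W. mconst \<tau> * (z ^ (k + 2) * (D * ysq (W - {j}))))
        + (\<Sum>t\<in>T. z ^ k * (D * (mvar s - mvar t) * ysq W))"
      by (simp only: sum_distrib_left mult.assoc)
    finally have eq: "z ^ k * (mconst ?N * (D * ysq S)) =
        mconst \<kappa> * (z ^ Suc k * (D * ysq W)) + (z ^ k * D * ysq W) * ylin - (z ^ k * ysq W) * (D * Y U)
        - (z ^ k * D) * R - (\<Sum>j\<in>W. mconst \<tau> * (z ^ (k + 2) * (D * ysq (W - {j}))))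
        + (\<Sum>t\<in>T. z ^ k * (D * (mvar s - mvar t) * ysq W))" .
    have "lefschetz_ok (z ^ k * (mconst ?N * (D * ysq S)))"
      unfolding eq
    proof (intro lefschetz_ok_add lefschetz_ok_diff lefschetz_ok_sum)
      show "lefschetz_ok (mconst \<kappa> * (z ^ Suc k * (D * ysq W)))"
        by (intro lefschetz_ok_const IH cW) (use S SW in auto)
      show "lefschetz_ok ((z ^ k * D * ysq W) * ylin)"
        by (intro lefschetz_ok_Jl Jl_simps ylin_Jl)
      show "lefschetz_ok ((z ^ k * ysq W) * (D * Y U))" "lefschetz_ok ((z ^ k * D) * R)"
        by (rule lefschetz_ok_Jl, rule Jl_simps(3), use DX R J_subset_Jl in blast)+
      fix j assume "j \<in> W"
      then have "card (W - {j}) < card S" using cW finW by (meson card_Diff1_le le_less_trans)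
      then show "lefschetz_ok (mconst \<tau> * (z ^ (k + 2) * (D * ysq (W - {j}))))"
        by (intro lefschetz_ok_const IH) (use S SW in auto)
    qed (rule IH2)
    then have "lefschetz_ok (mconst (1 / ?N) * (z ^ k * (mconst ?N * (D * ysq S))))"
      by (rule lefschetz_ok_const)
    moreover have "?N \<noteq> 0" by (metis of_nat_Suc of_nat_neq_0 add.commute)
    ultimately show ?thesis
      by (simp only: mult.left_commute[of "z ^ k"] mconst_mult_cancel not_False_eq_True)
  qed
qed

theorem lefschetz_surjective:
  assumes nz: "\<And>i. 2 * i \<le> n \<Longrightarrow> Hs \<tau> \<kappa> (n - 2 * i) (Suc (n - 2 * i)) \<noteq> 0"
    and f: "f \<in> polys {0..n}" "whomogeneous (\<lambda>_. 1) d f" and d: "n \<le> 2 * d" "d \<le> n"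
  shows "\<exists>g\<in>polys {0..n}. whomogeneous (\<lambda>_. 1) (n - d) g \<and> f - z ^ (2 * d - n) * g \<in> Jl"
proof -
  have "lefschetz_ok f"
    using f(1)
  proof (induction rule: squarefree_induct)
    case (basis k S)
    have "lefschetz_ok (z ^ k * (1 * ysq S))"
      by (rule lefschetz_ok_Specht[OF nz, of "{}" 0])
        (use basis in \<open>auto simp: Y_def J_simps\<close>)
    then show ?case by simp
  qed (use J_subset_Jl in \<open>auto intro: lefschetz_ok_Jl lefschetz_ok_add lefschetz_ok_const\<close>)
  then show ?thesis
    using d hpart_homogeneous[OF f(2), of d] unfolding lefschetz_ok_def by fastforce
qed

end

text \<open>
  For \<open>\<rho> \<noteq> 0\<close>, \<open>Hs (\<rho>\<^sup>2) \<kappa> m (Suc m)\<close> is a polynomial in \<open>\<kappa>\<close> of degree \<open>m + 1\<close>, and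
  applying \<open>Hs_sum_mem\<close> to vectors with entries \<open>\<plusminus>\<rho>\<close> yields \<open>m + 1\<close> distinct roots.
\<close>
lemma Hs_eq_0_imp:
  fixes \<rho> \<kappa> :: "'a::field_char_0"
  assumes "Hs (\<rho> ^ 2) \<kappa> m (Suc m) = 0"
  shows "\<exists>j\<le>m. \<kappa> = (of_nat (m - j) - of_nat j) * \<rho>"
proof (cases "\<rho> = 0")
  case True
  have "Hs 0 \<kappa> m j = \<kappa> ^ j" for j
    using Hs_scale[of 0 "\<kappa>" 1 m j] by (induction "0::'a" \<kappa> m j rule: Hs.induct) auto
  then have "\<kappa> = 0" using assms True by (auto simp del: Hs.simps)
  then show ?thesis using True by auto
next
  case False
  define p where "p = Hs [:\<rho> ^ 2:] [:0, 1:] m (Suc m)"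
  define root where "root j = (of_nat (m - j) - of_nat j) * \<rho>" for j
  have poly: "poly p x = Hs (\<rho> ^ 2) x m (Suc m)" for x
  proof -
    interpret h: ring_hom1 "\<lambda>p. poly p x" by unfold_locales auto
    show ?thesis unfolding p_def by (simp add: h.hom_Hs del: Hs.simps)
  qed
  have p: "degree p = Suc m" "p \<noteq> 0" using Hs_monic[of "\<rho> ^ 2" m "Suc m"] by (auto simp: p_def)
  have root: "poly p (root j) = 0" if "j \<le> m" for j
  proof -
    define y where "y i = (if i < j then - \<rho> else \<rho>)" for i :: nat
    have "sum y ({..<j} \<union> {j..<m}) = sum y {..<j} + sum y {j..<m}"
      by (rule sum.union_disjoint) auto
    moreover have "{..<j} \<union> {j..<m} = {..<m}" using that by auto
    ultimately have "sum y {..<m} = sum y {..<j} + sum y {j..<m}" by (simp only:)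
    then have "sum y {..<m} = root j" by (simp add: y_def root_def algebra_simps)
    moreover have "Hs (\<rho> ^ 2) (sum y {..<m}) (card {..<m}) (Suc (card {..<m})) \<in> {0}"
      by (rule Hs_sum_mem) (auto simp: y_def)
    ultimately show ?thesis by (simp add: poly del: Hs.simps)
  qed
  have inj: "inj_on root {..m}"
  proof (rule inj_onI)
    fix a b assume ab: "a \<in> {..m}" "b \<in> {..m}" "root a = root b"
    then have "of_nat (m - a) - of_nat a = (of_nat (m - b) - of_nat b :: 'a)"
      using False by (simp add: root_def)
    moreover have "of_nat (m - a) = (of_nat m - of_nat a :: 'a)" "of_nat (m - b) = (of_nat m - of_nat b :: 'a)"
      using ab by (simp_all add: of_nat_diff)
    ultimately have "of_nat m - (of_nat a + of_nat a) = (of_nat m - (of_nat b + of_nat b) :: 'a)"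
      by (simp only: diff_diff_eq)
    then have "of_nat (a + a) = (of_nat (b + b) :: 'a)" by (simp only: diff_left_imp_eq of_nat_add)
    then show "a = b" by (simp only: of_nat_eq_iff)
  qed
  show ?thesis
  proof (rule ccontr)
    assume "\<not> ?thesis"
    then have \<kappa>: "\<kappa> \<notin> root ` {..m}" by (auto simp: root_def)
    have "insert \<kappa> (root ` {..m}) \<subseteq> {x. poly p x = 0}"
      using root assms by (auto simp: poly)
    then have "card (insert \<kappa> (root ` {..m})) \<le> degree p"
      using card_mono[OF poly_roots_finite[OF p(2)]] card_poly_roots_bound[OF p(2)] le_trans by blast
    then show False using \<kappa> p(1) by (simp add: card_image[OF inj])
  qed
qed

section \<open>Hilbert functions of regular sequences\<close>

context vector_space
begin

lemma dim_insert_not_in_span: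
  assumes "finite F" "S \<subseteq> span F" "x \<notin> span S"
  shows "dim (insert x S) = Suc (dim S)"
proof -
  obtain B where B: "B \<subseteq> S" "independent B" "S \<subseteq> span B" "card B = dim S"
    using basis_exists by metis
  have fin: "finite B" using independent_span_bound[OF assms(1) B(2) order_trans[OF B(1) assms(2)]] by simp
  have span: "span B = span S"
    by (metis B(1,3) span_mono span_span subset_antisym)
  then have "x \<notin> span B" using assms(3) by simp
  then have "independent (insert x B)" "x \<notin> B"
    using independent_insertI B(2) span_base by blast+
  moreover have "span (insert x B) = span (insert x S)"
    using span unfolding span_insert by simp
  ultimately have "dim (insert x S) = card (insert x B)"
    using dim_eq_card by metis
  then show ?thesis using fin \<open>x \<notin> B\<close> B(4) by simp
qed

lemma subspace_dim_eqI:
  assumes "subspace S" "S \<subseteq> T" "finite F" "T \<subseteq> span F" "dim T \<le> dim S"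
  shows "S = T"
proof (rule ccontr)
  assume "S \<noteq> T"
  then obtain t where t: "t \<in> T" "t \<notin> S" using assms(2) by blast
  have "t \<notin> span S" using t(2) assms(1) by (simp add: span_eq_iff[THEN iffD2])
  then have "dim (insert t S) = Suc (dim S)"
    using dim_insert_not_in_span[OF assms(3)] assms(2,4) by blast
  moreover have "dim (insert t S) \<le> dim T"
  proof -
    obtain C where C: "C \<subseteq> T" "independent C" "T \<subseteq> span C" "card C = dim T"
      using basis_exists[of T] by metis
    have "C \<subseteq> span F" using C(1) assms(4) by (rule order_trans)
    then have "finite C" using independent_span_bound[OF assms(3) C(2)] by simp
    moreover have "insert t S \<subseteq> span C" using C(3) t(1) assms(2) by blast
    ultimately show ?thesis unfolding C(4)[symmetric] by (intro dim_le_card)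
  qed
  ultimately show False using assms(5) by simp
qed

lemma rank_nullity_mod:
  assumes T: "\<And>x y. T (x + y) = T x + T y" "\<And>c x. T (scale c x) = scale c (T x)"
    and U: "subspace U" "finite F" "U \<subseteq> span F"
    and Z: "subspace Z" "finite F'" "Z \<subseteq> span F'"
  shows "dim {a + T x |a x. a \<in> Z \<and> x \<in> U} + dim {x \<in> U. T x \<in> Z} = dim U + dim Z"
proof -
  interpret T: Modules.module_hom scale scale T
    using T by unfold_locales
  let ?K = "{x \<in> U. T x \<in> Z}"
  have K: "subspace ?K"
    using U(1) Z(1) by (auto simp: subspace_def T.zero T)
  obtain BK where BK: "BK \<subseteq> ?K" "independent BK" "?K \<subseteq> span BK" "card BK = dim ?K"
    by (rule basis_exists)
  obtain B where B: "BK \<subseteq> B" "B \<subseteq> U" "independent B" "U \<subseteq> span B"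
    by (rule maximal_independent_subset_extend[of BK U]) (use BK in auto)
  obtain BZ where BZ: "BZ \<subseteq> Z" "independent BZ" "Z \<subseteq> span BZ" "card BZ = dim Z"
    by (rule basis_exists)
  have finB: "finite B" using independent_span_bound[OF U(2) B(3) order_trans[OF B(2) U(3)]] by simp
  have finBZ: "finite BZ" using independent_span_bound[OF Z(2) BZ(2) order_trans[OF BZ(1) Z(3)]] by simp
  have spanX: "span B = U" using B U(1) by (metis span_subspace)
  have spanZ: "span BZ = Z" using BZ Z(1) by (metis span_subspace)
  have spanK: "span BK = ?K" using BK K by (metis span_subspace)
  define C where "C = B - BK"
  have finC: "finite C" using finB by (simp add: C_def)
  have *: "dim (BZ \<union> T ` C') = card BZ + card C'" if "C' \<subseteq> C" for C'
    using finite_subset[OF that finC] that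
  proof (induction C' rule: finite_induct)
    case empty
    then show ?case using dim_eq_card_independent[OF BZ(2)] by simp
  next
    case (insert c C')
    have "T c \<notin> span (BZ \<union> T ` C')"
    proof
      assume "T c \<in> span (BZ \<union> T ` C')"
      then obtain a x where ax: "a \<in> Z" "x \<in> span C'" "T c = a + T x"
        unfolding span_Un T.span_image spanZ by blast
      have "x \<in> U" using ax(2) insert.prems span_mono[of C' B] spanX by (auto simp: C_def)
      moreover have "c \<in> U" using insert.prems B(2) by (auto simp: C_def)
      moreover have "T (c - x) \<in> Z" using ax by (simp add: T.diff)
      ultimately have "c - x \<in> span BK" unfolding spanK using subspace_diff[OF U(1)] by simp
      then have "c - x \<in> span (BK \<union> C')" "x \<in> span (BK \<union> C')"
        using ax(2) span_mono[of BK "BK \<union> C'"] span_mono[of C' "BK \<union> C'"] by auto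
      then have "c \<in> span (BK \<union> C')" using span_add[of "c - x" _ x] by simp
      moreover have "BK \<union> C' \<subseteq> B - {c}" using insert B(1) by (auto simp: C_def)
      ultimately have "c \<in> span (B - {c})" using span_mono by blast
      moreover have "c \<in> B" using insert.prems by (auto simp: C_def)
      ultimately show False using B(3) dependent_def by blast
    qed
    moreover have "finite (BZ \<union> T ` C')" using finBZ insert by simp
    ultimately have "dim (insert (T c) (BZ \<union> T ` C')) = Suc (dim (BZ \<union> T ` C'))"
      using dim_insert_not_in_span[OF _ span_superset] by blast
    then show ?case using insert by simp
  qed
  have "{a + T x |a x. a \<in> Z \<and> x \<in> U} = span (BZ \<union> T ` C)"
  proof (intro equalityI subsetI)
    fix y assume "y \<in> {a + T x |a x. a \<in> Z \<and> x \<in> U}"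
    then obtain a x where y: "y = a + T x" "a \<in> Z" "x \<in> U" by blast
    have "BK \<union> C = B" using B(1) by (auto simp: C_def)
    then have "x \<in> span (BK \<union> C)" using y(3) spanX by simp
    then obtain k c where kc: "x = k + c" "k \<in> ?K" "c \<in> span C"
      unfolding span_Un spanK by blast
    have "a + T k \<in> Z" using y kc subspace_add[OF Z(1)] by blast
    moreover have "y = (a + T k) + T c" using y kc by (simp add: T add.assoc)
    ultimately show "y \<in> span (BZ \<union> T ` C)"
      unfolding span_Un T.span_image spanZ using kc(3) by blast
  next
    fix y assume "y \<in> span (BZ \<union> T ` C)"
    then obtain a c where "y = a + T c" "a \<in> Z" "c \<in> span C"
      unfolding span_Un T.span_image spanZ by blast
    moreover have "span C \<subseteq> U" using span_mono[of C B] spanX by (auto simp: C_def)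
    ultimately show "y \<in> {a + T x |a x. a \<in> Z \<and> x \<in> U}" by blast
  qed
  then have "dim {a + T x |a x. a \<in> Z \<and> x \<in> U} = card BZ + card C" using * by simp
  moreover have "dim U = card B" using spanX dim_span_eq_card_independent[OF B(3)] by simp
  moreover have "card B = card BK + card C"
    using finB B(1) by (simp add: C_def card_Diff_subset card_mono finite_subset)
  ultimately show ?thesis using BK(4) BZ(4) by simp
qed

end

interpretation kv: vector_space "\<lambda>c f. mconst c * (f :: ('v, 'k::field) mpoly)"
  by unfold_locales (auto simp: mconst_add mconst_mult algebra_simps)

declare kv.scale_scale [simp del]

definition monomials :: "'v set \<Rightarrow> nat \<Rightarrow> ('v \<Rightarrow>\<^sub>0 nat) set" where
  "monomials V d = {m. Poly_Mapping.keys m \<subseteq> V \<and> wdeg (\<lambda>_. 1) m = d}"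

definition homs :: "'v set \<Rightarrow> nat \<Rightarrow> ('v, 'k::comm_ring_1) mpoly set" where
  "homs V d = {f \<in> polys V. whomogeneous (\<lambda>_. 1) d f}"

lemma monomials_insert_0: "monomials (insert v V) 0 = monomials V 0"
proof -
  have "m = 0" if "wdeg (\<lambda>_. 1) m = 0" for m :: "'a \<Rightarrow>\<^sub>0 nat"
    using that by (intro poly_mapping_eqI) (auto simp: wdeg_def in_keys_iff)
  then have "monomials W 0 = {0}" for W :: "'a set"
    unfolding monomials_def by force
  then show ?thesis by simp
qed

lemma monomials_insert_Suc:
  assumes "v \<notin> V"
  shows "monomials (insert v V) (Suc d) =
    monomials V (Suc d) \<union> (\<lambda>m. m + Poly_Mapping.single v 1) ` monomials (insert v V) d"
    and "monomials V (Suc d) \<inter> (\<lambda>m. m + Poly_Mapping.single v 1) ` monomials (insert v V) d = {}"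
proof -
  show "monomials (insert v V) (Suc d) =
    monomials V (Suc d) \<union> (\<lambda>m. m + Poly_Mapping.single v 1) ` monomials (insert v V) d"
  proof (intro equalityI subsetI)
    fix m assume m: "m \<in> monomials (insert v V) (Suc d)"
    show "m \<in> monomials V (Suc d) \<union> (\<lambda>m. m + Poly_Mapping.single v 1) ` monomials (insert v V) d"
    proof (cases "v \<in> Poly_Mapping.keys m")
      case True
      define m' where "m' = m - Poly_Mapping.single v 1"
      have mm: "m = m' + Poly_Mapping.single v 1"
        using True by (intro poly_mapping_eqI)
          (auto simp: m'_def lookup_add lookup_minus lookup_single when_def in_keys_iff)
      have "wdeg (\<lambda>_. 1) m = wdeg (\<lambda>_. 1) m' + 1" unfolding mm wdeg_add by simp
      moreover have "Poly_Mapping.keys m' \<subseteq> Poly_Mapping.keys m"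
        using keys_add_nat[of m' "Poly_Mapping.single v 1"] unfolding mm[symmetric] by blast
      ultimately have "m' \<in> monomials (insert v V) d" using m by (auto simp: monomials_def)
      then show ?thesis using mm by blast
    qed (use m in \<open>auto simp: monomials_def\<close>)
  qed (auto simp: monomials_def wdeg_add keys_add_nat)
  show "monomials V (Suc d) \<inter> (\<lambda>m. m + Poly_Mapping.single v 1) ` monomials (insert v V) d = {}"
    using assms by (auto simp: monomials_def keys_add_nat)
qed

lemma finite_monomials: "finite V \<Longrightarrow> finite (monomials V d)"
proof (induction V arbitrary: d rule: finite_induct)
  case empty
  then show ?case by (rule finite_subset[of _ "{0}"]) (auto simp: monomials_def)
next
  case (insert v V)
  show ?case
    by (induction d)
      (use insert in \<open>auto simp: monomials_insert_0 monomials_insert_Suc(1)\<close>)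
qed

lemma monomials_fps:
  "finite V \<Longrightarrow> Abs_fps (\<lambda>d. int (card (monomials V d))) * (1 - fps_X) ^ card V = 1"
proof (induction V rule: finite_induct)
  case empty
  have "monomials {} d = (if d = 0 then {0 :: 'a \<Rightarrow>\<^sub>0 nat} else {})" for d
    by (auto simp: monomials_def)
  then show ?case by (intro fps_ext) auto
next
  case (insert v V)
  have "Abs_fps (\<lambda>d. int (card (monomials (insert v V) d))) * (1 - fps_X)
      = Abs_fps (\<lambda>d. int (card (monomials V d)))"
  proof (rule fps_ext)
    fix d
    have "card (monomials (insert v V) (Suc d)) =
      card (monomials V (Suc d)) + card (monomials (insert v V) d)" for d
      unfolding monomials_insert_Suc(1)[OF insert(2)]
      using insert by (subst card_Un_disjoint)
        (auto simp: finite_monomials monomials_insert_Suc(2) card_image inj_on_def)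
    then show "fps_nth (Abs_fps (\<lambda>d. int (card (monomials (insert v V) d))) * (1 - fps_X)) d
      = fps_nth (Abs_fps (\<lambda>d. int (card (monomials V d)))) d"
      by (cases d) (auto simp: right_diff_distrib monomials_insert_0)
  qed
  then show ?case using insert by (simp add: mult.assoc flip: mult.assoc)
qed

lemma one_plus_fps_X_power_nth: "fps_nth ((1 + fps_X) ^ n :: int fps) d = int (n choose d)"
proof (induction n arbitrary: d)
  case 0
  then show ?case by (cases d) auto
next
  case (Suc n)
  then show ?case by (cases d) (auto simp: fps_mult_fps_X_plus_1_nth)
qed

lemma subspace_homs: "kv.subspace (homs V d)"
  by (auto simp: kv.subspace_def homs_def intro: polys_add polys_mult whomogeneous_add whomogeneous_mconst_mult)

lemma homs_span:
  "(homs V d :: ('v, 'k::field) mpoly set) \<subseteq> kv.span ((\<lambda>m. Poly_Mapping.single m 1) ` monomials V d)"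
proof
  fix f :: "('v, 'k) mpoly" assume f: "f \<in> homs V d"
  have "f = (\<Sum>m\<in>Poly_Mapping.keys f. mconst (Poly_Mapping.lookup f m) * Poly_Mapping.single m 1)"
    by (subst mpoly_sum_single[of f]) (simp add: mconst_def mult_single)
  also have "\<dots> \<in> kv.span ((\<lambda>m. Poly_Mapping.single m 1) ` monomials V d)"
    using f by (intro kv.span_sum kv.span_scale kv.span_base)
      (auto simp: homs_def monomials_def polys_def whomogeneous_def)
  finally show "f \<in> kv.span ((\<lambda>m. Poly_Mapping.single m 1) ` monomials V d)" .
qed

lemma finite_homs_span:
  "finite V \<Longrightarrow> \<exists>F. finite F \<and> F \<subseteq> homs V d \<and> homs V d \<subseteq> kv.span F"
  using homs_span[of V d] finite_monomials[of V d]
  by (intro exI[of _ "(\<lambda>m. Poly_Mapping.single m 1) ` monomials V d"])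
    (auto simp: homs_def monomials_def polys_def whomogeneous_def)

lemma dim_homs:
  assumes "finite V" shows "kv.dim (homs V d :: ('v, 'k::field) mpoly set) = card (monomials V d)"
proof -
  let ?s = "\<lambda>m. Poly_Mapping.single m 1 :: ('v, 'k) mpoly"
  let ?B = "?s ` monomials V d"
  have inj: "inj_on ?s (monomials V d)"
    by (rule inj_onI) (metis keys_single singleton_inject zero_neq_one)
  have "kv.independent ?B"
  proof (rule kv.independent_if_scalars_zero)
    show "finite ?B" using finite_monomials[OF assms] by simp
    fix c x assume c: "(\<Sum>x\<in>?B. mconst (c x) * x) = 0" and x: "x \<in> ?B"
    obtain m where m: "m \<in> monomials V d" "x = ?s m" using x by blast
    have "0 = Poly_Mapping.lookup (\<Sum>l\<in>monomials V d. mconst (c (?s l)) * ?s l) m"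
      using c inj by (simp add: sum.reindex)
    also have "\<dots> = c x"
      using m finite_monomials[OF assms]
      by (simp add: lookup_sum lookup_mconst_mult lookup_single when_def if_distrib sum.delta cong: if_cong)
    finally show "c x = 0" by simp
  qed
  moreover have "?B \<subseteq> homs V d" by (auto simp: homs_def monomials_def polys_def whomogeneous_def)
  ultimately have "card ?B = kv.dim (homs V d :: ('v, 'k) mpoly set)"
    using homs_span by (intro kv.basis_card_eq_dim)
  then show ?thesis using inj by (simp add: card_image)
qed

lemma ideal_gen_insert_homs:
  fixes f :: "('v, 'k::field) mpoly"
  assumes f: "f \<in> homs V e" and F: "F \<subseteq> polys V" "\<And>x. x \<in> F \<Longrightarrow> \<exists>d. whomogeneous (\<lambda>_. 1) d x"
    and e: "e \<le> d"
  shows "ideal_gen (insert f F) \<inter> homs V d =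
    {a + f * x |a x. a \<in> ideal_gen F \<inter> homs V d \<and> x \<in> homs V (d - e)}"
proof (intro equalityI subsetI)
  fix g assume g: "g \<in> ideal_gen (insert f F) \<inter> homs V d"
  obtain k where k: "k \<in> polys V" "g - k * f \<in> ideal_gen F"
    using ideal_gen_insert_polys[of f F V g] f F g by (auto simp: homs_def)
  have "hpart (\<lambda>_. 1) d (g - k * f) = g - f * hpart (\<lambda>_. 1) (d - e) k"
    using f g e by (auto simp: homs_def hpart_diff hpart_homogeneous hpart_mult_homogeneous mult.commute[of k])
  moreover have "hpart (\<lambda>_. 1) d (g - k * f) \<in> ideal_gen F"
    using ideal_gen_hpart[OF F(2) k(2)] by blast
  moreover have "g - f * hpart (\<lambda>_. 1) (d - e) k \<in> homs V d"
    using f g e k whomogeneous_mult[of "\<lambda>_. 1" e f "d - e" "hpart (\<lambda>_. 1) (d - e) k"]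
    by (auto simp: homs_def intro!: polys_diff polys_mult hpart_polys whomogeneous_diff)
  ultimately show "g \<in> {a + f * x |a x. a \<in> ideal_gen F \<inter> homs V d \<and> x \<in> homs V (d - e)}"
    using k by (intro CollectI exI[of _ "g - f * hpart (\<lambda>_. 1) (d - e) k"] exI[of _ "hpart (\<lambda>_. 1) (d - e) k"])
      (auto simp: homs_def hpart_polys)
next
  fix g assume "g \<in> {a + f * x |a x. a \<in> ideal_gen F \<inter> homs V d \<and> x \<in> homs V (d - e)}"
  then obtain a x where g: "g = a + f * x" "a \<in> ideal_gen F" "a \<in> homs V d" "x \<in> homs V (d - e)" by blast
  have "f * x \<in> homs V d" using f g(4) e whomogeneous_mult[of "\<lambda>_. 1" e f "d - e" x]
    by (auto simp: homs_def polys_mult)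
  then have "g \<in> homs V d" unfolding g(1) using g(3) by (intro kv.subspace_add[OF subspace_homs])
  moreover have "a \<in> ideal_gen (insert f F)" using g(2) idl.span_mono[of F "insert f F"] by blast
  then have "g \<in> ideal_gen (insert f F)"
    unfolding g(1) by (intro idl.span_add ideal_gen_mult_right[OF idl.span_base]) auto
  ultimately show "g \<in> ideal_gen (insert f F) \<inter> homs V d" by blast
qed

lemma ideal_gen_insert_homs_less:
  assumes f: "f \<in> homs V e" and F: "F \<subseteq> polys V" "\<And>x. x \<in> F \<Longrightarrow> \<exists>d. whomogeneous (\<lambda>_. 1) d x"
    and e: "d < e"
  shows "ideal_gen (insert f F) \<inter> homs V d = ideal_gen F \<inter> homs V d"
proof (intro equalityI subsetI)
  fix g assume g: "g \<in> ideal_gen (insert f F) \<inter> homs V d"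
  obtain k where k: "k \<in> polys V" "g - k * f \<in> ideal_gen F"
    using ideal_gen_insert_polys[of f F V g] f F g by (auto simp: homs_def)
  have "hpart (\<lambda>_. 1) d (g - k * f) = g"
    using f g e by (auto simp: homs_def hpart_diff hpart_homogeneous hpart_mult_homogeneous mult.commute[of k])
  moreover have "hpart (\<lambda>_. 1) d (g - k * f) \<in> ideal_gen F"
    using ideal_gen_hpart[OF F(2) k(2)] by blast
  ultimately show "g \<in> ideal_gen F \<inter> homs V d" using g by simp
qed (use idl.span_mono[of F "insert f F"] in auto)

lemma subspace_ideal_homs: "kv.subspace (ideal_gen F \<inter> homs V d)"
  using subspace_homs[of V d]
  by (auto simp: kv.subspace_def intro: idl.span_zero idl.span_add idl.span_scale)

lemma hilbert_regular_sequence: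
  fixes fs :: "('v, 'k::field) mpoly list"
  assumes V: "finite V" and reg: "regular_sequence (mpoly_alg w V) fs"
    and hom: "\<And>f. f \<in> set fs \<Longrightarrow> whomogeneous (\<lambda>_. 1) e f" and "i \<le> length fs"
  shows "Abs_fps (\<lambda>d. int (kv.dim (homs V d :: ('v, 'k) mpoly set))
      - int (kv.dim (ideal_gen (set (take i fs)) \<inter> homs V d)))
    = Abs_fps (\<lambda>d. int (card (monomials V d))) * (1 - fps_X ^ e) ^ i"
  using assms(4)
proof (induction i)
  case 0
  have "kv.dim ({0} \<inter> homs V d :: ('v, 'k) mpoly set) = 0" for d
  proof -
    have "{0} \<inter> homs V d = ({0} :: ('v, 'k) mpoly set)" using kv.subspace_0[OF subspace_homs] by auto
    then show ?thesis using kv.dim_eq_card[of "{}" "{0} :: ('v, 'k) mpoly set"] kv.independent_empty by simp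
  qed
  then show ?case by (simp add: dim_homs[OF V])
next
  case (Suc i)
  let ?F = "set (take i fs)" and ?f = "fs ! i"
  have sub: "set fs \<subseteq> polys V" using reg by (simp add: regular_sequence_def)
  have F: "?F \<subseteq> polys V" using sub set_take_subset[of i fs] by (rule order_trans[rotated])
  have Fhom: "\<exists>d. whomogeneous (\<lambda>_. 1) d x" if "x \<in> ?F" for x
    using hom[of x] in_set_takeD[OF that] by blast
  have i: "?f \<in> set fs" using Suc.prems by simp
  then have f: "?f \<in> homs V e" using sub hom by (auto simp: homs_def)
  have ins: "set (take (Suc i) fs) = insert ?f ?F"
    using Suc.prems by (simp add: take_Suc_conv_app_nth)
  have nzd: "x \<in> ideal_gen ?F" if "x \<in> polys V" "?f * x \<in> ideal_gen ?F" for x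
  proof -
    have "\<forall>i<length fs. \<forall>g\<in>polys V. fs ! i * g \<in> genideal (mpoly_alg w V) (set (take i fs)) \<longrightarrow>
        g \<in> genideal (mpoly_alg w V) (set (take i fs))"
      using reg unfolding regular_sequence_def by simp
    then have "?f * x \<in> genideal (mpoly_alg w V) ?F \<longrightarrow> x \<in> genideal (mpoly_alg w V) ?F"
      using that(1) Suc.prems by simp
    moreover have "?f * x \<in> polys V" using f that(1) by (auto simp: homs_def polys_mult)
    ultimately show ?thesis using that(2) unfolding genideal_mpoly_alg[OF F] by blast
  qed
  let ?h = "\<lambda>F d. int (kv.dim (homs V d :: ('v, 'k) mpoly set)) - int (kv.dim (ideal_gen F \<inter> homs V d))"
  have "?h (insert ?f ?F) d = ?h ?F d - (if e \<le> d then ?h ?F (d - e) else 0)" for d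
  proof (cases "e \<le> d")
    case True
    obtain B B' :: "('v, 'k) mpoly set" where B: "finite B" "homs V (d - e) \<subseteq> kv.span B" "finite B'" "homs V d \<subseteq> kv.span B'"
      using finite_homs_span[OF V] by metis
    have "kv.dim {a + ?f * x |a x. a \<in> ideal_gen ?F \<inter> homs V d \<and> x \<in> homs V (d - e)}
      + kv.dim {x \<in> homs V (d - e). ?f * x \<in> ideal_gen ?F \<inter> homs V d}
      = kv.dim (homs V (d - e) :: ('v, 'k) mpoly set) + kv.dim (ideal_gen ?F \<inter> homs V d)"
      by (rule kv.rank_nullity_mod[OF _ _ subspace_homs B(1,2) subspace_ideal_homs B(3)])
        (use B(4) in \<open>auto simp: algebra_simps\<close>)
    moreover have "{x \<in> homs V (d - e). ?f * x \<in> ideal_gen ?F \<inter> homs V d} = ideal_gen ?F \<inter> homs V (d - e)"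
      using f True whomogeneous_mult[of "\<lambda>_. 1" e ?f "d - e"] nzd
      by (auto simp: homs_def intro: idl.span_scale polys_mult)
    ultimately show ?thesis using True ideal_gen_insert_homs[OF f F Fhom True] by simp
  next
    case False
    then show ?thesis using ideal_gen_insert_homs_less[OF f F Fhom, of d] by simp
  qed
  then have "Abs_fps (?h (insert ?f ?F)) = Abs_fps (?h ?F) * (1 - fps_X ^ e)"
    by (intro fps_ext) (simp add: right_diff_distrib fps_X_power_mult_right_nth)
  then show ?case unfolding ins using Suc by (simp add: mult.assoc mult.commute)
qed

context
  fixes V :: "'v set" and fs :: "('v, 'k::field) mpoly list" and w
  assumes V: "finite V" and reg: "regular_sequence (mpoly_alg w V) fs"
    and hom: "\<And>f. f \<in> set fs \<Longrightarrow> whomogeneous (\<lambda>_. 1) 2 f" and len: "length fs = card V"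
begin

lemma hilbert_quadrics:
  "int (kv.dim (homs V d :: ('v, 'k) mpoly set)) - int (kv.dim (ideal_gen (set fs) \<inter> homs V d))
    = int (card V choose d)"
proof -
  let ?M = "Abs_fps (\<lambda>d. int (card (monomials V d)))" and ?n = "card V"
  have "(1 - fps_X ^ 2) = (1 - fps_X) * (1 + fps_X :: int fps)"
    by (simp add: algebra_simps power2_eq_square)
  then have "?M * (1 - fps_X ^ 2) ^ ?n = (?M * (1 - fps_X) ^ ?n) * (1 + fps_X) ^ ?n"
    by (simp only: power_mult_distrib mult.assoc)
  also have "\<dots> = (1 + fps_X) ^ ?n" by (simp only: monomials_fps[OF V] mult_1_left)
  finally have "fps_nth (?M * (1 - fps_X ^ 2) ^ ?n) d = fps_nth ((1 + fps_X) ^ ?n) d" by (simp only:)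
  also have "\<dots> = int (?n choose d)" by (rule one_plus_fps_X_power_nth)
  finally show ?thesis
    using arg_cong[OF hilbert_regular_sequence[OF V reg hom, of "length fs"], of "\<lambda>F. fps_nth F d"] len
    by simp
qed

lemma homs_subset_ideal: "card V < d \<Longrightarrow> homs V d \<subseteq> ideal_gen (set fs)"
proof -
  assume "card V < d"
  then have "kv.dim (homs V d :: ('v, 'k) mpoly set) \<le> kv.dim (ideal_gen (set fs) \<inter> homs V d)"
    using hilbert_quadrics[of d] by (simp add: binomial_eq_0)
  moreover obtain B :: "('v, 'k) mpoly set" where "finite B" "homs V d \<subseteq> kv.span B"
    using finite_homs_span[OF V] by metis
  ultimately show ?thesis
    using kv.subspace_dim_eqI[OF subspace_ideal_homs, of "set fs" V d "homs V d"] by blast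
qed

lemma lefschetz_injective:
  assumes i: "2 * i \<le> card V" and e: "e \<in> homs V (card V - 2 * i)"
    and surj: "\<And>g. g \<in> homs V (card V - i) \<Longrightarrow> \<exists>f\<in>homs V i. g - e * f \<in> ideal_gen (set fs)"
    and f: "f \<in> homs V i" "e * f \<in> ideal_gen (set fs)"
  shows "f \<in> ideal_gen (set fs)"
proof -
  let ?n = "card V" and ?I = "ideal_gen (set fs)"
  let ?K = "{x \<in> homs V i. e * x \<in> ?I \<inter> homs V (?n - i)}"
  have ex: "e * x \<in> homs V (?n - i)" if "x \<in> homs V i" for x
    using whomogeneous_mult[of "\<lambda>_. 1" "?n - 2 * i" e i x] e that i by (auto simp: homs_def polys_mult)
  obtain B B' :: "('v, 'k) mpoly set" where B: "finite B" "homs V i \<subseteq> kv.span B" "finite B'" "homs V (?n - i) \<subseteq> kv.span B'"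
    using finite_homs_span[OF V] by metis
  have sums: "{a + e * x |a x. a \<in> ?I \<inter> homs V (?n - i) \<and> x \<in> homs V i} = homs V (?n - i)"
  proof (intro equalityI subsetI)
    fix g :: "('v, 'k) mpoly" assume g: "g \<in> homs V (?n - i)"
    then obtain x where x: "x \<in> homs V i" "g - e * x \<in> ?I" using surj by blast
    then have "g - e * x \<in> ?I \<inter> homs V (?n - i)"
      using kv.subspace_diff[OF subspace_homs g ex] by blast
    then show "g \<in> {a + e * x |a x. a \<in> ?I \<inter> homs V (?n - i) \<and> x \<in> homs V i}"
      using x(1) by (intro CollectI exI[of _ "g - e * x"] exI[of _ x]) auto
  qed (use ex kv.subspace_add[OF subspace_homs] in blast)
  have "kv.dim {a + e * x |a x. a \<in> ?I \<inter> homs V (?n - i) \<and> x \<in> homs V i} + kv.dim ?K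
      = kv.dim (homs V i :: ('v, 'k) mpoly set) + kv.dim (?I \<inter> homs V (?n - i))"
    by (rule kv.rank_nullity_mod[OF _ _ subspace_homs B(1,2) subspace_ideal_homs B(3)])
      (use B(4) in \<open>auto simp: algebra_simps\<close>)
  then have "kv.dim (homs V (?n - i) :: ('v, 'k) mpoly set) + kv.dim ?K
      = kv.dim (homs V i :: ('v, 'k) mpoly set) + kv.dim (?I \<inter> homs V (?n - i))"
    unfolding sums .
  moreover have "?n choose (?n - i) = ?n choose i" using i by (simp add: binomial_symmetric[symmetric])
  ultimately have "kv.dim ?K \<le> kv.dim (?I \<inter> homs V i)"
    using hilbert_quadrics[of i] hilbert_quadrics[of "?n - i"] by linarith
  moreover have "?I \<inter> homs V i \<subseteq> ?K" using ex by (auto intro: idl.span_scale)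
  ultimately have "?I \<inter> homs V i = ?K"
    using B(2) by (intro kv.subspace_dim_eqI[OF subspace_ideal_homs _ B(1)]) auto
  then show ?thesis using f ex by blast
qed

end

section \<open>Graded images of polynomial algebras\<close>

locale closed_polys =
  fixes V :: "'v set" and H :: "('v, 'k::field) mpoly set"
  assumes H_sub: "H \<subseteq> polys V"
    and H_const: "mconst c \<in> H"
    and H_add: "f \<in> H \<Longrightarrow> g \<in> H \<Longrightarrow> f + g \<in> H"
    and H_mult: "f \<in> H \<Longrightarrow> g \<in> H \<Longrightarrow> f * g \<in> H"
    and H_hpart: "f \<in> H \<Longrightarrow> hpart (\<lambda>_. 1) d f \<in> H"
begin

lemma H_0: "0 \<in> H" and H_1: "1 \<in> H"
  using H_const[of 0] H_const[of 1] by simp_all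

lemma H_uminus: "f \<in> H \<Longrightarrow> - f \<in> H"
  using H_mult[OF H_const[of "- 1"]] by fastforce

lemma H_diff: "f \<in> H \<Longrightarrow> g \<in> H \<Longrightarrow> f - g \<in> H"
  using H_add[of f "- g"] H_uminus[of g] by simp

lemma H_sum: "(\<And>i. i \<in> A \<Longrightarrow> p i \<in> H) \<Longrightarrow> sum p A \<in> H"
  by (induction A rule: infinite_finite_induct) (auto intro: H_0 H_add)

lemma H_power: "f \<in> H \<Longrightarrow> f ^ k \<in> H"
  by (induction k) (auto intro: H_1 H_mult)

end

lemma closed_polys_polys: "closed_polys V (polys V)"
  by unfold_locales (auto intro: polys_add polys_mult hpart_polys)

locale graded_image = closed_polys V H
  for V :: "'v set" and H :: "('v, 'k::field) mpoly set" +
  fixes B :: "('b, 'k) galgebra" and \<pi> :: "('v, 'k) mpoly \<Rightarrow> 'b"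
  assumes \<pi>_carrier: "carrier B = \<pi> ` H"
    and \<pi>_add: "f \<in> H \<Longrightarrow> g \<in> H \<Longrightarrow> \<pi> f \<oplus>\<^bsub>B\<^esub> \<pi> g = \<pi> (f + g)"
    and \<pi>_mult: "f \<in> H \<Longrightarrow> g \<in> H \<Longrightarrow> \<pi> f \<otimes>\<^bsub>B\<^esub> \<pi> g = \<pi> (f * g)"
    and \<pi>_zero: "\<zero>\<^bsub>B\<^esub> = \<pi> 0" and \<pi>_one: "\<one>\<^bsub>B\<^esub> = \<pi> 1"
    and \<pi>_emb: "emb B c = \<pi> (mconst c)"
    and \<pi>_hcomp: "hcomp B d = \<pi> ` (H \<inter> homs V d)"
    and \<pi>_hpart: "f \<in> H \<Longrightarrow> \<pi> f = \<pi> 0 \<Longrightarrow> \<pi> (hpart (\<lambda>_. 1) d f) = \<pi> 0"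
begin

lemma \<pi>_closed: "f \<in> H \<Longrightarrow> \<pi> f \<in> carrier B"
  by (simp add: \<pi>_carrier)

lemma cring: "cring B"
proof (rule cringI)
  show "abelian_group B"
  proof (rule abelian_groupI)
    fix x assume "x \<in> carrier B"
    then obtain f where "f \<in> H" "x = \<pi> f" by (auto simp: \<pi>_carrier)
    then show "\<exists>y\<in>carrier B. y \<oplus>\<^bsub>B\<^esub> x = \<zero>\<^bsub>B\<^esub>"
      by (intro bexI[of _ "\<pi> (- f)"]) (auto simp: \<pi>_add \<pi>_zero H_uminus \<pi>_closed)
  qed (auto simp: \<pi>_carrier \<pi>_zero \<pi>_add H_0 H_add add_ac)
  show "comm_monoid B"
    by (rule comm_monoidI) (auto simp: \<pi>_carrier \<pi>_one \<pi>_mult H_1 H_mult mult_ac)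
qed (auto simp: \<pi>_carrier \<pi>_add \<pi>_mult H_add H_mult distrib_right)

sublocale B: cring B by (rule cring)

lemma \<pi>_eq_iff: "f \<in> H \<Longrightarrow> g \<in> H \<Longrightarrow> \<pi> f = \<pi> g \<longleftrightarrow> \<pi> (f - g) = \<pi> 0"
proof -
  assume f: "f \<in> H" and g: "g \<in> H"
  have "\<pi> f = \<pi> (f - g) \<oplus>\<^bsub>B\<^esub> \<pi> g" using f g by (simp add: \<pi>_add H_diff)
  then show ?thesis
    using B.add.r_cancel_one[OF \<pi>_closed[OF g] \<pi>_closed[OF H_diff[OF f g]]] by (simp add: \<pi>_zero)
qed

lemma \<pi>_sum:
  assumes "finite D" "\<And>i. i \<in> D \<Longrightarrow> p i \<in> H"
  shows "\<pi> (sum p D) = (\<Oplus>\<^bsub>B\<^esub>i\<in>D. \<pi> (p i))"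
  using assms
proof (induction D rule: finite_induct)
  case (insert i D)
  then show ?case
    by (simp add: B.finsum_insert \<pi>_closed Pi_def flip: \<pi>_add[OF _ H_sum])
qed (simp add: \<pi>_zero)

lemma graded: "graded_algebra B"
  unfolding graded_algebra_def
proof (intro conjI allI ballI)
  show "emb B \<in> ring_hom ring_of_type_algebra B"
    by (rule ring_hom_memI)
      (auto simp: ring_of_type_algebra_def \<pi>_emb \<pi>_closed H_const \<pi>_add \<pi>_mult \<pi>_one mconst_add mconst_mult)
  fix i
  show "additive_subgroup (hcomp B i) B"
  proof (rule additive_subgroup.intro, rule B.add.subgroupI)
    show "hcomp B i \<subseteq> carrier B" by (auto simp: \<pi>_hcomp \<pi>_carrier)
    show "hcomp B i \<noteq> {}" unfolding \<pi>_hcomp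
      using H_0 kv.subspace_0[OF subspace_homs] by blast
    fix a assume "a \<in> hcomp B i"
    then obtain f where f: "f \<in> H \<inter> homs V i" "a = \<pi> f" by (auto simp: \<pi>_hcomp)
    have "\<ominus>\<^bsub>B\<^esub> a = \<pi> (- f)"
      using f by (intro B.minus_equality) (auto simp: \<pi>_add H_uminus \<pi>_closed \<pi>_zero)
    moreover have "- f \<in> H \<inter> homs V i" using f H_uminus kv.subspace_neg[OF subspace_homs] by blast
    ultimately show "\<ominus>\<^bsub>B\<^esub> a \<in> hcomp B i" by (auto simp: \<pi>_hcomp)
  next
    fix a b assume "a \<in> hcomp B i" "b \<in> hcomp B i"
    then obtain f g where f: "f \<in> H \<inter> homs V i" "a = \<pi> f" "g \<in> H \<inter> homs V i" "b = \<pi> g"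
      by (auto simp: \<pi>_hcomp)
    then have "f + g \<in> H \<inter> homs V i" using H_add kv.subspace_add[OF subspace_homs] by blast
    then show "a \<oplus>\<^bsub>B\<^esub> b \<in> hcomp B i" using f by (auto simp: \<pi>_hcomp \<pi>_add)
  qed
next
  fix c show "emb B c \<in> hcomp B 0"
    by (auto simp: \<pi>_emb \<pi>_hcomp homs_def H_const)
next
  fix i j a b assume "a \<in> hcomp B i" "b \<in> hcomp B j"
  then obtain f g where f: "f \<in> H \<inter> homs V i" "a = \<pi> f" "g \<in> H \<inter> homs V j" "b = \<pi> g"
    by (auto simp: \<pi>_hcomp)
  then have "f * g \<in> H \<inter> homs V (i + j)" using H_mult by (auto simp: homs_def polys_mult whomogeneous_mult)
  then show "a \<otimes>\<^bsub>B\<^esub> b \<in> hcomp B (i + j)" using f by (auto simp: \<pi>_hcomp \<pi>_mult)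
next
  fix b assume "b \<in> carrier B"
  then obtain f where f: "f \<in> H" "b = \<pi> f" by (auto simp: \<pi>_carrier)
  let ?h = "\<lambda>i. hpart (\<lambda>_. 1) i f"
  have h: "?h i \<in> H \<inter> homs V i" for i using f H_hpart H_sub by (auto simp: homs_def hpart_polys)
  let ?D = "wdeg (\<lambda>_. 1) ` Poly_Mapping.keys f"
  have 0: "?h i = 0" if "i \<notin> ?D" for i
    using that by (intro poly_mapping_eqI) (auto simp: lookup_hpart in_keys_iff)
  let ?P = "\<lambda>g. (\<forall>i. g i \<in> hcomp B i) \<and> finite {i. g i \<noteq> \<zero>\<^bsub>B\<^esub>} \<and>
        b = (\<Oplus>\<^bsub>B\<^esub>i\<in>{i. g i \<noteq> \<zero>\<^bsub>B\<^esub>}. g i)"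
  show "\<exists>!g. ?P g"
  proof (rule ex1I[of _ "\<lambda>i. \<pi> (?h i)"])
    have sub: "{i. \<pi> (?h i) \<noteq> \<zero>\<^bsub>B\<^esub>} \<subseteq> ?D"
      using 0 by (metis (mono_tags, lifting) \<pi>_zero mem_Collect_eq subsetI)
    have "b = \<pi> (\<Sum>i\<in>?D. ?h i)" using f by (simp add: sum_hpart)
    also have "\<dots> = (\<Oplus>\<^bsub>B\<^esub>i\<in>?D. \<pi> (?h i))" using h by (intro \<pi>_sum) auto
    also have "\<dots> = (\<Oplus>\<^bsub>B\<^esub>i\<in>{i. \<pi> (?h i) \<noteq> \<zero>\<^bsub>B\<^esub>}. \<pi> (?h i))"
      using h sub by (intro B.add.finprod_mono_neutral_cong_right) (auto simp: \<pi>_closed)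
    finally show "?P (\<lambda>i. \<pi> (?h i))"
      using h finite_subset[OF sub] by (auto simp: \<pi>_hcomp)
  next
    fix g assume g: "?P g"
    let ?S = "{i. g i \<noteq> \<zero>\<^bsub>B\<^esub>}"
    have "\<forall>i. \<exists>p. p \<in> H \<inter> homs V i \<and> g i = \<pi> p" using g by (auto simp: \<pi>_hcomp)
    then obtain p where p: "\<And>i. p i \<in> H \<inter> homs V i" "\<And>i. g i = \<pi> (p i)" by metis
    have "\<pi> f = \<pi> (\<Sum>i\<in>?S. p i)"
      using g f p(1) by (subst \<pi>_sum) (auto simp flip: p(2))
    then have *: "\<pi> (f - (\<Sum>i\<in>?S. p i)) = \<pi> 0"
      using \<pi>_eq_iff f p(1) H_sum[of ?S p] by blast
    show "g = (\<lambda>i. \<pi> (?h i))"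
    proof
      fix j
      have pj: "hpart (\<lambda>_. 1) j (p i) = (if j = i then p i else 0)" for i
        using p(1)[of i] by (auto simp: homs_def hpart_homogeneous)
      have fin: "finite ?S" using g by blast
      have "hpart (\<lambda>_. 1) j (f - (\<Sum>i\<in>?S. p i)) = ?h j - (if j \<in> ?S then p j else 0)"
        unfolding hpart_diff hpart_sum pj using fin by (simp add: sum.delta)
      moreover have "f - (\<Sum>i\<in>?S. p i) \<in> H" using f p(1) H_sum[of ?S p] H_diff by blast
      ultimately have "\<pi> (?h j - (if j \<in> ?S then p j else 0)) = \<pi> 0"
        using \<pi>_hpart[OF _ *] by metis
      then have "\<pi> (?h j) = \<pi> (if j \<in> ?S then p j else 0)"
        using \<pi>_eq_iff[of "?h j" "if j \<in> ?S then p j else 0"] h p(1)[of j] H_0 by auto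
      then show "g j = \<pi> (?h j)" using p(2)[of j] \<pi>_zero by (auto split: if_splits)
    qed
  qed
qed (rule cring)

lemma subfield_emb:
  assumes "\<pi> 1 \<noteq> \<pi> 0" shows "subfield (Set.range (emb B)) B"
proof -
  let ?K = "ring_of_type_algebra :: 'k ring"
  have K: "Ring.field ?K" by (rule field_from_type_algebra)
  then have "subfield (carrier ?K) ?K" by (rule field.carrier_is_subfield)
  moreover have "ring_hom_ring ?K B (emb B)"
    using graded field.is_ring[OF K] B.ring_axioms
    by (intro ring_hom_ringI2) (auto simp: graded_algebra_def)
  ultimately have "subfield (emb B ` carrier ?K) B"
    using assms by (intro ring_hom_ring.img_is_subfield(2)) (auto simp: \<pi>_one \<pi>_zero)
  then show ?thesis by (simp add: ring_of_type_algebra_def)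
qed

lemma hcomp_0: "hcomp B 0 = Set.range (emb B)"
proof -
  have "f = mconst (Poly_Mapping.lookup f 0)" if "f \<in> homs V 0" for f :: "('v, 'k) mpoly"
  proof -
    have "m = 0" if "m \<in> Poly_Mapping.keys f" for m
    proof -
      have "wdeg (\<lambda>_. 1) m = 0" using that \<open>f \<in> homs V 0\<close> by (auto simp: homs_def whomogeneous_def)
      then show ?thesis by (intro poly_mapping_eqI) (auto simp: wdeg_def in_keys_iff)
    qed
    then show ?thesis
      by (intro poly_mapping_eqI) (auto simp: mconst_def lookup_single when_def in_keys_iff)
  qed
  then have "H \<inter> homs V 0 \<subseteq> Set.range mconst" by (metis IntD2 range_eqI subsetI)
  moreover have "Set.range mconst \<subseteq> H \<inter> homs V 0" by (auto simp: homs_def H_const)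
  ultimately have "H \<inter> homs V 0 = Set.range mconst" by (rule equalityI)
  then show ?thesis unfolding \<pi>_hcomp \<pi>_emb[abs_def] by (simp add: image_image)
qed

lemma finite_dim:
  assumes one: "\<pi> 1 \<noteq> \<pi> 0" and F: "finite F" "F \<subseteq> H"
    and span: "\<And>f. f \<in> H \<Longrightarrow> \<exists>g\<in>kv.span F. \<pi> f = \<pi> g"
  shows "B.finite_dimension (Set.range (emb B)) (carrier B)"
proof -
  let ?K = "Set.range (emb B)"
  obtain Us where Us: "set Us = \<pi> ` F" using finite_list[OF finite_imageI[OF F(1), of \<pi>]] by metis
  have Us_sub: "set Us \<subseteq> carrier B" using Us F(2) \<pi>_closed by auto
  note K = subfield_emb[OF one]
  have "g \<in> H \<and> \<pi> g \<in> B.Span ?K Us" if "g \<in> kv.span F" for g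
    using that
  proof (induction rule: kv.span_induct_alt)
    case base
    show ?case using B.Span_subgroup_props(2)[OF K Us_sub] H_0 by (simp add: \<pi>_zero)
  next
    case (step c x y)
    have x: "x \<in> H" using step F by blast
    have "\<pi> x \<in> B.Span ?K Us" using B.Span_base_incl[OF K Us_sub] Us step by auto
    then have "emb B c \<otimes>\<^bsub>B\<^esub> \<pi> x \<in> B.Span ?K Us" by (intro B.Span_smult_closed[OF K Us_sub]) auto
    moreover have "emb B c \<otimes>\<^bsub>B\<^esub> \<pi> x = \<pi> (mconst c * x)" using x by (simp add: \<pi>_emb \<pi>_mult H_const)
    ultimately have "\<pi> (mconst c * x) \<oplus>\<^bsub>B\<^esub> \<pi> y \<in> B.Span ?K Us"
      using B.Span_subgroup_props(3)[OF K Us_sub] step by auto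
    then show ?case using step x by (simp add: \<pi>_add H_add H_mult H_const)
  qed
  then have "carrier B \<subseteq> B.Span ?K Us" using span by (fastforce simp: \<pi>_carrier)
  then have "carrier B = B.Span ?K Us" using B.Span_subgroup_props(1)[OF K Us_sub] by blast
  then show ?thesis using B.Span_finite_dimension[OF K Us_sub] by simp
qed

lemma strong_lefschetz:
  assumes one: "\<pi> 1 \<noteq> \<pi> 0" and F: "finite F" "F \<subseteq> H"
    and span: "\<And>f. f \<in> H \<Longrightarrow> \<exists>g\<in>kv.span F. \<pi> f = \<pi> g"
    and e: "e \<in> H \<inter> homs V 1"
    and top: "\<And>d f. c < d \<Longrightarrow> f \<in> H \<inter> homs V d \<Longrightarrow> \<pi> f = \<pi> 0"
    and inj: "\<And>i f. 2 * i \<le> c \<Longrightarrow> f \<in> H \<inter> homs V i \<Longrightarrow> \<pi> (e ^ (c - 2 * i) * f) = \<pi> 0 \<Longrightarrow> \<pi> f = \<pi> 0"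
    and surj: "\<And>i g. 2 * i \<le> c \<Longrightarrow> g \<in> H \<inter> homs V (c - i) \<Longrightarrow>
      \<exists>f\<in>H \<inter> homs V i. \<pi> g = \<pi> (e ^ (c - 2 * i) * f)"
  shows "strong_lefschetz_property B"
  unfolding strong_lefschetz_property_def strong_lefschetz_element_def
proof (intro conjI bexI[of _ "\<pi> e"] exI[of _ c] allI impI)
  let ?L = "\<lambda>b. \<pi> e \<otimes>\<^bsub>B\<^esub> b"
  have eH: "e ^ k \<in> H" for k using e H_power by blast
  have L: "(?L ^^ k) (\<pi> f) = \<pi> (e ^ k * f)" if "f \<in> H" for k f
    using that e by (induction k) (auto simp: \<pi>_mult H_mult eH mult.assoc)
  fix i
  show "hcomp B i = {\<zero>\<^bsub>B\<^esub>}" if "c + 1 \<le> i"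
  proof -
    have "0 \<in> H \<inter> homs V i" using H_0 kv.subspace_0[OF subspace_homs] by blast
    then have 0: "{\<pi> 0} \<subseteq> \<pi> ` (H \<inter> homs V i)" by blast
    have "x \<in> {\<pi> 0}" if "x \<in> \<pi> ` (H \<inter> homs V i)" for x
    proof -
      from that obtain f where f: "x = \<pi> f" "f \<in> H \<inter> homs V i" by (rule imageE)
      have "c < i" using \<open>c + 1 \<le> i\<close> by simp
      from top[OF this f(2)] show ?thesis unfolding f(1) singleton_iff .
    qed
    then have "\<pi> ` (H \<inter> homs V i) \<subseteq> {\<pi> 0}" by (rule subsetI)
    then have "\<pi> ` (H \<inter> homs V i) = {\<pi> 0}" using 0 by (rule equalityI)
    then show ?thesis by (simp only: \<pi>_hcomp \<pi>_zero)
  qed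
  assume "i \<le> c div 2"
  then have i: "2 * i \<le> c" by simp
  let ?k = "c - 2 * i"
  have hom: "e ^ ?k * f \<in> H \<inter> homs V (c - i)" if "f \<in> H \<inter> homs V i" for f
  proof -
    have "whomogeneous (\<lambda>_. 1) (1 * ?k + i) (e ^ ?k * f)"
      using that e by (intro whomogeneous_mult whomogeneous_power) (auto simp: homs_def)
    then show ?thesis using that i H_mult[OF eH] e
      by (auto simp: homs_def intro: polys_mult polys_power)
  qed
  show "bij_betw (?L ^^ ?k) (hcomp B i) (hcomp B (c - i))"
    unfolding bij_betw_def
  proof
    show "inj_on (?L ^^ ?k) (hcomp B i)"
    proof (rule inj_onI)
      fix a b assume "a \<in> hcomp B i" "b \<in> hcomp B i" and eq: "(?L ^^ ?k) a = (?L ^^ ?k) b"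
      then obtain f g where f: "f \<in> H \<inter> homs V i" "a = \<pi> f" "g \<in> H \<inter> homs V i" "b = \<pi> g"
        by (auto simp: \<pi>_hcomp)
      have fg: "f - g \<in> H \<inter> homs V i" using f H_diff kv.subspace_diff[OF subspace_homs] by blast
      have "\<pi> (e ^ ?k * f) = \<pi> (e ^ ?k * g)" using eq f L by auto
      then have "\<pi> (e ^ ?k * f - e ^ ?k * g) = \<pi> 0" using \<pi>_eq_iff hom f by blast
      then have "\<pi> (f - g) = \<pi> 0" using inj[OF i fg] by (simp add: right_diff_distrib)
      then show "a = b" using \<pi>_eq_iff f by blast
    qed
    show "(?L ^^ ?k) ` hcomp B i = hcomp B (c - i)"
    proof (intro equalityI subsetI)
      fix b assume "b \<in> (?L ^^ ?k) ` hcomp B i"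
      then show "b \<in> hcomp B (c - i)" using L hom by (force simp: \<pi>_hcomp)
    next
      fix b assume "b \<in> hcomp B (c - i)"
      then obtain g where g: "g \<in> H \<inter> homs V (c - i)" "b = \<pi> g" by (auto simp: \<pi>_hcomp)
      obtain f where f: "f \<in> H \<inter> homs V i" "\<pi> g = \<pi> (e ^ ?k * f)" using surj[OF i g(1)] by blast
      then have "b = (?L ^^ ?k) (\<pi> f)" using g L by auto
      then show "b \<in> (?L ^^ ?k) ` hcomp B i" using f by (auto simp: \<pi>_hcomp)
    qed
  qed
qed (use graded subfield_emb[OF one] finite_dim[OF one F span] hcomp_0 e in \<open>auto simp: \<pi>_hcomp\<close>)

end

subsection \<open>Quotients\<close>

definition coset :: "('v, 'k::field) mpoly set \<Rightarrow> ('v, 'k) mpoly \<Rightarrow> ('v, 'k) mpoly set" where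
  "coset J f = (\<lambda>j. j + f) ` J"

lemma sub_alg_polys: "sub_alg (mpoly_alg w V) (polys V) = mpoly_alg w V"
  by (auto simp: sub_alg_def mpoly_alg_def polys_def)

lemma a_r_coset_sub_alg: "J +>\<^bsub>sub_alg (mpoly_alg w V) H\<^esub> f = coset J f"
  by (auto simp: a_r_coset_def r_coset_def coset_def sub_alg_def mpoly_alg_def)

lemma a_r_coset_mpoly_alg: "J +>\<^bsub>mpoly_alg w V\<^esub> f = coset J f"
  by (auto simp: a_r_coset_def r_coset_def coset_def mpoly_alg_def)

locale closed_quotient = closed_polys V H
  for V :: "'v set" and H :: "('v, 'k::field) mpoly set" +
  fixes J :: "('v, 'k) mpoly set"
  assumes J_sub: "J \<subseteq> H"
    and J_0: "0 \<in> J"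
    and J_add: "f \<in> J \<Longrightarrow> g \<in> J \<Longrightarrow> f + g \<in> J"
    and J_mult: "f \<in> H \<Longrightarrow> g \<in> J \<Longrightarrow> f * g \<in> J"
    and J_hpart: "f \<in> J \<Longrightarrow> hpart (\<lambda>_. 1) d f \<in> J"
begin

lemma J_mult_right: "g \<in> J \<Longrightarrow> f \<in> H \<Longrightarrow> g * f \<in> J"
  using J_mult[of f g] by (simp add: mult.commute)

lemma J_uminus: "f \<in> J \<Longrightarrow> - f \<in> J"
  using J_mult[OF H_const[of "- 1"]] by fastforce

lemma J_diff: "f \<in> J \<Longrightarrow> g \<in> J \<Longrightarrow> f - g \<in> J"
  using J_add[of f "- g"] J_uminus[of g] by simp

lemma coset_eq_iff: "coset J f = coset J g \<longleftrightarrow> f - g \<in> J"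
proof
  assume "coset J f = coset J g"
  then have "0 + f \<in> coset J g" using J_0 unfolding coset_def by blast
  then show "f - g \<in> J" by (auto simp: coset_def)
next
  assume fg: "f - g \<in> J"
  have "j + f \<in> coset J g" "j + g \<in> coset J f" if "j \<in> J" for j
    using J_add[OF that fg] J_diff[OF that fg] unfolding coset_def
    by (auto simp: image_iff algebra_simps intro: bexI[rotated])
  then show "coset J f = coset J g" by (auto simp: coset_def)
qed

lemma coset_0: "coset J 0 = J"
  by (simp add: coset_def)

lemma coset_eq_0_iff: "coset J f = coset J 0 \<longleftrightarrow> f \<in> J"
  by (simp add: coset_eq_iff)

abbreviation S where "S \<equiv> sub_alg (mpoly_alg (\<lambda>_. 1) V) H"

lemma S_simps: "carrier S = H" "monoid.mult S = (*)" "one S = 1" "ring.zero S = 0" "ring.add S = (+)"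
  "emb S = mconst" "hcomp S d = H \<inter> homs V d"
  using H_sub by (auto simp: sub_alg_def mpoly_alg_def homs_def polys_def)

lemma S_image: "graded_image V H S (\<lambda>f. f)"
  by unfold_locales (auto simp: S_simps)

lemma ideal_S: "ideal J S"
proof (rule idealI)
  interpret graded_image V H S "\<lambda>f. f" by (rule S_image)
  show "ring S" by (rule B.ring_axioms)
  show "subgroup J (add_monoid S)"
  proof (rule B.add.subgroupI)
    show "J \<subseteq> carrier S" using J_sub by (simp add: S_simps)
    show "J \<noteq> {}" using J_0 by blast
    fix a assume a: "a \<in> J"
    then have "\<ominus>\<^bsub>S\<^esub> a = - a"
      using J_sub H_uminus by (intro B.minus_equality) (auto simp: S_simps)
    then show "\<ominus>\<^bsub>S\<^esub> a \<in> J" using J_uminus[OF a] by simp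
  qed (auto simp: S_simps J_add)
qed (simp_all add: S_simps J_mult J_mult_right)

lemma quot_image: "graded_image V H (quot_alg S J) (coset J)"
proof
  interpret I: ideal J S by (rule ideal_S)
  note hom = I.rcos_ring_hom[unfolded a_r_coset_sub_alg[abs_def]]
  have Q: "carrier (quot_alg S J) = carrier (S Quot J)" "ring.add (quot_alg S J) = ring.add (S Quot J)"
    "monoid.mult (quot_alg S J) = monoid.mult (S Quot J)" "ring.zero (quot_alg S J) = ring.zero (S Quot J)"
    "one (quot_alg S J) = one (S Quot J)"
    by (simp_all add: quot_alg_def ring.defs)
  show "carrier (quot_alg S J) = coset J ` H"
    unfolding Q by (auto simp: FactRing_def A_RCOSETS_def' a_r_coset_sub_alg S_simps)
  show "coset J f \<oplus>\<^bsub>quot_alg S J\<^esub> coset J g = coset J (f + g)" if "f \<in> H" "g \<in> H" for f g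
    unfolding Q using ring_hom_add[OF hom, of f g] that by (simp add: S_simps)
  show "coset J f \<otimes>\<^bsub>quot_alg S J\<^esub> coset J g = coset J (f * g)" if "f \<in> H" "g \<in> H" for f g
    unfolding Q using ring_hom_mult[OF hom, of f g] that by (simp add: S_simps)
  show "\<zero>\<^bsub>quot_alg S J\<^esub> = coset J 0"
    unfolding Q by (simp add: FactRing_def coset_0)
  show "\<one>\<^bsub>quot_alg S J\<^esub> = coset J 1"
    unfolding Q by (simp add: FactRing_def a_r_coset_sub_alg S_simps)
  show "emb (quot_alg S J) c = coset J (mconst c)" for c
    by (simp add: quot_alg_def ring.defs galgebra.defs a_r_coset_sub_alg S_simps)
  show "hcomp (quot_alg S J) d = coset J ` (H \<inter> homs V d)" for d
    by (simp add: quot_alg_def ring.defs galgebra.defs a_r_coset_sub_alg S_simps)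
  show "coset J (hpart (\<lambda>_. 1) d f) = coset J 0" if "f \<in> H" "coset J f = coset J 0" for f d
    using that J_hpart by (simp add: coset_eq_0_iff)
qed

end

lemma closed_quotient_ideal_gen:
  fixes F :: "('v, 'k::field) mpoly set"
  assumes "closed_polys V H" "\<And>f. f \<in> F \<Longrightarrow> \<exists>d. whomogeneous (\<lambda>_. 1) d f"
  shows "closed_quotient V H (ideal_gen F \<inter> H)"
proof -
  interpret closed_polys V H by fact
  show ?thesis
    by unfold_locales
      (auto intro: H_0 H_add H_mult H_hpart idl.span_zero idl.span_add idl.span_scale
        ideal_gen_hpart[OF assms(2)])
qed

lemma (in graded_image) complete_intersectionI:
  fixes gs :: "(nat, 'k) mpoly list"
  assumes reg: "regular_sequence (mpoly_alg (\<lambda>_. 1) {..<m}) gs"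
    and gs: "\<And>g. g \<in> set gs \<Longrightarrow> \<exists>d. whomogeneous (\<lambda>_. 1) d g"
    and \<psi>: "ring_hom1 \<psi>" "\<And>c. \<psi> (mconst c) = mconst c"
    and \<psi>_hpart: "\<And>d f. hpart (\<lambda>_. 1) d (\<psi> f) = \<psi> (hpart (\<lambda>_. 1) d f)"
    and \<psi>_H: "\<And>f. f \<in> polys {..<m} \<Longrightarrow> \<psi> f \<in> H"
    and onto: "\<And>f. f \<in> H \<Longrightarrow> \<exists>g\<in>polys {..<m}. \<pi> f = \<pi> (\<psi> g)"
    and ker: "\<And>g. g \<in> polys {..<m} \<Longrightarrow> \<pi> (\<psi> g) = \<pi> 0 \<longleftrightarrow> g \<in> ideal_gen (set gs)"
  shows "complete_intersection B"
proof -
  interpret \<psi>: ring_hom1 \<psi> by fact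
  let ?P = "mpoly_alg (\<lambda>_. 1) {..<m} :: ((nat, 'k) mpoly, 'k) galgebra"
  let ?W = "polys {..<m} :: (nat, 'k) mpoly set"
  define J where "J = ideal_gen (set gs) \<inter> ?W"
  have idl: "genideal ?P (set gs) = J"
    using reg unfolding J_def regular_sequence_def by (intro genideal_mpoly_alg) simp
  interpret Q: closed_quotient "{..<m}" ?W J
    unfolding J_def by (rule closed_quotient_ideal_gen[OF closed_polys_polys gs])
  let ?Q = "quot_alg ?P J"
  interpret Q: graded_image "{..<m}" ?W ?Q "coset J"
    using Q.quot_image by (simp add: sub_alg_polys)
  have eq_iff: "\<pi> (\<psi> f) = \<pi> (\<psi> g) \<longleftrightarrow> coset J f = coset J g" if "f \<in> ?W" "g \<in> ?W" for f g
    using \<pi>_eq_iff[OF \<psi>_H[OF that(1)] \<psi>_H[OF that(2)]] ker[OF polys_diff[OF that]] polys_diff[OF that]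
    unfolding Q.coset_eq_iff by (simp add: J_def)
  define h where "h U = \<pi> (\<psi> (SOME g. g \<in> ?W \<and> U = coset J g))" for U
  have h: "h (coset J g) = \<pi> (\<psi> g)" if "g \<in> ?W" for g
  proof -
    have "\<exists>f. f \<in> ?W \<and> coset J g = coset J f" using that by blast
    from someI_ex[OF this] show ?thesis unfolding h_def using eq_iff[OF _ that] by metis
  qed
  have "h \<in> ring_iso ?Q B"
    unfolding ring_iso_def
  proof (intro CollectI conjI ring_hom_memI)
    show "bij_betw h (carrier ?Q) (carrier B)"
      unfolding bij_betw_def
    proof
      show "inj_on h (carrier ?Q)"
        by (rule inj_onI) (auto simp: Q.\<pi>_carrier h eq_iff)
      show "h ` carrier ?Q = carrier B"
      proof (intro equalityI subsetI)
        fix b assume "b \<in> carrier B"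
        then obtain f where "f \<in> H" "b = \<pi> f" by (auto simp: \<pi>_carrier)
        then show "b \<in> h ` carrier ?Q" using onto[of f] h by (force simp: Q.\<pi>_carrier)
      qed (auto simp: Q.\<pi>_carrier h \<psi>_H \<pi>_closed)
    qed
  qed (auto simp: Q.\<pi>_carrier Q.\<pi>_one Q.\<pi>_add Q.\<pi>_mult h \<psi>_H \<pi>_closed \<pi>_add \<pi>_mult \<pi>_one
      polys_add polys_mult)
  moreover have "h (emb ?Q c) = emb B c" for c
    by (simp add: Q.\<pi>_emb h \<pi>_emb \<psi>(2))
  moreover have "h ` hcomp ?Q d = hcomp B d" for d
  proof (intro equalityI subsetI)
    have hom: "\<psi> g \<in> H \<inter> homs V d" if "g \<in> ?W \<inter> homs {..<m} d" for g
    proof -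
      have "hpart (\<lambda>_. 1) d (\<psi> g) = \<psi> g"
        unfolding \<psi>_hpart using that hpart_homogeneous[of "\<lambda>_. 1" d g d] by (simp add: homs_def)
      then have "whomogeneous (\<lambda>_. 1) d (\<psi> g)" by (metis whomogeneous_hpart)
      then show ?thesis using \<psi>_H that H_sub by (auto simp: homs_def)
    qed
    fix b
    show "b \<in> hcomp B d" if "b \<in> h ` hcomp ?Q d"
      using that hom by (auto simp: Q.\<pi>_hcomp \<pi>_hcomp h)
    assume "b \<in> hcomp B d"
    then obtain f where f: "f \<in> H \<inter> homs V d" "b = \<pi> f" by (auto simp: \<pi>_hcomp)
    obtain g where g: "g \<in> ?W" "\<pi> f = \<pi> (\<psi> g)" using onto f by blast
    have "\<pi> (f - \<psi> g) = \<pi> 0" using \<pi>_eq_iff f g \<psi>_H by blast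
    then have "\<pi> (hpart (\<lambda>_. 1) d (f - \<psi> g)) = \<pi> 0"
      using \<pi>_hpart f g \<psi>_H H_diff by blast
    moreover have "hpart (\<lambda>_. 1) d (f - \<psi> g) = f - \<psi> (hpart (\<lambda>_. 1) d g)"
      using f hpart_homogeneous[of "\<lambda>_. 1" d f d] by (simp add: hpart_diff \<psi>_hpart homs_def)
    ultimately have "b = \<pi> (\<psi> (hpart (\<lambda>_. 1) d g))"
      using \<pi>_eq_iff f \<psi>_H hpart_polys[OF g(1)] by auto
    moreover have "hpart (\<lambda>_. 1) d g \<in> ?W \<inter> homs {..<m} d"
      using hpart_polys[OF g(1)] by (simp add: homs_def)
    ultimately show "b \<in> h ` hcomp ?Q d" using h by (force simp: Q.\<pi>_hcomp)
  qed
  ultimately show ?thesis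
    unfolding complete_intersection_def Let_def using reg gs idl
    by (intro exI[of _ m] exI[of _ "\<lambda>_. 1"] exI[of _ gs] exI[of _ h]) simp
qed

section \<open>The quadrics and their normal form\<close>

lemma square_sum_eq:
  fixes x :: "nat \<Rightarrow> 'a::comm_ring_1"
  assumes "finite A"
  shows "(\<Sum>j\<in>A. x j) ^ 2 = (\<Sum>j\<in>A. x j ^ 2) + 2 * (\<Sum>(k, l)\<in>{(k, l). k \<in> A \<and> l \<in> A \<and> k < l}. x k * x l)"
proof -
  let ?L = "{(k, l). k \<in> A \<and> l \<in> A \<and> k < l}" and ?D = "(\<lambda>j. (j, j)) ` A"
  let ?f = "\<lambda>(k, l). x k * x l"
  have fin: "finite ?L" by (rule finite_subset[of _ "A \<times> A"]) (use assms in auto)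
  have "A \<times> A = ?D \<union> (?L \<union> prod.swap ` ?L)" by (auto simp: image_iff)
  then have "(\<Sum>j\<in>A. x j) ^ 2 = sum ?f (?D \<union> (?L \<union> prod.swap ` ?L))"
    by (simp add: power2_eq_square sum_product sum.cartesian_product)
  also have "\<dots> = sum ?f ?D + (sum ?f ?L + sum ?f (prod.swap ` ?L))"
    using assms fin by (subst sum.union_disjoint; (subst sum.union_disjoint)?) auto
  also have "sum ?f ?D = (\<Sum>j\<in>A. x j ^ 2)"
    by (subst sum.reindex) (auto simp: inj_on_def power2_eq_square)
  also have "sum ?f (prod.swap ` ?L) = sum ?f ?L"
    by (subst sum.reindex) (auto simp: inj_on_def case_prod_unfold mult.commute intro: sum.cong)
  finally show ?thesis by simp
qed

lemma mconst_inverse_mult: "(c :: 'k::field) \<noteq> 0 \<Longrightarrow> mconst (1 / c) * mconst c = 1"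
  by (simp flip: mconst_mult)

definition psum2 :: "nat \<Rightarrow> (nat, 'k::field) mpoly" where
  "psum2 n = (\<Sum>j\<in>{1..n}. mvar j ^ 2)"

definition nform :: "nat \<Rightarrow> 'k::field \<Rightarrow> 'k \<Rightarrow> 'k \<Rightarrow> 'k \<Rightarrow> nat \<Rightarrow> (nat, 'k) mpoly" where
  "nform n a b c d i = mconst a * mvar i ^ 2 + mconst b * (e1 n * mvar i) + mconst c * psum2 n + mconst d * e1 n ^ 2"

lemma quadric_nform:
  fixes p :: "4 \<Rightarrow> 'k::field_char_0"
  assumes i: "i \<in> {1..n}"
  shows "quadric n p i = nform n (p 0 - p 1 - p 2 + p 3) (p 1 - p 3) (p 2 - p 3 / 2) (p 3 / 2) i"
proof -
  let ?A = "{1..n} - {i}" and ?x = "mvar i :: (nat, 'k) mpoly"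
  let ?s = "\<Sum>j\<in>?A. mvar j :: (nat, 'k) mpoly" and ?q = "\<Sum>j\<in>?A. mvar j ^ 2 :: (nat, 'k) mpoly"
  define E where "E = (\<Sum>(k, l)\<in>{(k, l). 1 \<le> k \<and> k < l \<and> l \<le> n \<and> k \<noteq> i \<and> l \<noteq> i}. mvar k * mvar l :: (nat, 'k) mpoly)"
  have "{(k, l). k \<in> ?A \<and> l \<in> ?A \<and> k < l} = {(k, l). 1 \<le> k \<and> k < l \<and> l \<le> n \<and> k \<noteq> i \<and> l \<noteq> i}"
    by auto
  then have E: "?s ^ 2 = ?q + 2 * E"
    using square_sum_eq[of ?A "mvar :: nat \<Rightarrow> (nat, 'k) mpoly"] by (simp add: E_def)
  have e: "e1 n = ?x + ?s" "psum2 n = ?x ^ 2 + ?q"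
    unfolding e1_def psum2_def using i by (simp_all add: sum.remove)
  define h where "h = (mconst (p 3 / 2) :: (nat, 'k) mpoly)"
  have h: "mconst (p 3) = h + h" unfolding h_def by (simp flip: mconst_add)
  have h2: "2 * h * E = h * ?s ^ 2 - h * ?q" unfolding E by (simp add: algebra_simps)
  have "quadric n p i = mconst (p 0) * ?x ^ 2 + mconst (p 1) * ?s * ?x + mconst (p 2) * ?q + mconst (p 3) * E"
    by (simp add: quadric_def E_def)
  also have "\<dots> = mconst (p 0) * ?x ^ 2 + mconst (p 1) * ?s * ?x + mconst (p 2) * ?q + (h * ?s ^ 2 - h * ?q)"
    using h2 by (simp add: h algebra_simps)
  also have "\<dots> = nform n (p 0 - p 1 - p 2 + p 3) (p 1 - p 3) (p 2 - p 3 / 2) (p 3 / 2) i"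
    unfolding nform_def e mconst_add mconst.hom_diff h h_def[symmetric]
    by (simp add: algebra_simps power2_eq_square)
  finally show ?thesis .
qed

lemma set_quadrics: "set (quadrics n p) = quadric n p ` {1..n}"
  by (auto simp: quadrics_def)

lemma e1_polys: "e1 n \<in> polys {1..n}" and psum2_polys: "psum2 n \<in> polys {1..n}"
  by (auto simp: e1_def psum2_def intro!: polys_intros)

lemma homogeneous_e1: "whomogeneous (\<lambda>_. 1) 1 (e1 n)"
  unfolding e1_def by (intro whomogeneous_sum whomogeneous_mvar) simp

lemma homogeneous_square: "whomogeneous (\<lambda>_. 1) 1 f \<Longrightarrow> whomogeneous (\<lambda>_. 1) 2 (f ^ 2)"
  using whomogeneous_power[of "\<lambda>_. 1" 1 f 2] by simp

lemma homogeneous_psum2: "whomogeneous (\<lambda>_. 1) 2 (psum2 n)"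
  unfolding psum2_def by (intro whomogeneous_sum homogeneous_square whomogeneous_mvar) simp

lemma nform_polys: "i \<in> {1..n} \<Longrightarrow> nform n a b c d i \<in> polys {1..n}"
  unfolding nform_def by (intro polys_intros polys_mconst e1_polys psum2_polys) auto

lemma homogeneous_nform: "whomogeneous (\<lambda>_. 1) 2 (nform n a b c d i)"
proof -
  have "whomogeneous (\<lambda>_. 1) (1 + 1) (e1 n * mvar i :: (nat, 'a) mpoly)"
    by (intro whomogeneous_mult homogeneous_e1 whomogeneous_mvar) simp
  then show ?thesis unfolding nform_def
    by (intro whomogeneous_add whomogeneous_mconst_mult homogeneous_square whomogeneous_mvar
        homogeneous_e1 homogeneous_psum2) auto
qed

lemma I_ideal_eq:
  fixes p :: "4 \<Rightarrow> 'k::field_char_0"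
  shows "I_ideal n p = ideal_gen (set (quadrics n p)) \<inter> polys {1..n}"
  unfolding I_ideal_def
  by (rule genideal_mpoly_alg) (auto simp: set_quadrics quadric_nform nform_polys)

lemma sum_nform:
  "(\<Sum>i\<in>{1..n}. nform n a b c d i) =
     mconst (a + of_nat n * c) * psum2 n + mconst (b + of_nat n * d) * e1 n ^ 2"
  unfolding nform_def sum.distrib
  by (simp add: psum2_def e1_def mconst_add mconst_mult power2_eq_square sum_distrib_left[symmetric]
      sum_distrib_right[symmetric] algebra_simps)

definition normal_quadric :: "nat \<Rightarrow> 'k::field_char_0 \<Rightarrow> 'k \<Rightarrow> nat \<Rightarrow> (nat, 'k) mpoly" where
  "normal_quadric n s t i = mvar i ^ 2 - mconst s * (e1 n * mvar i) - mconst t * e1 n ^ 2"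

lemma ideal_normal_quadrics:
  fixes a b c d :: "'k::field_char_0"
  assumes f: "\<And>i. i \<in> {1..n} \<Longrightarrow> f i = nform n a b c d i"
    and a: "a \<noteq> 0" and ac: "a + of_nat n * c \<noteq> 0"
  shows "\<exists>s t. ideal_gen (f ` {1..n}) = ideal_gen (normal_quadric n s t ` {1..n})"
proof (intro exI)
  define N s t where "N = (of_nat n :: 'k)" and "s = - b / a" and "t = - (d + c * s) / (a + N * c)"
  define la where "la = (b + N * d) / (a + N * c)"
  let ?q = "normal_quadric n s t"
  have ac: "a + N * c \<noteq> 0" using ac by (simp add: N_def)
  have sumq: "(\<Sum>i\<in>{1..n}. ?q i) = psum2 n - mconst (s + N * t) * e1 n ^ 2"
    unfolding normal_quadric_def sum_subtractf
    by (simp add: psum2_def e1_def N_def mconst_add mconst_mult power2_eq_square sum_distrib_left[symmetric]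
      sum_distrib_right[symmetric] algebra_simps)
  have as: "a * s = - b" using a by (simp add: s_def)
  have ts: "t * (a + N * c) = - (d + c * s)" using ac by (simp add: t_def)
  have *: "a * t + c * (s + N * t) = - d"
    using ts by (simp add: algebra_simps)
  have f_eq: "f i = mconst a * ?q i + mconst c * (\<Sum>i\<in>{1..n}. ?q i)" if "i \<in> {1..n}" for i
  proof -
    have "mconst a * ?q i + mconst c * (\<Sum>i\<in>{1..n}. ?q i) =
      mconst a * mvar i ^ 2 - mconst (a * s) * (e1 n * mvar i) + mconst c * psum2 n
        - mconst (a * t + c * (s + N * t)) * e1 n ^ 2"
      unfolding sumq unfolding normal_quadric_def by (simp add: mconst_add mconst_mult algebra_simps)
    then show ?thesis unfolding f[OF that] nform_def as * by (simp add: mconst.hom_uminus)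
  qed
  have "d * (a + N * c) - c * (b + N * d) = - (a * t) * (a + N * c)"
  proof -
    have ad: "a * d = - (a * (a * t + c * (s + N * t)))" and b: "b = - (a * s)" using * as by simp_all
    show ?thesis unfolding b by (simp add: ad algebra_simps)
  qed
  then have "d - c * la = - (a * t)"
    using ac unfolding la_def by (simp add: field_simps)
  then have t': "(d - c * la) / a = - t" using a by (simp add: field_simps)
  have q_eq: "?q i = mconst (1 / a) * (f i - mconst (c / (a + N * c)) * (\<Sum>i\<in>{1..n}. f i))"
    if "i \<in> {1..n}" for i
  proof -
    have sumf: "(\<Sum>i\<in>{1..n}. f i) = mconst (a + N * c) * psum2 n + mconst (b + N * d) * e1 n ^ 2"
      using f sum_nform[of n a b c d] by (simp add: N_def)
    have "mconst (c / (a + N * c)) * (\<Sum>i\<in>{1..n}. f i) =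
      mconst (c / (a + N * c) * (a + N * c)) * psum2 n + mconst (c / (a + N * c) * (b + N * d)) * e1 n ^ 2"
      unfolding sumf distrib_left[of "mconst (c / (a + N * c))"] mconst_mult mult.assoc ..
    also have "\<dots> = mconst c * psum2 n + mconst (c * la) * e1 n ^ 2"
      using ac by (simp add: la_def)
    finally have "mconst (1 / a) * (f i - mconst (c / (a + N * c)) * (\<Sum>i\<in>{1..n}. f i)) =
      mconst (1 / a * a) * mvar i ^ 2 + mconst (1 / a * b) * (e1 n * mvar i) + mconst (1 / a * (d - c * la)) * e1 n ^ 2"
      unfolding f[OF that] nform_def mconst_mult mconst.hom_diff by (simp only: algebra_simps)
    also have "1 / a * (d - c * la) = - t" using t' by simp
    also have "1 / a * b = - s" by (simp add: s_def)
    finally show ?thesis using a unfolding normal_quadric_def by (simp add: mconst.hom_uminus)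
  qed
  show "ideal_gen (f ` {1..n}) = ideal_gen (?q ` {1..n})"
  proof (rule ideal_gen_eqI)
    have "f i \<in> ideal_gen (?q ` {1..n})" if "i \<in> {1..n}" for i
      unfolding f_eq[OF that]
      by (intro idl.span_add idl.span_scale idl.span_sum idl.span_base) (use that in auto)
    then show "f ` {1..n} \<subseteq> ideal_gen (?q ` {1..n})" by blast
    have "?q i \<in> ideal_gen (f ` {1..n})" if "i \<in> {1..n}" for i
      unfolding q_eq[OF that]
      by (intro idl.span_diff idl.span_scale idl.span_sum idl.span_base) (use that in auto)
    then show "?q ` {1..n} \<subseteq> ideal_gen (f ` {1..n})" by blast
  qed
qed

lemma generic_normal_quadrics:
  fixes p :: "4 \<Rightarrow> 'k::field_char_0"
  assumes "p 0 - p 1 - p 2 + p 3 \<noteq> 0"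
    and "2 * (p 0 - p 1 - p 2 + p 3) + of_nat n * (2 * p 2 - p 3) \<noteq> 0"
  shows "\<exists>s t. ideal_gen (set (quadrics n p)) = ideal_gen (normal_quadric n s t ` {1..n})"
proof -
  have "2 * ((p 0 - p 1 - p 2 + p 3) + of_nat n * (p 2 - p 3 / 2)) \<noteq> 0"
    using assms(2) by (simp add: algebra_simps)
  then have ac: "(p 0 - p 1 - p 2 + p 3) + of_nat n * (p 2 - p 3 / 2) \<noteq> 0" by (metis mult_zero_right)
  show ?thesis
    unfolding set_quadrics by (rule ideal_normal_quadrics[OF _ assms(1) ac]) (rule quadric_nform)
qed

text \<open>
  For \<open>n = 2\<close> the decomposition into the four types of terms is not unique, because
  \<open>e\<^sub>1 x\<^sub>i = x\<^sub>i\<^sup>2 + x\<^sub>1 x\<^sub>2\<close>; this covers parameters with \<open>a = 0\<close> and a regular sequence.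
\<close>
lemma nform_2:
  fixes a b c d :: "'k::field_char_0"
  assumes "i \<in> {1..2}"
  shows "nform 2 a b c d i = nform 2 (a + b) 0 (c - b / 2) (d + b / 2) i"
proof -
  define h where "h = (mconst (b / 2) :: (nat, 'k) mpoly)"
  have h: "mconst b = h + h" unfolding h_def by (simp flip: mconst_add)
  have "{1..2} = {1, 2 :: nat}" by auto
  then have e: "e1 2 = mvar 1 + mvar 2" "psum2 2 = mvar 1 ^ 2 + mvar 2 ^ 2" "i = 1 \<or> i = 2"
    using assms by (simp_all add: e1_def psum2_def)
  show ?thesis
    using e(3) unfolding nform_def e mconst_add mconst.hom_diff h h_def[symmetric]
    by (elim disjE) (simp_all add: algebra_simps power2_eq_square)
qed

lemma regular_normal_quadrics:
  fixes p :: "4 \<Rightarrow> 'k::field_char_0"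
  assumes n: "1 \<le> n" and reg: "regular_sequence (R_alg n) (quadrics n p)"
    and e1: "e1 n ^ 2 \<notin> I_ideal n p"
  shows "\<exists>s t. ideal_gen (set (quadrics n p)) = ideal_gen (normal_quadric n s t ` {1..n})"
proof -
  let ?I = "ideal_gen (set (quadrics n p))"
  define a b c d where "a = p 0 - p 1 - p 2 + p 3" and "b = p 1 - p 3"
    and "c = p 2 - p 3 / 2" and "d = p 3 / 2"
  have f: "quadric n p i = nform n a b c d i" if "i \<in> {1..n}" for i
    using quadric_nform[OF that] by (simp add: a_def b_def c_def d_def)
  have fI: "quadric n p i \<in> ?I" if "i \<in> {1..n}" for i
    using that by (auto simp: set_quadrics intro: idl.span_base)
  have sub: "quadric n p ` {1..n} \<subseteq> polys {1..n}" by (auto simp: f nform_polys)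
  have one: "1 \<notin> ?I"
  proof
    assume "1 \<in> ?I"
    then have "x \<in> ?I" for x using idl.span_scale[of 1 _ x] by simp
    then have "I_ideal n p = carrier (R_alg n)" unfolding I_ideal_eq by auto
    then show False using reg by (simp add: regular_sequence_def I_ideal_def)
  qed
  have nzd: "g \<in> ideal_gen (quadric n p ` {1..k})"
    if "Suc k \<le> n" "g \<in> polys {1..n}" "quadric n p (Suc k) * g \<in> ideal_gen (quadric n p ` {1..k})" for k g
  proof -
    have len: "k < length (quadrics n p)" using that(1) by (simp add: quadrics_def)
    have nth: "quadrics n p ! k = quadric n p (Suc k)"
      using that(1) by (simp add: quadrics_def nth_upt One_nat_def del: upt_Suc)
    have take: "set (take k (quadrics n p)) = quadric n p ` {1..k}"
      using that(1) by (auto simp: quadrics_def take_map simp flip: image_set)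
    have F: "quadric n p ` {1..k} \<subseteq> polys {1..n}" using sub that(1) by (auto simp: image_subset_iff)
    have "quadric n p (Suc k) * g \<in> polys {1..n}"
      using sub that(1,2) by (intro polys_mult) auto
    then show ?thesis
      using reg len that(2,3) nth unfolding regular_sequence_def
      by (auto simp: take genideal_mpoly_alg[OF F])
  qed
  have pos: "quadric n p (Suc k) \<notin> ideal_gen (quadric n p ` {1..k})" if "Suc k \<le> n" for k
  proof
    assume "quadric n p (Suc k) \<in> ideal_gen (quadric n p ` {1..k})"
    then have "1 \<in> ideal_gen (quadric n p ` {1..k})" using nzd[OF that, of 1] by simp
    moreover have "ideal_gen (quadric n p ` {1..k}) \<subseteq> ?I"
      unfolding set_quadrics using that by (intro idl.span_mono image_mono) auto
    ultimately show False using one by blast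
  qed
  have ac: "a + of_nat n * c \<noteq> 0"
  proof
    assume 0: "a + of_nat n * c = 0"
    have sum: "(\<Sum>i\<in>{1..n}. quadric n p i) = mconst (b + of_nat n * d) * e1 n ^ 2"
      using f sum_nform[of n a b c d] 0 by simp
    show False
    proof (cases "b + of_nat n * d = 0")
      case True
      obtain k where k: "n = Suc k" using n by (cases n) auto
      have "quadric n p (Suc k) = - (\<Sum>i\<in>{1..k}. quadric n p i)"
        using sum True unfolding k by (simp add: add_eq_0_iff2)
      also have "\<dots> \<in> ideal_gen (quadric n p ` {1..k})"
        by (intro idl.span_neg idl.span_sum idl.span_base) auto
      finally show False using pos[of k] k by simp
    next
      case False
      have "mconst (1 / (b + of_nat n * d)) * (\<Sum>i\<in>{1..n}. quadric n p i) \<in> ?I"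
        by (intro idl.span_scale idl.span_sum fI)
      moreover have "mconst (1 / (b + of_nat n * d)) * mconst (b + of_nat n * d) = (1 :: (nat, 'k) mpoly)"
        by (rule mconst_inverse_mult[OF False])
      ultimately have "e1 n ^ 2 \<in> ?I" unfolding sum by (simp only: mult.assoc[symmetric] mult_1_left)
      then show False using e1 e1_polys[of n] by (auto simp: I_ideal_eq intro: polys_power)
    qed
  qed
  consider "n = 1" | "n = 2" | "3 \<le> n" using n by linarith
  then show ?thesis
  proof cases
    case 1
    have e: "e1 1 = mvar 1" "psum2 1 = mvar 1 ^ 2" by (simp_all add: e1_def psum2_def)
    have q1: "quadric n p 1 = mconst (a + b + c + d) * e1 n ^ 2"
      using f[of 1] 1 by (simp add: nform_def e mconst_add algebra_simps power2_eq_square)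
    show ?thesis
    proof (cases "a + b + c + d = 0")
      case True
      then show ?thesis using pos[of 0] q1 1 by (simp add: One_nat_def idl.span_zero)
    next
      case False
      have "mconst (1 / (a + b + c + d)) * quadric n p 1 \<in> ?I"
        using fI[of 1] 1 by (intro idl.span_scale) auto
      moreover have "mconst (1 / (a + b + c + d)) * mconst (a + b + c + d) = (1 :: (nat, 'k) mpoly)"
        by (rule mconst_inverse_mult[OF False])
      ultimately have "e1 n ^ 2 \<in> ?I" unfolding q1 by (simp only: mult.assoc[symmetric] mult_1_left)
      then show ?thesis using e1 e1_polys[of n] by (auto simp: I_ideal_eq intro: polys_power)
    qed
  next
    case 2
    have f2: "quadric n p i = nform n (a + b) 0 (c - b / 2) (d + b / 2) i" if "i \<in> {1..n}" for i
      using f[OF that] nform_2[of i a b c d] that 2 by simp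
    have ab: "a + b \<noteq> 0"
    proof
      assume "a + b = 0"
      then have "quadric n p (Suc 1) = quadric n p 1" using f2 2 by (simp add: nform_def)
      then show False using pos[of 1] 2 by (simp add: idl.span_base)
    qed
    have ac2: "(a + b) + of_nat n * (c - b / 2) \<noteq> 0" using ac 2 by simp
    show ?thesis unfolding set_quadrics by (rule ideal_normal_quadrics[OF f2 ab ac2])
  next
    case 3
    have a: "a \<noteq> 0"
    proof
      assume a: "a = 0"
      let ?f = "quadric n p" and ?x = "mvar :: nat \<Rightarrow> (nat, 'k) mpoly"
      have "?f 3 * (?x 2 - ?x 1) = ?f 1 * (?x 2 - ?x 3) + ?f 2 * (?x 3 - ?x 1)"
        using 3 by (simp add: f nform_def a algebra_simps)
      also have "\<dots> \<in> ideal_gen (?f ` {1..2})"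
        by (intro idl.span_add ideal_gen_mult_right idl.span_base) auto
      finally have "?f (Suc 2) * (?x 2 - ?x 1) \<in> ideal_gen (?f ` {1..2})"
        by (simp add: numeral_3_eq_3 numeral_2_eq_2)
      then have "?x 2 - ?x 1 \<in> ideal_gen (?f ` {1..2})"
      proof (rule nzd[of 2, rotated 2])
        show "?x 2 - ?x 1 \<in> polys {1..n}" using 3 by (intro polys_diff polys_mvar) auto
      qed (use 3 in auto)
      moreover have "hpart (\<lambda>_. 1) 1 g = 0" if "g \<in> ideal_gen (?f ` {1..2})" for g
        using that
      proof (induction rule: idl.span_induct_alt)
        case (step c x y)
        then have "whomogeneous (\<lambda>_. 1) 2 x" using 3 by (auto simp: f homogeneous_nform)
        then have "hpart (\<lambda>_. 1) 1 (x * c) = 0" by (simp add: hpart_mult_homogeneous)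
        then show ?case using step by (simp add: hpart_add mult.commute)
      qed simp
      moreover have "whomogeneous (\<lambda>_. 1) 1 (?x 2 - ?x 1)"
        by (intro whomogeneous_diff whomogeneous_mvar) auto
      ultimately have "?x 2 - ?x 1 = 0" by (metis hpart_homogeneous)
      then have "meval_at (\<lambda>v. if v = 2 then 1 else 0) (?x 2 - ?x 1) = 0" by simp
      then show False by simp
    qed
    show ?thesis unfolding set_quadrics by (rule ideal_normal_quadrics[OF f a ac])
  qed
qed

section \<open>Comparison with the deformed algebra\<close>

locale quad_algebra = deformed n r Blk "t + s ^ 2 / 4" "1 - of_nat n * s / 2"
  for n r :: nat and Blk :: "nat \<Rightarrow> nat set" and s t :: "'k::field_char_0" +
  fixes p :: "4 \<Rightarrow> 'k"
  assumes ideal_eq: "ideal_gen (set (quadrics n p)) = ideal_gen (normal_quadric n s t ` {1..n})"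
begin

abbreviation \<tau> :: 'k where "\<tau> \<equiv> t + s ^ 2 / 4"
abbreviation \<kappa> :: 'k where "\<kappa> \<equiv> 1 - of_nat n * s / 2"

definition I :: "(nat, 'k) mpoly set" where "I = ideal_gen (normal_quadric n s t ` {1..n})"
definition \<sigma>2 :: "(nat, 'k) mpoly" where "\<sigma>2 = mconst (s / 2)"
definition \<Lambda> :: "(nat, 'k) mpoly \<Rightarrow> (nat, 'k) mpoly" where
  "\<Lambda> = msubst (\<lambda>i. if i = 0 then e1 n else mvar i - \<sigma>2 * e1 n)"
definition \<Gamma> :: "(nat, 'k) mpoly \<Rightarrow> (nat, 'k) mpoly" where
  "\<Gamma> = msubst (\<lambda>i. mvar i + \<sigma>2 * z)"

sublocale \<Lambda>: ring_hom1 \<Lambda> unfolding \<Lambda>_def by (rule msubst.ring_hom1_axioms)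
sublocale \<Gamma>: ring_hom1 \<Gamma> unfolding \<Gamma>_def by (rule msubst.ring_hom1_axioms)

lemma \<Lambda>_mconst [simp]: "\<Lambda> (mconst c) = mconst c" and \<Gamma>_mconst [simp]: "\<Gamma> (mconst c) = mconst c"
  by (simp_all add: \<Lambda>_def \<Gamma>_def)

lemma \<Lambda>_mvar: "\<Lambda> (mvar i) = (if i = 0 then e1 n else mvar i - \<sigma>2 * e1 n)"
  and \<Gamma>_mvar: "\<Gamma> (mvar i) = mvar i + \<sigma>2 * z"
  by (simp_all add: \<Lambda>_def \<Gamma>_def)

lemma \<Lambda>_z [simp]: "\<Lambda> z = e1 n" by (simp add: z_def \<Lambda>_mvar)

lemma \<sigma>2_hom [simp]: "\<Lambda> \<sigma>2 = \<sigma>2" "\<Gamma> \<sigma>2 = \<sigma>2" "perm_act \<sigma> \<sigma>2 = \<sigma>2"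
  by (simp_all add: \<sigma>2_def)

lemma \<sigma>2: "mconst s = \<sigma>2 + \<sigma>2" "mconst (s ^ 2 / 4) = \<sigma>2 ^ 2"
  "mconst (of_nat n * s / 2) = of_nat n * \<sigma>2"
proof -
  show "mconst s = \<sigma>2 + \<sigma>2" unfolding \<sigma>2_def by (simp flip: mconst_add)
  have "s ^ 2 / 4 = s / 2 * (s / 2)" "of_nat n * s / 2 = of_nat n * (s / 2)"
    by (simp_all add: power2_eq_square)
  then show "mconst (s ^ 2 / 4) = \<sigma>2 ^ 2" "mconst (of_nat n * s / 2) = of_nat n * \<sigma>2"
    unfolding \<sigma>2_def by (simp_all only: mconst_mult power2_eq_square mconst.hom_of_nat)
qed

lemma q_eq: "q = (mconst t + \<sigma>2 ^ 2) * z ^ 2"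
  unfolding q_def mconst_add \<sigma>2 ..

lemma ylin_eq: "ylin = Y {1..n} - (1 - of_nat n * \<sigma>2) * z"
  unfolding ylin_def mconst.hom_diff \<sigma>2 by simp

lemma normal_quadric_eq:
  "normal_quadric n s t i = mvar i ^ 2 - (\<sigma>2 + \<sigma>2) * (e1 n * mvar i) - mconst t * e1 n ^ 2"
  by (simp add: normal_quadric_def \<sigma>2)

lemma normal_quadric_I: "i \<in> {1..n} \<Longrightarrow> normal_quadric n s t i \<in> I"
  unfolding I_def by (intro idl.span_base) auto

lemma subspace_I: "idl.subspace I"
  unfolding I_def by (rule idl.subspace_span)

lemma I_ideal_eq_I: "I_ideal n p = I \<inter> polys {1..n}"
  by (simp add: I_ideal_eq ideal_eq I_def)

lemma \<Lambda>_polys: "f \<in> polys {0..n} \<Longrightarrow> \<Lambda> f \<in> polys {1..n}"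
  unfolding \<Lambda>_def \<sigma>2_def
  by (erule msubst_polys) (auto intro!: polys_diff polys_mult polys_mvar e1_polys)

lemma \<Gamma>_polys: "f \<in> polys {1..n} \<Longrightarrow> \<Gamma> f \<in> polys {0..n}"
  unfolding \<Gamma>_def \<sigma>2_def
  by (erule msubst_polys) (auto intro!: polys_add polys_mult polys_mvar z_polys)

lemma \<Lambda>_ylin: "\<Lambda> ylin = 0"
proof -
  have "\<Lambda> (Y {1..n}) = e1 n - of_nat n * (\<sigma>2 * e1 n)"
    by (simp add: Y_def \<Lambda>.hom_sum \<Lambda>_mvar sum_subtractf e1_def)
  then show ?thesis unfolding ylin_eq by (simp add: algebra_simps)
qed

lemma \<Lambda>_Jl: "f \<in> Jl \<Longrightarrow> \<Lambda> f \<in> I"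
  unfolding Jl_def I_def
proof (rule ideal_gen_hom[OF \<Lambda>.ring_hom1_axioms])
  fix f assume "f \<in> insert ylin (squares q {1..n})"
  then consider "f = ylin" | i where "i \<in> {1..n}" "f = mvar i ^ 2 - q" by blast
  then show "\<Lambda> f \<in> ideal_gen (normal_quadric n s t ` {1..n})"
  proof cases
    case 2
    have \<Lambda>q: "\<Lambda> q = (mconst t + \<sigma>2 ^ 2) * e1 n ^ 2" unfolding q_eq by simp
    have \<Lambda>i: "\<Lambda> (mvar i) = mvar i - \<sigma>2 * e1 n" using 2(1) by (simp add: \<Lambda>_mvar)
    have "\<Lambda> f = normal_quadric n s t i"
      unfolding 2(2) \<Lambda>.hom_diff \<Lambda>.hom_power \<Lambda>q \<Lambda>i normal_quadric_eq
      by (simp add: algebra_simps power2_eq_square)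
    then show ?thesis using normal_quadric_I[OF 2(1)] by (simp add: I_def)
  qed (simp add: \<Lambda>_ylin idl.span_zero)
qed

lemma \<Gamma>_e1: "\<Gamma> (e1 n) = ylin + z"
  unfolding ylin_eq by (simp add: e1_def Y_def \<Gamma>.hom_sum \<Gamma>_mvar sum.distrib algebra_simps)

lemma \<Gamma>_I: "f \<in> I \<Longrightarrow> \<Gamma> f \<in> Jl"
  unfolding I_def Jl_def
proof (rule ideal_gen_hom[OF \<Gamma>.ring_hom1_axioms])
  fix f assume "f \<in> normal_quadric n s t ` {1..n}"
  then obtain i where i: "i \<in> {1..n}" "f = normal_quadric n s t i" by blast
  have "\<Gamma> 2 = 2" using \<Gamma>.hom_of_nat[of 2] by simp
  then have "\<Gamma> f = (mvar i ^ 2 - q) - ((\<sigma>2 + \<sigma>2) * (mvar i + \<sigma>2 * z) + mconst t * (z + z + ylin)) * ylin"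
    unfolding i(2) normal_quadric_eq q_eq
    by (simp add: \<Gamma>_e1 \<Gamma>_mvar algebra_simps power2_eq_square)
  also have "\<dots> \<in> Jl"
    by (rule Jl_simps(2)[OF _ Jl_simps(3)[OF ylin_Jl]]) (use square_mem_J[OF i(1)] J_subset_Jl in blast)
  finally show "\<Gamma> f \<in> ideal_gen (insert ylin (squares q {1..n}))" unfolding Jl_def .
qed

lemma \<Lambda>_\<Gamma>: "f \<in> polys {1..n} \<Longrightarrow> \<Lambda> (\<Gamma> f) = f"
proof (induction rule: mpoly_induct)
  case (mvar v f)
  then show ?case by (simp add: \<Gamma>_mvar \<Lambda>_mvar)
qed auto

lemma \<Gamma>_\<Lambda>: "f \<in> polys {0..n} \<Longrightarrow> \<Gamma> (\<Lambda> f) - f \<in> Jl"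
proof (induction rule: mpoly_induct)
  case (add f g)
  then show ?case using Jl_simps(1)[of "\<Gamma> (\<Lambda> f) - f" "\<Gamma> (\<Lambda> g) - g"] by (simp add: algebra_simps)
next
  case (mvar v f)
  have "\<Gamma> (\<Lambda> (mvar v)) - mvar v \<in> Jl"
  proof (cases "v = 0")
    case True
    then show ?thesis using ylin_Jl by (simp add: \<Lambda>_mvar \<Gamma>_e1 z_def)
  next
    case False
    then have "\<Gamma> (\<Lambda> (mvar v)) - mvar v = - \<sigma>2 * ylin"
      by (simp add: \<Lambda>_mvar \<Gamma>_e1 \<Gamma>_mvar algebra_simps)
    then show ?thesis using Jl_simps(3)[OF ylin_Jl] by metis
  qed
  then have "f * (\<Gamma> (\<Lambda> (mvar v)) - mvar v) + \<Gamma> (\<Lambda> (mvar v)) * (\<Gamma> (\<Lambda> f) - f) \<in> Jl"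
    by (intro Jl_simps(1) Jl_simps(3)) (use mvar in auto)
  then show ?case by (simp add: algebra_simps)
qed (auto simp: Jl_simps)

lemma homogeneous_\<sigma>2_mult: "whomogeneous w d f \<Longrightarrow> whomogeneous w d (\<sigma>2 * f)"
  unfolding \<sigma>2_def by (rule whomogeneous_mconst_mult)

lemma hpart_\<Lambda>: "hpart (\<lambda>_. 1) d (\<Lambda> f) = \<Lambda> (hpart (\<lambda>_. 1) d f)"
  unfolding \<Lambda>_def
  by (rule hpart_msubst)
    (auto intro!: homogeneous_e1 whomogeneous_diff whomogeneous_mvar homogeneous_\<sigma>2_mult)

lemma hpart_\<Gamma>: "hpart (\<lambda>_. 1) d (\<Gamma> f) = \<Gamma> (hpart (\<lambda>_. 1) d f)"
  unfolding \<Gamma>_def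
  by (rule hpart_msubst)
    (auto intro!: homogeneous_z whomogeneous_add whomogeneous_mvar homogeneous_\<sigma>2_mult)

lemma hpart_\<Theta>: "hpart (\<lambda>_. 1) d (\<Theta> f) = \<Theta> (hpart (\<lambda>_. 1) d f)"
  unfolding \<Theta>_def
  by (rule hpart_msubst) (auto intro!: homogeneous_z homogeneous_Y)

lemma homogeneous_\<Lambda>: "whomogeneous (\<lambda>_. 1) d f \<Longrightarrow> whomogeneous (\<lambda>_. 1) d (\<Lambda> f)"
  and homogeneous_\<Gamma>: "whomogeneous (\<lambda>_. 1) d f \<Longrightarrow> whomogeneous (\<lambda>_. 1) d (\<Gamma> f)"
  by (metis hpart_homogeneous hpart_\<Lambda> whomogeneous_hpart, metis hpart_homogeneous hpart_\<Gamma> whomogeneous_hpart)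

lemma perm_act_e1:
  assumes "\<sigma> \<in> G" shows "perm_act \<sigma> (e1 n :: (nat, 'k) mpoly) = e1 n"
  using perm_act_Y[OF G_inj[OF assms], of "{1..n}"] permutes_image[OF G_permutes[OF assms]]
  by (simp add: Y_def e1_def)

lemma perm_act_\<Lambda>: "\<sigma> \<in> G \<Longrightarrow> perm_act \<sigma> (\<Lambda> f) = \<Lambda> (perm_act \<sigma> f)"
proof -
  assume \<sigma>: "\<sigma> \<in> G"
  have 0: "\<sigma> v = 0 \<longleftrightarrow> v = 0" for v
    using G_0[OF \<sigma>] G_inj[OF \<sigma>, of UNIV] by (metis UNIV_I inj_onD)
  have "f \<in> polys UNIV" by simp
  then show ?thesis
    by (induction rule: mpoly_induct)
      (auto simp: \<Lambda>_mvar 0 perm_act_e1[OF \<sigma>] \<sigma>2_def)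
qed

lemma \<Lambda>_avg: "\<Lambda> (avg f) = avg (\<Lambda> f)"
  by (simp add: avg_def \<Lambda>.hom_sum perm_act_\<Lambda>)

lemma perm_act_I: "\<sigma> \<in> G \<Longrightarrow> f \<in> I \<Longrightarrow> perm_act \<sigma> f \<in> I"
  unfolding I_def
proof (rule ideal_gen_hom[OF perm_act.ring_hom1_axioms])
  fix f assume \<sigma>: "\<sigma> \<in> G" and "f \<in> normal_quadric n s t ` {1..n}"
  then obtain i where i: "i \<in> {1..n}" "f = normal_quadric n s t i" by blast
  have "\<sigma> i \<in> {1..n}" using permutes_in_image[OF G_permutes[OF \<sigma>]] i(1) by blast
  moreover have "perm_act \<sigma> f = normal_quadric n s t (\<sigma> i)"
    by (simp add: i(2) normal_quadric_def perm_act_e1[OF \<sigma>])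
  ultimately show "perm_act \<sigma> f \<in> ideal_gen (normal_quadric n s t ` {1..n})"
    by (auto intro: idl.span_base)
qed

lemma avg_I: "f \<in> I \<Longrightarrow> avg f \<in> I"
  unfolding avg_def using subspace_I perm_act_I
  by (intro idl.subspace_scale idl.subspace_sum) auto

abbreviation H :: "(nat, 'k) mpoly set" where "H \<equiv> R_inv n G"

lemma H_iff: "f \<in> H \<longleftrightarrow> f \<in> polys {1..n} \<and> (\<forall>\<sigma>\<in>G. perm_act \<sigma> f = f)"
  by (simp add: R_inv_def)

lemma closed_H: "closed_polys {1..n} H"
  by unfold_locales (auto simp: H_iff polys_add polys_mult hpart_polys simp flip: hpart_perm_act)

lemma closed_quotient_I:
  assumes "closed_polys {1..n} H'" shows "closed_quotient {1..n} H' (I \<inter> H')"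
  unfolding I_def
proof (rule closed_quotient_ideal_gen[OF assms])
  fix f assume "f \<in> normal_quadric n s t ` {1..n}"
  moreover have "whomogeneous (\<lambda>_. 1) 2 (normal_quadric n s t i)" for i
  proof -
    have "whomogeneous (\<lambda>_. 1) (1 + 1) (e1 n * mvar i :: (nat, 'k) mpoly)"
      by (intro whomogeneous_mult homogeneous_e1 whomogeneous_mvar) simp
    then show ?thesis unfolding normal_quadric_def
      by (intro whomogeneous_diff whomogeneous_mconst_mult homogeneous_square whomogeneous_mvar
          homogeneous_e1) auto
  qed
  ultimately show "\<exists>d. whomogeneous (\<lambda>_. 1) d f" by blast
qed

lemma avg_H: "f \<in> polys {1..n} \<Longrightarrow> avg f \<in> H"
  by (simp add: H_iff avg_polys perm_act_avg)

lemma H_avg: "f \<in> H \<Longrightarrow> avg f = f"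
  by (simp add: H_iff avg_invariant)

lemma \<Theta>_\<Lambda>_H: "g \<in> polys {0..r} \<Longrightarrow> \<Lambda> (\<Theta> g) \<in> H"
  by (simp add: H_iff \<Lambda>_polys \<Theta>_polys perm_act_\<Lambda> \<Theta>_invariant)

lemma invariants_onto:
  assumes f: "f \<in> H" shows "\<exists>g\<in>polys {0..r}. f - \<Lambda> (\<Theta> g) \<in> I"
proof -
  have fp: "f \<in> polys {1..n}" using f by (simp add: H_iff)
  obtain g where g: "g \<in> polys {0..r}" "avg (\<Gamma> f) - \<Theta> g \<in> J"
    using avg_in_range[OF \<Gamma>_polys[OF fp]] by blast
  then have "\<Lambda> (avg (\<Gamma> f) - \<Theta> g) \<in> I" using \<Lambda>_Jl J_subset_Jl by blast
  then show ?thesis using g(1) H_avg[OF f] by (auto simp: \<Lambda>_avg \<Lambda>_\<Gamma>[OF fp])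
qed

lemma kernel_iff:
  assumes g: "g \<in> polys {0..r}"
  shows "\<Lambda> (\<Theta> g) \<in> I \<longleftrightarrow> g \<in> ideal_gen (set relations)"
proof
  assume "\<Lambda> (\<Theta> g) \<in> I"
  then have "\<Gamma> (\<Lambda> (\<Theta> g)) \<in> Jl" by (rule \<Gamma>_I)
  from Jl_simps(2)[OF this \<Gamma>_\<Lambda>[OF \<Theta>_polys[OF g]]]
  have "\<Theta> g \<in> Jl" by simp
  then show "g \<in> ideal_gen (set relations)" by (rule kernel_relations[OF g])
qed (intro \<Lambda>_Jl \<Theta>_relations)

subsection \<open>The image of \<open>\<phi>\<close>\<close>

definition \<Phi> :: "(nat, 'k) mpoly \<Rightarrow> (nat, 'k) mpoly" where
  "\<Phi> = msubst (\<lambda>k. \<Sum>x\<in>Blk k. mvar x)"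

sublocale \<Phi>: ring_hom1 \<Phi> unfolding \<Phi>_def by (rule msubst.ring_hom1_axioms)

lemma \<Phi>_H:
  assumes "g \<in> polys {1..r}" shows "\<Phi> g \<in> H"
proof -
  have "\<Phi> g = \<Theta> g" unfolding \<Phi>_def \<Theta>_def
    by (rule msubst_cong[OF assms]) (auto simp: Y_def)
  moreover have "g \<in> polys {0..r}" using assms polys_mono[of "{1..r}" "{0..r}"] by auto
  moreover have "\<Phi> g \<in> polys {1..n}" unfolding \<Phi>_def
    by (rule msubst_polys[OF assms]) (use Blk_subset in \<open>auto intro!: polys_intros\<close>)
  ultimately show ?thesis by (simp add: H_iff \<Theta>_invariant)
qed

lemma \<Phi>_image:
  assumes "g \<in> polys {0..r}" shows "\<exists>g'\<in>polys {1..r}. \<Lambda> (\<Theta> g) = \<Phi> g'"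
  using assms
proof (induction rule: mpoly_induct)
  case (const c)
  show ?case by (intro bexI[of _ "mconst c"]) (simp_all add: \<Phi>_def)
next
  case (add f g)
  then show ?case by (metis \<Lambda>.hom_add \<Theta>.hom_add \<Phi>.hom_add polys_add)
next
  case (mvar v f)
  let ?e = "\<Sum>k\<in>{1..r}. mvar k :: (nat, 'k) mpoly"
  have e: "\<Phi> ?e = e1 n" "?e \<in> polys {1..r}"
    using sum_Blk[of "mvar :: nat \<Rightarrow> (nat, 'k) mpoly"]
    by (auto simp: \<Phi>_def msubst.hom_sum e1_def intro!: polys_intros)
  have "\<exists>g'\<in>polys {1..r}. \<Lambda> (\<Theta> (mvar v)) = \<Phi> g'"
  proof (cases "v = 0")
    case True
    then show ?thesis using e by (intro bexI[of _ ?e]) (auto simp: \<Theta>_mvar)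
  next
    case False
    then have v: "v \<in> {1..r}" using mvar(1) by simp
    have "i \<noteq> 0" if "i \<in> Blk v" for i using Blk_subset[OF v] that by auto
    then have "\<Lambda> (Y (Blk v)) = (\<Sum>i\<in>Blk v. mvar i - \<sigma>2 * e1 n)"
      unfolding Y_def \<Lambda>.hom_sum by (intro sum.cong) (auto simp: \<Lambda>_mvar)
    then have "\<Lambda> (\<Theta> (mvar v)) = \<Phi> (mvar v - of_nat (card (Blk v)) * (\<sigma>2 * ?e))"
      using False by (simp add: \<Theta>_mvar sum_subtractf e) (simp add: \<Phi>_def \<sigma>2_def)
    moreover have "mvar v - of_nat (card (Blk v)) * (\<sigma>2 * ?e) \<in> polys {1..r}"
      unfolding \<sigma>2_def using v e(2) by (intro polys_diff polys_mult polys_mvar polys_mconst polys_of_nat)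
    ultimately show ?thesis by blast
  qed
  then obtain a b where "a \<in> polys {1..r}" "\<Lambda> (\<Theta> (mvar v)) = \<Phi> a" "b \<in> polys {1..r}" "\<Lambda> (\<Theta> f) = \<Phi> b"
    using mvar by blast
  then show ?case by (intro bexI[of _ "a * b"]) (auto simp: polys_mult)
qed

lemma \<Phi>_onto: "f \<in> H \<Longrightarrow> \<exists>g\<in>polys {1..r}. f - \<Phi> g \<in> I"
  using invariants_onto \<Phi>_image by metis

sublocale A: closed_quotient "{1..n}" "polys {1..n}" "I \<inter> polys {1..n}"
  by (rule closed_quotient_I[OF closed_polys_polys])

abbreviation cosA :: "(nat, 'k) mpoly \<Rightarrow> (nat, 'k) mpoly set" where
  "cosA \<equiv> coset (I \<inter> polys {1..n})"

lemma A_image: "graded_image {1..n} (polys {1..n}) (A_alg n p) cosA"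
  using A.quot_image unfolding A_alg_def I_ideal_eq_I sub_alg_polys .

lemma perm_act_coset:
  assumes "\<sigma> \<in> G" shows "perm_act \<sigma> ` cosA f = cosA (perm_act \<sigma> f)"
proof -
  have img: "\<sigma> ` {1..n} \<subseteq> {1..n}" if "\<sigma> \<in> G" for \<sigma>
    using permutes_image[OF G_permutes[OF that]] by simp
  have mem: "perm_act \<sigma> j \<in> I \<inter> polys {1..n}" if "j \<in> I \<inter> polys {1..n}" "\<sigma> \<in> G" for j \<sigma>
    using that perm_act_I perm_act_polys[OF _ img] by auto
  have inv: "perm_act \<sigma> (perm_act (inv_into UNIV \<sigma>) j) = j" for j :: "(nat, 'k) mpoly"
    by (simp add: perm_act_comp permutes_inv_o[OF G_permutes[OF assms]])
  have "perm_act \<sigma> ` (I \<inter> polys {1..n}) = I \<inter> polys {1..n}"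
  proof (intro equalityI subsetI)
    fix j assume "j \<in> I \<inter> polys {1..n}"
    then have "perm_act (inv_into UNIV \<sigma>) j \<in> I \<inter> polys {1..n}" by (rule mem[OF _ inv_G[OF assms]])
    then show "j \<in> perm_act \<sigma> ` (I \<inter> polys {1..n})" by (rule image_eqI[where f = "perm_act \<sigma>", OF inv[of j, symmetric]])
  qed (use mem assms in blast)
  then have "(\<lambda>j. j + perm_act \<sigma> f) ` (perm_act \<sigma> ` (I \<inter> polys {1..n})) = (\<lambda>j. j + perm_act \<sigma> f) ` (I \<inter> polys {1..n})"
    by (rule arg_cong)
  then show ?thesis unfolding coset_def image_image by simp
qed

lemma A_inv_eq: "A_inv n p G = cosA ` H"
proof (intro equalityI subsetI)
  interpret A': graded_image "{1..n}" "polys {1..n}" "A_alg n p" cosA by (rule A_image)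
  fix a
  show "a \<in> A_inv n p G" if "a \<in> cosA ` H"
  proof -
    from that obtain f where f: "f \<in> H" "a = cosA f" by blast
    have "perm_act \<sigma> ` a = a" if "\<sigma> \<in> G" for \<sigma>
      unfolding f(2) perm_act_coset[OF that] using f(1) that by (simp add: H_iff)
    then show ?thesis using f by (simp add: A_inv_def A'.\<pi>_closed H_iff)
  qed
  assume a: "a \<in> A_inv n p G"
  then obtain f where f: "f \<in> polys {1..n}" "a = cosA f" by (auto simp: A_inv_def A'.\<pi>_carrier)
  have "perm_act \<sigma> f - f \<in> I" if "\<sigma> \<in> G" for \<sigma>
  proof -
    have "cosA (perm_act \<sigma> f) = cosA f"
      using a that f perm_act_coset[OF that, of f] by (auto simp: A_inv_def)
    then show ?thesis by (simp add: A.coset_eq_iff)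
  qed
  then have "mconst (1 / of_nat (card G)) * (\<Sum>\<sigma>\<in>G. perm_act \<sigma> f - f) \<in> I"
    by (intro idl.subspace_scale[OF subspace_I] idl.subspace_sum[OF subspace_I])
  moreover have "mconst (1 / of_nat (card G)) * (\<Sum>\<sigma>\<in>G. perm_act \<sigma> f - f) =
      avg f - mconst (1 / of_nat (card G)) * mconst (of_nat (card G)) * f"
    by (simp add: avg_def sum_subtractf right_diff_distrib mult.assoc)
  ultimately have "avg f - f \<in> I" by (simp only: mconst_inverse_mult[OF card_G] mult_1_left)
  then have "cosA (avg f) = a" unfolding f(2) A.coset_eq_iff
    using f(1) avg_H[OF f(1)] by (auto simp: H_iff intro: polys_diff)
  then show "a \<in> cosA ` H" using avg_H[OF f(1)] by blast
qed

lemma AG_image: "graded_image {1..n} H (AG_alg n p G) cosA"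
proof -
  interpret A': graded_image "{1..n}" "polys {1..n}" "A_alg n p" cosA by (rule A_image)
  interpret closed_polys "{1..n}" H by (rule closed_H)
  have "cosA ` (polys {1..n} \<inter> homs {1..n} d) \<inter> cosA ` H = cosA ` (H \<inter> homs {1..n} d)" for d
  proof (intro equalityI subsetI)
    fix a assume "a \<in> cosA ` (polys {1..n} \<inter> homs {1..n} d) \<inter> cosA ` H"
    then obtain f g where f: "f \<in> homs {1..n} d" "a = cosA f" "g \<in> H" "a = cosA g" by blast
    have fp: "f \<in> polys {1..n}" using f(1) by (simp add: homs_def)
    have "cosA f = cosA g" using f(2,4) by (rule trans[OF sym])
    then have "f - g \<in> I" unfolding A.coset_eq_iff by blast
    then have "avg (f - g) \<in> I" by (rule avg_I)
    then have "avg f - g \<in> I" using f(3) by (simp add: avg_diff H_avg)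
    then have "cosA (avg f) = a" unfolding f(4) A.coset_eq_iff
      using avg_H[OF fp] f(3) by (auto simp: H_iff intro: polys_diff)
    moreover have "avg f \<in> homs {1..n} d"
    proof -
      have "hpart (\<lambda>_. 1) d f = f" using f(1) hpart_homogeneous[of "\<lambda>_. 1" d f d] by (simp add: homs_def)
      then have "whomogeneous (\<lambda>_. 1) d (avg f)" using whomogeneous_hpart[of "\<lambda>_. 1" d "avg f"] by (simp add: hpart_avg)
      moreover have "avg f \<in> polys {1..n}" using avg_H[OF fp] by (simp add: H_iff)
      ultimately show ?thesis by (simp add: homs_def)
    qed
    ultimately show "a \<in> cosA ` (H \<inter> homs {1..n} d)" using avg_H[OF fp] by blast
  qed (auto simp: homs_def)
  then show ?thesis
    using H_sub
    by unfold_locales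
      (auto simp: AG_alg_def sub_alg_def A_inv_eq A'.\<pi>_add A'.\<pi>_mult A'.\<pi>_zero A'.\<pi>_one A'.\<pi>_emb
        A'.\<pi>_hcomp A'.\<pi>_hpart subset_iff)
qed

lemma phi_eq: "phi n p Blk g = cosA (\<Phi> g)"
  by (simp add: phi_def a_r_coset_mpoly_alg I_ideal_eq_I \<Phi>_def)

lemma cosA_\<Phi>_onto:
  assumes "f \<in> H" shows "\<exists>g\<in>polys {1..r}. cosA f = cosA (\<Phi> g)"
proof -
  obtain g where g: "g \<in> polys {1..r}" "f - \<Phi> g \<in> I" using \<Phi>_onto[OF assms] by blast
  then have "f - \<Phi> g \<in> I \<inter> polys {1..n}"
    using assms \<Phi>_H[OF g(1)] by (auto simp: H_iff intro: polys_diff)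
  then show ?thesis using g(1) A.coset_eq_iff by blast
qed

theorem phi_image: "phi n p Blk ` carrier (R_alg r) = carrier (AG_alg n p G)"
proof -
  interpret AG: graded_image "{1..n}" H "AG_alg n p G" cosA by (rule AG_image)
  have "cosA f \<in> (\<lambda>g. cosA (\<Phi> g)) ` polys {1..r}" if "f \<in> H" for f
    using cosA_\<Phi>_onto[OF that] by blast
  then show ?thesis unfolding AG.\<pi>_carrier using \<Phi>_H by (auto simp: phi_eq)
qed

theorem standard_graded_AG: "standard_graded (AG_alg n p G)"
  unfolding standard_graded_def
proof
  let ?B = "AG_alg n p G"
  interpret AG: graded_image "{1..n}" H ?B cosA by (rule AG_image)
  show "graded_algebra ?B" by (rule AG.graded)
  let ?S = "hcomp ?B 0 \<union> hcomp ?B 1"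
  have "?S \<subseteq> carrier ?B" by (auto simp: AG.\<pi>_hcomp AG.\<pi>_carrier)
  then have 1: "generate_ring ?B ?S \<subseteq> carrier ?B" by (rule AG.B.generate_ring_incl)
  have gen: "cosA (\<Phi> g) \<in> generate_ring ?B ?S" if "g \<in> polys {1..r}" for g
    using that
  proof (induction rule: mpoly_induct)
    case (const c)
    have "mconst c \<in> H \<inter> homs {1..n} 0" by (simp add: AG.H_const homs_def)
    then have "cosA (\<Phi> (mconst c)) \<in> ?S" by (auto simp: AG.\<pi>_hcomp \<Phi>_def)
    then show ?case by (rule generate_ring.incl)
  next
    case (add f g)
    then show ?case using generate_ring.eng_add[OF add(3,4)] by (simp add: AG.\<pi>_add \<Phi>_H)
  next
    case (mvar v f)
    have v: "mvar v \<in> polys {1..r}" using mvar(1) by (rule polys_mvar)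
    have "whomogeneous (\<lambda>_. 1) 1 (\<Phi> (mvar v))"
      unfolding \<Phi>_def by (simp add: whomogeneous_sum whomogeneous_mvar)
    then have "\<Phi> (mvar v) \<in> H \<inter> homs {1..n} 1" using \<Phi>_H[OF v] by (auto simp: homs_def H_iff)
    then have "cosA (\<Phi> (mvar v)) \<in> ?S" by (auto simp: AG.\<pi>_hcomp)
    then have "cosA (\<Phi> (mvar v)) \<in> generate_ring ?B ?S" by (rule generate_ring.incl)
    from generate_ring.eng_mult[OF this mvar(3)]
    show ?case using \<Phi>_H[OF v] \<Phi>_H[OF mvar(2)] by (simp add: AG.\<pi>_mult)
  qed
  have "carrier ?B \<subseteq> generate_ring ?B ?S"
    unfolding AG.\<pi>_carrier using gen cosA_\<Phi>_onto by (metis image_subsetI)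
  with 1 show "generate_ring ?B ?S = carrier ?B" by (rule equalityI)
qed

end

section \<open>Invariants of the complete intersection\<close>

lemma e1_power_homs: "(e1 n :: (nat, 'a::field) mpoly) ^ k \<in> homs {1..n} k"
  using whomogeneous_power[OF homogeneous_e1[of n, where ?'a = 'a], of k]
  by (simp add: homs_def polys_power e1_polys)

context quad_algebra
begin

context
  assumes reg: "regular_sequence (R_alg n) (quadrics n p)"
begin

lemma quadrics_homogeneous: "f \<in> set (quadrics n p) \<Longrightarrow> whomogeneous (\<lambda>_. 1) 2 f"
  by (auto simp: set_quadrics quadric_nform homogeneous_nform)

lemma quadrics_length: "length (quadrics n p) = card {1..n}"
  by (simp add: quadrics_def)

lemma high_degree_I: "n < d \<Longrightarrow> f \<in> homs {1..n} d \<Longrightarrow> f \<in> I"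
  using homs_subset_ideal[OF _ reg quadrics_homogeneous quadrics_length, of d]
  by (auto simp: ideal_eq I_def)

lemma one_notin_I: "1 \<notin> I"
proof
  assume "1 \<in> I"
  then have "x \<in> I" for x using idl.subspace_scale[OF subspace_I, of 1 x] by simp
  then have "I_ideal n p = carrier (R_alg n)" unfolding I_ideal_eq_I by auto
  then show False using reg by (simp add: regular_sequence_def I_ideal_def)
qed

text \<open>
  If the value vanished, a vector of signs would give a common zero of the quadrics over the
  algebraic closure at which \<open>e\<^sub>1\<close> does not vanish, although \<open>e\<^sub>1\<close> is nilpotent modulo \<open>I\<close>.
\<close>
lemma Hs_nonzero:
  assumes i: "2 * i \<le> n"
  shows "Hs \<tau> \<kappa> (n - 2 * i) (Suc (n - 2 * i)) \<noteq> 0"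
proof
  define m where "m = n - 2 * i"
  assume "Hs \<tau> \<kappa> (n - 2 * i) (Suc (n - 2 * i)) = 0"
  then have 0: "Hs \<tau> \<kappa> m (Suc m) = 0" by (simp only: m_def)
  interpret ac: ring_hom1 "to_ac :: 'k \<Rightarrow> 'k alg_closure" by unfold_locales auto
  obtain \<rho> where \<rho>: "\<rho> ^ 2 = to_ac \<tau>" using nth_root_exists[of 2 "to_ac \<tau>"] by auto
  have "Hs (\<rho> ^ 2) (to_ac \<kappa>) m (Suc m) = 0"
    using arg_cong[OF 0, of to_ac] unfolding ac.hom_Hs \<rho> by (simp only: to_ac_0)
  then obtain j where j: "j \<le> m" "to_ac \<kappa> = (of_nat (m - j) - of_nat j) * \<rho>"
    using Hs_eq_0_imp by blast
  define y where "y k = (if k \<le> i + j then - \<rho> else \<rho>)" for k :: nat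
  define ev where "ev = meval to_ac (\<lambda>v. if v = 0 then 1 else y v)"
  interpret ev: ring_hom1 ev unfolding ev_def by (rule meval_ring_hom1[OF ac.ring_hom1_axioms])
  have ev_simps: "ev (mconst c) = to_ac c" "ev (mvar v) = (if v = 0 then 1 else y v)" for c v
    unfolding ev_def by (simp_all add: meval_mconst[OF ac.ring_hom1_axioms] meval_mvar[OF ac.ring_hom1_axioms])
  have ev_z: "ev z = 1" by (simp add: z_def ev_simps)
  have "sum y ({1..i + j} \<union> {i + j + 1..n}) = sum y {1..i + j} + sum y {i + j + 1..n}"
    by (rule sum.union_disjoint) auto
  moreover have "{1..i + j} \<union> {i + j + 1..n} = {1..n}" using i j by (auto simp: m_def)
  moreover have "sum y {1..i + j} = of_nat (i + j) * - \<rho>" by (simp add: y_def)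
  moreover have "sum y {i + j + 1..n} = (\<Sum>k\<in>{i + j + 1..n}. \<rho>)" by (intro sum.cong) (auto simp: y_def)
  then have "sum y {i + j + 1..n} = of_nat (n - (i + j)) * \<rho>" by simp
  moreover have "n - (i + j) = (m - j) + i" using i j by (simp add: m_def)
  ultimately have "sum y {1..n} = to_ac \<kappa>" unfolding j(2) by (simp add: algebra_simps)
  moreover have "ev (Y {1..n}) = sum y {1..n}"
    unfolding Y_def ev.hom_sum by (intro sum.cong) (auto simp: ev_simps)
  ultimately have ev_ylin: "ev ylin = 0" unfolding ylin_def by (simp only: ev.hom_diff ev.hom_mult ev_z ev_simps) simp
  have ev_q: "ev q = \<rho> ^ 2" unfolding q_def \<rho> by (simp only: ev.hom_mult ev.hom_power ev_z ev_simps) simp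
  have "ev f \<in> ideal_gen {0}" if "f \<in> Jl" for f
    using that unfolding Jl_def
  proof (rule ideal_gen_hom[OF ev.ring_hom1_axioms, rotated])
    fix f assume "f \<in> insert ylin (squares q {1..n})"
    then show "ev f \<in> ideal_gen {0}"
      using ev_ylin by (auto simp: ev_q ev_simps y_def idl.span_zero)
  qed
  then have ev_Jl: "ev f = 0" if "f \<in> Jl" for f using that by (auto simp: idl.span_singleton)
  have "e1 n ^ Suc n \<in> I" by (rule high_degree_I[OF _ e1_power_homs]) simp
  then have "ev (\<Gamma> (e1 n ^ Suc n)) = 0" by (intro ev_Jl \<Gamma>_I)
  then show False by (simp add: \<Gamma>_e1 ev_ylin ev_z)
qed

lemma lefschetz_surj:
  assumes i: "2 * i \<le> n" and g: "g \<in> homs {1..n} (n - i)"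
  shows "\<exists>f\<in>homs {1..n} i. g - e1 n ^ (n - 2 * i) * f \<in> I"
proof -
  have gp: "g \<in> polys {1..n}" "whomogeneous (\<lambda>_. 1) (n - i) (\<Gamma> g)"
    using g homogeneous_\<Gamma> by (auto simp: homs_def)
  have "\<exists>h\<in>polys {0..n}. whomogeneous (\<lambda>_. 1) (n - (n - i)) h \<and> \<Gamma> g - z ^ (2 * (n - i) - n) * h \<in> Jl"
    by (rule lefschetz_surjective[OF Hs_nonzero \<Gamma>_polys[OF gp(1)] gp(2)]) (use i in auto)
  moreover have "n - (n - i) = i" "2 * (n - i) - n = n - 2 * i" using i by auto
  ultimately obtain h where h: "h \<in> polys {0..n}" "whomogeneous (\<lambda>_. 1) i h"
    "\<Gamma> g - z ^ (n - 2 * i) * h \<in> Jl" by auto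
  have "\<Lambda> (\<Gamma> g - z ^ (n - 2 * i) * h) \<in> I" using h(3) by (rule \<Lambda>_Jl)
  then show ?thesis using h \<Lambda>_polys homogeneous_\<Lambda>
    by (intro bexI[of _ "\<Lambda> h"]) (auto simp: \<Lambda>_\<Gamma>[OF gp(1)] homs_def)
qed

lemma lefschetz_inj:
  assumes i: "2 * i \<le> n" and f: "f \<in> homs {1..n} i" "e1 n ^ (n - 2 * i) * f \<in> I"
  shows "f \<in> I"
  using lefschetz_injective[OF _ reg quadrics_homogeneous quadrics_length, of i "e1 n ^ (n - 2 * i)" f]
    i f lefschetz_surj[OF i]
  by (simp add: ideal_eq e1_power_homs flip: I_def)

abbreviation cosH :: "(nat, 'k) mpoly \<Rightarrow> (nat, 'k) mpoly set" where
  "cosH \<equiv> coset (I \<inter> H)"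

lemma RG_image: "graded_image {1..n} H (RG_quot n p G) cosH"
proof -
  interpret Q: closed_quotient "{1..n}" H "I \<inter> H" by (rule closed_quotient_I[OF closed_H])
  have "I_ideal n p \<inter> H = I \<inter> H" by (auto simp: I_ideal_eq_I H_iff)
  then show ?thesis using Q.quot_image by (simp add: RG_quot_def)
qed

lemma cosH_eq_iff:
  assumes "f \<in> H" "g \<in> H" shows "cosH f = cosH g \<longleftrightarrow> f - g \<in> I"
proof -
  interpret Q: closed_quotient "{1..n}" H "I \<inter> H" by (rule closed_quotient_I[OF closed_H])
  show ?thesis using Q.coset_eq_iff Q.H_diff[OF assms] by blast
qed

lemma zero_H: "0 \<in> H" and one_H: "1 \<in> H" and e1_H: "e1 n \<in> H"
  by (simp_all add: H_iff e1_polys perm_act_e1)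

lemma cosH_eq_0_iff: "f \<in> H \<Longrightarrow> cosH f = cosH 0 \<longleftrightarrow> f \<in> I"
  using cosH_eq_iff[OF _ zero_H] by simp

theorem complete_intersection_RG: "complete_intersection (RG_quot n p G)"
proof -
  interpret B: graded_image "{1..n}" H "RG_quot n p G" cosH by (rule RG_image)
  have V: "{..<r + 1} = {0..r}" by auto
  show ?thesis
  proof (rule B.complete_intersectionI[of "r + 1" relations "\<lambda>g. \<Lambda> (\<Theta> g)"])
    have "Hs \<tau> \<kappa> n (Suc n) \<noteq> 0" using Hs_nonzero[of 0] by simp
    then show "regular_sequence (mpoly_alg (\<lambda>_. 1) {..<r + 1}) relations" by (rule regular_relations)
    show "\<exists>d. whomogeneous (\<lambda>_. 1) d g" if "g \<in> set relations" for g
      using that by (rule homogeneous_relations)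
    show "ring_hom1 (\<lambda>g. \<Lambda> (\<Theta> g))" by (rule ring_hom1_comp[OF \<Lambda>.ring_hom1_axioms \<Theta>.ring_hom1_axioms])
    show "\<exists>g\<in>polys {..<r + 1}. cosH f = cosH (\<Lambda> (\<Theta> g))" if f: "f \<in> H" for f
    proof -
      obtain g where g: "g \<in> polys {0..r}" "f - \<Lambda> (\<Theta> g) \<in> I" using invariants_onto[OF f] by blast
      then have "cosH f = cosH (\<Lambda> (\<Theta> g))" using cosH_eq_iff[OF f \<Theta>_\<Lambda>_H[OF g(1)]] by blast
      then show ?thesis unfolding V using g(1) by blast
    qed
    show "cosH (\<Lambda> (\<Theta> g)) = cosH 0 \<longleftrightarrow> g \<in> ideal_gen (set relations)" if "g \<in> polys {..<r + 1}" for g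
      using that unfolding V by (simp add: cosH_eq_0_iff \<Theta>_\<Lambda>_H kernel_iff)
    show "\<Lambda> (\<Theta> f) \<in> H" if "f \<in> polys {..<r + 1}" for f
      using that unfolding V by (rule \<Theta>_\<Lambda>_H)
  qed (simp_all add: hpart_\<Lambda> hpart_\<Theta>)
qed

lemma avg_span: "f \<in> kv.span F \<Longrightarrow> avg f \<in> kv.span (avg ` F)"
proof (induction rule: kv.span_induct_alt)
  case (step c x y)
  have "avg (mconst c * x) = mconst c * avg x" by (rule avg_mult) simp
  moreover have "mconst c * avg x + avg y \<in> kv.span (avg ` F)"
    by (rule kv.span_add[OF kv.span_scale[OF kv.span_base]]) (use step in auto)
  ultimately show ?case by (simp only: avg_add)
qed (simp add: kv.span_zero)

lemma invariants_finite_span: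
  "\<exists>F. finite F \<and> F \<subseteq> H \<and> (\<forall>f\<in>H. \<exists>g\<in>kv.span F. cosH f = cosH g)"
proof -
  have "\<exists>F. finite F \<and> F \<subseteq> homs {1..n} d \<and> (homs {1..n} d :: (nat, 'k) mpoly set) \<subseteq> kv.span F" for d
    by (rule finite_homs_span) simp
  then obtain F :: "nat \<Rightarrow> (nat, 'k) mpoly set" where
    F: "\<And>d. finite (F d)" "\<And>d. F d \<subseteq> homs {1..n} d" "\<And>d. homs {1..n} d \<subseteq> kv.span (F d)" by metis
  define FF where "FF = (\<Union>d\<in>{..n}. avg ` F d)"
  have FH: "FF \<subseteq> H" using F(2) by (auto simp: FF_def homs_def intro!: avg_H)
  have "\<exists>g\<in>kv.span FF. cosH f = cosH g" if f: "f \<in> H" for f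
  proof -
    let ?h = "\<lambda>d. hpart (\<lambda>_. 1) d f"
    let ?D = "{..n} \<union> wdeg (\<lambda>_. 1) ` Poly_Mapping.keys f"
    have h: "?h d \<in> homs {1..n} d" for d using f by (simp add: homs_def H_iff hpart_polys)
    have hH: "?h d \<in> H" for d using f closed_polys.H_hpart[OF closed_H] by blast
    have "?h d \<in> kv.span FF" if "d \<le> n" for d
    proof -
      have "avg (?h d) \<in> kv.span (avg ` F d)" using F(3) h by (intro avg_span) blast
      moreover have "kv.span (avg ` F d) \<subseteq> kv.span FF"
        using that by (intro kv.span_mono) (auto simp: FF_def)
      ultimately show ?thesis using H_avg[OF hH] by auto
    qed
    then have span: "(\<Sum>d\<in>{..n}. ?h d) \<in> kv.span FF" by (intro kv.span_sum) auto
    have "f = (\<Sum>d\<in>?D. ?h d)" by (rule sum_hpart[symmetric]) auto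
    also have "\<dots> = (\<Sum>d\<in>?D - {..n}. ?h d) + (\<Sum>d\<in>{..n}. ?h d)" by (rule sum.subset_diff) auto
    finally have "f - (\<Sum>d\<in>{..n}. ?h d) = (\<Sum>d\<in>?D - {..n}. ?h d)" by (simp add: algebra_simps)
    also have "\<dots> \<in> I"
    proof (rule idl.subspace_sum[OF subspace_I])
      fix d assume "d \<in> ?D - {..n}"
      then have "n < d" by auto
      then show "?h d \<in> I" using h by (rule high_degree_I)
    qed
    finally have "f - (\<Sum>d\<in>{..n}. ?h d) \<in> I" .
    moreover have "(\<Sum>d\<in>{..n}. ?h d) \<in> H"
      using hH by (intro closed_polys.H_sum[OF closed_H])
    ultimately show ?thesis using span cosH_eq_iff[OF f] by blast
  qed
  moreover have "finite FF" using F(1) by (simp add: FF_def)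
  ultimately show ?thesis using FH by blast
qed

theorem strong_lefschetz_RG: "strong_lefschetz_property (RG_quot n p G)"
proof -
  interpret B: graded_image "{1..n}" H "RG_quot n p G" cosH by (rule RG_image)
  obtain F where F: "finite F" "F \<subseteq> H" "\<And>f. f \<in> H \<Longrightarrow> \<exists>g\<in>kv.span F. cosH f = cosH g"
    using invariants_finite_span by blast
  have eH: "e1 n ^ k * f \<in> H" if "f \<in> H" for k f using that e1_H B.H_mult B.H_power by blast
  show ?thesis
  proof (rule B.strong_lefschetz[OF _ F, where e = "e1 n" and c = n])
    show "cosH 1 \<noteq> cosH 0" using one_notin_I cosH_eq_0_iff[OF one_H] by simp
    show "e1 n \<in> H \<inter> homs {1..n} 1" using e1_H homogeneous_e1 e1_polys by (auto simp: homs_def)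
    show "cosH f = cosH 0" if "n < d" "f \<in> H \<inter> homs {1..n} d" for d f
      using that high_degree_I cosH_eq_0_iff by blast
    show "cosH f = cosH 0" if "2 * i \<le> n" "f \<in> H \<inter> homs {1..n} i" "cosH (e1 n ^ (n - 2 * i) * f) = cosH 0" for i f
      using that lefschetz_inj[OF that(1), of f] cosH_eq_0_iff eH by blast
    fix i g assume i: "2 * i \<le> n" and g: "g \<in> H \<inter> homs {1..n} (n - i)"
    obtain f where f: "f \<in> homs {1..n} i" "g - e1 n ^ (n - 2 * i) * f \<in> I"
      using lefschetz_surj[OF i] g by blast
    have fp: "f \<in> polys {1..n}" using f(1) by (simp add: homs_def)
    have "avg (g - e1 n ^ (n - 2 * i) * f) = g - e1 n ^ (n - 2 * i) * avg f"
      using g by (simp add: avg_diff H_avg) (rule avg_mult, simp add: perm_act_e1)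
    then have "g - e1 n ^ (n - 2 * i) * avg f \<in> I" using avg_I[OF f(2)] by simp
    then have "cosH g = cosH (e1 n ^ (n - 2 * i) * avg f)"
      using cosH_eq_iff g eH[OF avg_H[OF fp]] by blast
    moreover have "hpart (\<lambda>_. 1) i f = f" using f(1) hpart_homogeneous[of "\<lambda>_. 1" i f i] by (simp add: homs_def)
    then have "whomogeneous (\<lambda>_. 1) i (avg f)"
      using whomogeneous_hpart[of "\<lambda>_. 1" i "avg f"] by (simp add: hpart_avg)
    then have "avg f \<in> H \<inter> homs {1..n} i" using avg_H[OF fp] by (simp add: homs_def H_iff)
    ultimately show "\<exists>f\<in>H \<inter> homs {1..n} i. cosH g = cosH (e1 n ^ (n - 2 * i) * f)" by blast
  qed
qed

end

end

lemma quad_algebraI: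
  fixes p :: "4 \<Rightarrow> 'k::field_char_0"
  assumes "var_partition n r Blk"
    and "\<exists>s t. ideal_gen (set (quadrics n p)) = ideal_gen (normal_quadric n s t ` {1..n})"
  shows "\<exists>s t. quad_algebra n r Blk s t p"
  using assms by (auto simp: quad_algebra_def quad_algebra_axioms_def deformed_def young_def)

section \<open>The generic locus\<close>

definition generic_locus_poly :: "nat \<Rightarrow> (4, 'k::field_char_0) mpoly" where
  "generic_locus_poly n = (mvar 0 - mvar 1 - mvar 2 + mvar 3) *
     (mconst 2 * (mvar 0 - mvar 1 - mvar 2 + mvar 3) + mconst (of_nat n) * (mconst 2 * mvar 2 - mvar 3))"

definition generic_locus :: "nat \<Rightarrow> (4 \<Rightarrow> 'k::field_char_0) set set" where
  "generic_locus n = proj_space - proj_zero_locus {generic_locus_poly n}"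

lemma meval_generic_locus_poly:
  "meval_at p (generic_locus_poly n) = (p 0 - p 1 - p 2 + p 3) *
     (2 * (p 0 - p 1 - p 2 + p 3) + of_nat n * (2 * p 2 - p 3))"
  unfolding generic_locus_poly_def
  by (simp only: meval_at.hom_mult meval_at.hom_add meval_at.hom_diff meval_at_mvar meval_at_mconst)

lemma zariski_open_generic_locus: "zariski_open (generic_locus n :: (4 \<Rightarrow> 'k::field_char_0) set set)"
proof -
  have "whomogeneous (\<lambda>_. 1) (1 + 1) (generic_locus_poly n :: (4, 'k) mpoly)"
    unfolding generic_locus_poly_def
    by (intro whomogeneous_mult whomogeneous_add whomogeneous_diff whomogeneous_mconst_mult whomogeneous_mvar refl)
  then show ?thesis unfolding zariski_open_def generic_locus_def by blast
qed

lemma proj_point_self: "p \<in> proj_point p"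
  unfolding proj_point_def by (intro CollectI exI[of _ 1]) auto

lemma generic_locus_nonempty: "generic_locus n \<noteq> ({} :: (4 \<Rightarrow> 'k::field_char_0) set set)"
proof -
  define p :: "4 \<Rightarrow> 'k" where "p i = (if i = 0 then 1 else 0)" for i
  have "p 0 \<noteq> 0" by (simp add: p_def)
  then have p: "p \<noteq> (\<lambda>_. 0)" by metis
  have "proj_point p \<notin> proj_zero_locus {generic_locus_poly n}"
  proof
    assume "proj_point p \<in> proj_zero_locus {generic_locus_poly n}"
    then obtain q where q: "proj_point p = proj_point q" "meval_at q (generic_locus_poly n) = 0"
      by (auto simp: proj_zero_locus_def)
    then obtain c where c: "p = (\<lambda>i. c * q i)" using proj_point_self[of p] by (auto simp: proj_point_def)
    have "meval_at p (generic_locus_poly n) = c ^ 2 * meval_at q (generic_locus_poly n)"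
      unfolding meval_generic_locus_poly c by (simp add: algebra_simps power2_eq_square)
    moreover have "meval_at p (generic_locus_poly n) = 2"
      unfolding meval_generic_locus_poly by (simp add: p_def)
    ultimately show False using q(2) by simp
  qed
  then show ?thesis using p unfolding generic_locus_def proj_space_def by blast
qed

lemma generic_locus_meval:
  assumes "proj_point p \<in> generic_locus n" shows "meval_at p (generic_locus_poly n) \<noteq> 0"
proof
  assume 0: "meval_at p (generic_locus_poly n) = 0"
  obtain p' where p': "p' \<noteq> (\<lambda>_. 0)" "proj_point p = proj_point p'"
    using assms by (auto simp: generic_locus_def proj_space_def)
  then obtain c where "p' = (\<lambda>i. c * p i)" using proj_point_self[of p'] by (auto simp: proj_point_def)
  then have "p \<noteq> (\<lambda>_. 0)" using p'(1) by auto
  then have "proj_point p \<in> proj_zero_locus {generic_locus_poly n}"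
    using 0 by (auto simp: proj_zero_locus_def)
  then show False using assms by (simp add: generic_locus_def)
qed

lemma generic_quad_algebra:
  assumes "var_partition n r Blk" "proj_point p \<in> generic_locus n"
  shows "\<exists>s t. quad_algebra n r Blk s t p"
  using generic_locus_meval[OF assms(2)] unfolding meval_generic_locus_poly
  by (intro quad_algebraI assms(1) generic_normal_quadrics) auto

theorem theorem11:
  fixes n r :: nat and Blk :: "nat \<Rightarrow> nat set"
  assumes "1 \<le> n" and "var_partition n r Blk"
  shows
    "(\<forall>p :: 4 \<Rightarrow> 'k::field_char_0.
        regular_sequence (R_alg n) (quadrics n p) \<and> e1 n ^ 2 \<notin> I_ideal n p \<longrightarrow>
          complete_intersection (RG_quot n p (young_subgroup n r Blk)) \<and>
          strong_lefschetz_property (RG_quot n p (young_subgroup n r Blk)))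
     \<and>
     (\<exists>U :: (4 \<Rightarrow> 'k) set set. zariski_open U \<and> U \<noteq> {} \<and>
        (\<forall>p. proj_point p \<in> U \<and>
             regular_sequence (R_alg n) (quadrics n p) \<and> e1 n ^ 2 \<notin> I_ideal n p \<longrightarrow>
               phi n p Blk ` carrier (R_alg r) = carrier (AG_alg n p (young_subgroup n r Blk))))
     \<and>
     (\<exists>U :: (4 \<Rightarrow> 'k) set set. zariski_open U \<and> U \<noteq> {} \<and>
        (\<forall>p. proj_point p \<in> U \<longrightarrow> standard_graded (AG_alg n p (young_subgroup n r Blk))))"
proof (intro conjI allI impI)
  fix p :: "4 \<Rightarrow> 'k"
  assume p: "regular_sequence (R_alg n) (quadrics n p) \<and> e1 n ^ 2 \<notin> I_ideal n p"
  then obtain s t where "quad_algebra n r Blk s t p"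
    using quad_algebraI[OF assms(2) regular_normal_quadrics[OF assms(1)]] by blast
  then interpret quad_algebra n r Blk s t p .
  show "complete_intersection (RG_quot n p (young_subgroup n r Blk))"
    "strong_lefschetz_property (RG_quot n p (young_subgroup n r Blk))"
    using complete_intersection_RG strong_lefschetz_RG p by blast+
next
  show "\<exists>U :: (4 \<Rightarrow> 'k) set set. zariski_open U \<and> U \<noteq> {} \<and>
        (\<forall>p. proj_point p \<in> U \<and>
             regular_sequence (R_alg n) (quadrics n p) \<and> e1 n ^ 2 \<notin> I_ideal n p \<longrightarrow>
               phi n p Blk ` carrier (R_alg r) = carrier (AG_alg n p (young_subgroup n r Blk)))"
  proof (intro exI[of _ "generic_locus n"] conjI allI impI)
    fix p :: "4 \<Rightarrow> 'k" assume "proj_point p \<in> generic_locus n \<and>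
      regular_sequence (R_alg n) (quadrics n p) \<and> e1 n ^ 2 \<notin> I_ideal n p"
    then obtain s t where "quad_algebra n r Blk s t p"
      using generic_quad_algebra[OF assms(2)] by blast
    then show "phi n p Blk ` carrier (R_alg r) = carrier (AG_alg n p (young_subgroup n r Blk))"
      by (rule quad_algebra.phi_image)
  qed (rule zariski_open_generic_locus generic_locus_nonempty)+
  show "\<exists>U :: (4 \<Rightarrow> 'k) set set. zariski_open U \<and> U \<noteq> {} \<and>
        (\<forall>p. proj_point p \<in> U \<longrightarrow> standard_graded (AG_alg n p (young_subgroup n r Blk)))"
  proof (intro exI[of _ "generic_locus n"] conjI allI impI)
    fix p :: "4 \<Rightarrow> 'k" assume "proj_point p \<in> generic_locus n"
    then obtain s t where "quad_algebra n r Blk s t p"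
      using generic_quad_algebra[OF assms(2)] by blast
    then show "standard_graded (AG_alg n p (young_subgroup n r Blk))"
      by (rule quad_algebra.standard_graded_AG)
  qed (rule zariski_open_generic_locus generic_locus_nonempty)+
qed

end
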